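(* Let $c>1$ be real, $n\in\mathbb{N}$, and $\varepsilon:=c-\lfloor c\rfloor\in[0,1)$. In the $c$-MultiQueue with $n$ queues, the rank error $E^{(s)}$ of the $s$-th deletion converges in distribution as $s\to\infty$ to a random variable $E$ (the long-run rank error), and: (i) For $c=2$: $\mathbb{E}[E]=\tfrac56 n-1+\tfrac{1}{6n}$. (ii) For $c=1+\varepsilon$ with $\varepsilon\in(0,1)$: $\mathbb{E}[E]=\left(\tfrac1\varepsilon-\tfrac\varepsilon6\right)n-\tfrac1\varepsilon+\tfrac{\varepsilon}{6n}$. (iii) For every $c>1$: \[ n\int_0^1 f_c(x)\,dx-\tfrac{c}{c-1}\le \mathbb{E}[E]\le n\int_0^1 f_c(x)\,dx,\] where $f_c:(0,1)\to\mathbb{R}$, $f_c(x)=x^{\lfloor c\rfloor-1}(1-\varepsilon+\varepsilon x)\cdot\dfrac{1-x^{\lfloor c\rfloor}(1-\varepsilon+\varepsilon x)}{1-x^{\lfloor c\rfloor-1}(1-\varepsilon+\varepsilon x)}$. (iv) For every $c\ge 2$: $\tfrac{n}{\lceil c\rceil}-\tfrac{c}{c-1}\le\mathbb{E}[E]\le\tfrac{n}{\lfloor c\rfloor-1}$.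
   Context: The $c$-MultiQueue with $n$ queues: take an infinite totally ordered set of elements $x_1<x_2<\cdots$ and assign each element independently and uniformly at random to one of $n$ priority queues. Each deletion (with fresh independent randomness) selects $\lfloor c\rfloor+1$ queues with probability $\varepsilon=c-\lfloor c\rfloor$ and $\lfloor c\rfloor$ queues otherwise, each selected independently and uniformly at random among the $n$ queues, and deletes the minimum element of the selected queue whose minimum is smallest. Equivalently, ordering the queues by their minima, the deleted queue is the $i$-th one with $\Pr[\text{index}\le i]=1-(1-\tfrac in)^{\lfloor c\rfloor}(1-\varepsilon\tfrac in)$. The rank error of a deletion is $r-1$, where $r$ is the rank of the deleted element among all elements present just before the deletion (smallest has rank $1$). *)

theory Defs
  imports "HOL-Probability.Probability"
begin

text \<open>The c-MultiQueue with n queues. Elements x_1 < x_2 < ... are represented by the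
natural numbers 0 < 1 < 2 < ... (element j stands for x_(j+1)); queues are 0,...,n-1.
One sample point omega :: nat => (nat * bool * (nat => nat)) bundles, for every index t,
  fst (omega t)               : the queue to which element t is assigned (uniform),
  fst (snd (omega t))         : whether deletion t selects floor c + 1 queues (prob. eps)
                                 or floor c queues,
  snd (snd (omega t)) j, j < floor c + 1 : i.i.d. uniform queue choices for deletion t
                                 (the first floor c resp. floor c + 1 of them are used).
All components are independent.\<close>

definition mq_floor :: "real \<Rightarrow> nat" where
  "mq_floor c = nat \<lfloor>c\<rfloor>"

definition mq_eps :: "real \<Rightarrow> real" where
  "mq_eps c = c - of_int \<lfloor>c\<rfloor>"

definition mq_step_pmf :: "real \<Rightarrow> nat \<Rightarrow> (nat \<times> bool \<times> (nat \<Rightarrow> nat)) pmf" where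
  "mq_step_pmf c n =
     pair_pmf (pmf_of_set {..<n})
       (pair_pmf (bernoulli_pmf (mq_eps c))
                 (Pi_pmf {..<mq_floor c + 1} 0 (\<lambda>_. pmf_of_set {..<n})))"

definition mq_space :: "real \<Rightarrow> nat \<Rightarrow> (nat \<Rightarrow> nat \<times> bool \<times> (nat \<Rightarrow> nat)) measure" where
  "mq_space c n = PiM UNIV (\<lambda>_. measure_pmf (mq_step_pmf c n))"

definition mq_selected :: "real \<Rightarrow> (nat \<Rightarrow> nat \<times> bool \<times> (nat \<Rightarrow> nat)) \<Rightarrow> nat \<Rightarrow> nat set" where
  "mq_selected c \<omega> s =
     snd (snd (\<omega> s)) ` {..<(if fst (snd (\<omega> s)) then mq_floor c + 1 else mq_floor c)}"

text \<open>The element removed, given the set D of already deleted elements: the minimum of the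
selected queue whose minimum is smallest, i.e. the smallest present element lying in a
selected queue.\<close>
definition mq_del_elem :: "real \<Rightarrow> (nat \<Rightarrow> nat \<times> bool \<times> (nat \<Rightarrow> nat)) \<Rightarrow> nat \<Rightarrow> nat set \<Rightarrow> nat" where
  "mq_del_elem c \<omega> s D = (LEAST j. j \<notin> D \<and> fst (\<omega> j) \<in> mq_selected c \<omega> s)"

fun mq_deleted :: "real \<Rightarrow> (nat \<Rightarrow> nat \<times> bool \<times> (nat \<Rightarrow> nat)) \<Rightarrow> nat \<Rightarrow> nat set" where
  "mq_deleted c \<omega> 0 = {}"
| "mq_deleted c \<omega> (Suc s) = insert (mq_del_elem c \<omega> s (mq_deleted c \<omega> s)) (mq_deleted c \<omega> s)"

text \<open>Rank error of deletion number s+1 (0-based index s): number of present elements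
smaller than the deleted one, i.e. rank - 1.\<close>
definition mq_rank_error :: "real \<Rightarrow> (nat \<Rightarrow> nat \<times> bool \<times> (nat \<Rightarrow> nat)) \<Rightarrow> nat \<Rightarrow> nat" where
  "mq_rank_error c \<omega> s =
     (let D = mq_deleted c \<omega> s in card {i. i \<notin> D \<and> i < mq_del_elem c \<omega> s D})"

definition mq_f :: "real \<Rightarrow> real \<Rightarrow> real" where
  "mq_f c x =
     (let m = mq_floor c; e = mq_eps c; g = 1 - e + e * x in
      x ^ (m - 1) * g * ((1 - x ^ m * g) / (1 - x ^ (m - 1) * g)))"

end

theory Submission
  imports Defs "HOL-Combinatorics.Permutations"
begin

text \<open>
  Keep only the word of queue labels of the elements still present. Order the queues by their minima.
  Every letter strictly between the i-th and the (i+1)-st minimum belongs to one of the first i queues,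
  and, given the positions of the minima, these letters are independent and uniform among those i
  queues; after the last minimum all letters are uniform. A deletion preserves this description, so the
  positions of the minima form a Markov chain.

  With P i the probability that the index of the deleted queue is at most i, the chain has a stationary
  law in which the labels are in uniformly random order and the numbers of letters in the gaps are
  independent, the i-th being geometric with ratio i / (n P i): fixing the queue that moved last and
  summing over its previous position, the balance equation telescopes. The initial law is of the same
  form with ratios i / n, hence dominated by a multiple of the stationary one, and a fixed state can be
  reached from everywhere; so the overlap of the current and the stationary law increases to 1.

  The stationary rank error has mean equal to the sum over 0 < i < n of (1 - P i) times the mean
  distance 1 / (1 - i / (n P i)) from the i-th to the next minimum, which is the sum of the values of
  f_c at j / n for 0 < j < n. Since f_c is increasing with limit c / (c - 1) at 1, comparing this
  Riemann sum with the integral gives the bounds.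
\<close>

section \<open>Convergence of Markov chains dominated by a stationary law\<close>

text \<open>The obstacle is the infinite state space: minima far to the right need arbitrarily many
  deletions to come back, so in general no lower bound on transition probabilities holds uniformly
  over all states. Domination replaces it. It passes from the initial law to all later laws; hence
  all of them put all but a small mass on one finite set, and there a common time and a positive
  chance of meeting in one state can be chosen.

  The ratio i / (n P i) is forced. Let a queue move right past a letter that is no minimum and has N
  other minima to its left. That letter belongs to another queue with probability N / (N + 1); in
  the earlier state N + 1 minima lay to its left, in the later one N. With these two changes the sum
  over the earlier positions telescopes for exactly this ratio.

  Stationarity needs one inequality only: two probability laws, one of which is pointwise at most
  the other, coincide. So transition probabilities need only be bounded from below.\<close>

definition overlap :: "'a pmf \<Rightarrow> 'a pmf \<Rightarrow> ennreal" where
  "overlap p q = (\<integral>\<^sup>+x. ennreal (min (pmf p x) (pmf q x)) \<partial>count_space UNIV)"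

lemma overlap_commute: "overlap p q = overlap q p"
  by (simp add: overlap_def min.commute)

lemma nn_integral_pmf_UNIV: "(\<integral>\<^sup>+x. ennreal (pmf p x) \<partial>count_space UNIV) = 1"
  using measure_pmf.emeasure_space_1[of p] by (simp add: nn_integral_pmf)

text \<open>Splits \<open>p\<close> into the part shared with \<open>q\<close> and the excess. The
  mass of the excess is the total variation distance, so \<open>overlap\<close> is one minus that
  distance.\<close>

lemma overlap_add_defect:
  "overlap p q + (\<integral>\<^sup>+x. ennreal (pmf p x - min (pmf p x) (pmf q x)) \<partial>count_space UNIV) = 1"
proof -
  have "overlap p q + (\<integral>\<^sup>+x. ennreal (pmf p x - min (pmf p x) (pmf q x)) \<partial>count_space UNIV)
     = (\<integral>\<^sup>+x. ennreal (pmf p x) \<partial>count_space UNIV)"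
    unfolding overlap_def
    by (subst nn_integral_add[symmetric]) (auto simp: ennreal_plus[symmetric] simp del: ennreal_plus)
  then show ?thesis by (simp add: nn_integral_pmf_UNIV)
qed

lemma overlap_le_1: "overlap p q \<le> 1"
  using overlap_add_defect[of p q] by (metis le_iff_add)

lemma overlap_less_top: "overlap p q < \<top>"
  by (rule le_less_trans[OF overlap_le_1 ennreal_one_less_top])

text \<open>The shared part and the excess pass through the kernel separately. The shared part
  contributes the same to the images of \<open>p\<close> and of \<open>q\<close>.\<close>

lemma pmf_bind_split:
  "ennreal (pmf (bind_pmf p K) y) =
     (\<integral>\<^sup>+x. ennreal (min (pmf p x) (pmf q x)) * ennreal (pmf (K x) y) \<partial>count_space UNIV) +
     (\<integral>\<^sup>+x. ennreal (pmf p x - min (pmf p x) (pmf q x)) * ennreal (pmf (K x) y) \<partial>count_space UNIV)"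
proof -
  have "ennreal (pmf (bind_pmf p K) y) = (\<integral>\<^sup>+x. ennreal (pmf p x) * ennreal (pmf (K x) y) \<partial>count_space UNIV)"
    by (simp add: ennreal_pmf_bind nn_integral_measure_pmf)
  also have "\<dots> = (\<integral>\<^sup>+x. ennreal (min (pmf p x) (pmf q x)) * ennreal (pmf (K x) y)
     + ennreal (pmf p x - min (pmf p x) (pmf q x)) * ennreal (pmf (K x) y) \<partial>count_space UNIV)"
    by (intro nn_integral_cong)
       (simp add: distrib_right[symmetric] ennreal_plus[symmetric] del: ennreal_plus)
  finally show ?thesis by (simp add: nn_integral_add)
qed

text \<open>Of the mass outside the overlap, each of the two laws sends at least a share \<open>\<delta>\<close> of what lies in
  \<open>F\<close> to the common point \<open>z\<close>, where it overlaps.\<close>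

lemma overlap_bind_gain:
  fixes p q :: "'a pmf" and K :: "'a \<Rightarrow> 'b pmf"
  assumes F: "finite F" "\<And>x. x \<in> F \<Longrightarrow> \<delta> \<le> pmf (K x) z" and \<delta>: "0 \<le> \<delta>"
    and p: "emeasure p (- F) \<le> \<eta>" and q: "emeasure q (- F) \<le> \<eta>"
  shows "overlap p q + ennreal \<delta> * (1 - overlap p q - \<eta>) \<le> overlap (bind_pmf p K) (bind_pmf q K)"
proof -
  define m where "m = (\<lambda>x. ennreal (min (pmf p x) (pmf q x)))"
  define g where "g = ennreal \<delta> * (1 - overlap p q - \<eta>)"
  \<comment> \<open>\<open>p\<close> and \<open>q\<close> are bound afresh here because the bound is
    used in both orders; \<open>g\<close> is the same number in both, the overlap being
    symmetric.\<close>
  have gain: "g \<le> (\<integral>\<^sup>+x. ennreal (pmf p x - min (pmf p x) (pmf q x)) * ennreal (pmf (K x) z) \<partial>count_space UNIV)"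
    if p: "emeasure p (- F) \<le> \<eta>" and g: "g = ennreal \<delta> * (1 - overlap p q - \<eta>)" for p q :: "'a pmf"
  proof -
    let ?d = "\<lambda>x. ennreal (pmf p x - min (pmf p x) (pmf q x))"
    have "1 = overlap p q + (\<integral>\<^sup>+x. ?d x \<partial>count_space UNIV)"
      using overlap_add_defect by metis
    also have "(\<integral>\<^sup>+x. ?d x \<partial>count_space UNIV) =
      (\<integral>\<^sup>+x. ?d x * indicator F x + ?d x * indicator (-F) x \<partial>count_space UNIV)"
      by (intro nn_integral_cong) (auto simp: indicator_def)
    also have "\<dots> = (\<integral>\<^sup>+x. ?d x * indicator F x \<partial>count_space UNIV) + (\<integral>\<^sup>+x. ?d x * indicator (-F) x \<partial>count_space UNIV)"
      by (simp add: nn_integral_add)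
    also have "(\<integral>\<^sup>+x. ?d x * indicator (-F) x \<partial>count_space UNIV) \<le> (\<integral>\<^sup>+x. ennreal (pmf p x) * indicator (-F) x \<partial>count_space UNIV)"
      by (intro nn_integral_mono mult_right_mono ennreal_leI) auto
    also have "\<dots> = emeasure p (-F)"
      by (simp add: nn_integral_count_space_indicator[symmetric] nn_integral_pmf)
    also note p
    finally have "1 \<le> overlap p q + ((\<integral>\<^sup>+x. ?d x * indicator F x \<partial>count_space UNIV) + \<eta>)"
      by (simp add: add_mono)
    then have "1 - overlap p q - \<eta> \<le> (\<integral>\<^sup>+x. ?d x * indicator F x \<partial>count_space UNIV)"
      using overlap_le_1[of p q]
      by (auto simp: ennreal_minus_le_iff ac_simps ennreal_minus_eq_top)
    then have "g \<le> ennreal \<delta> * (\<integral>\<^sup>+x. ?d x * indicator F x \<partial>count_space UNIV)"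
      unfolding g by (intro mult_left_mono) auto
    also have "\<dots> = (\<integral>\<^sup>+x. ennreal \<delta> * (?d x * indicator F x) \<partial>count_space UNIV)"
      by (simp add: nn_integral_cmult)
    also have "\<dots> \<le> (\<integral>\<^sup>+x. ?d x * ennreal (pmf (K x) z) \<partial>count_space UNIV)"
      by (intro nn_integral_mono) (auto simp: indicator_def mult.commute[of "ennreal \<delta>"] intro!: mult_left_mono ennreal_leI F)
    finally show ?thesis .
  qed
  have g1: "g \<le> (\<integral>\<^sup>+x. ennreal (pmf p x - min (pmf p x) (pmf q x)) * ennreal (pmf (K x) z) \<partial>count_space UNIV)"
    by (rule gain[OF p g_def])
  have g2: "g \<le> (\<integral>\<^sup>+x. ennreal (pmf q x - min (pmf q x) (pmf p x)) * ennreal (pmf (K x) z) \<partial>count_space UNIV)"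
    by (rule gain[OF q]) (simp add: g_def overlap_commute)
  have pt: "(\<integral>\<^sup>+x. m x * ennreal (pmf (K x) y) \<partial>count_space UNIV) + g * indicator {z} y
    \<le> ennreal (min (pmf (bind_pmf p K) y) (pmf (bind_pmf q K) y))" for y
  proof -
    have "(\<integral>\<^sup>+x. m x * ennreal (pmf (K x) y) \<partial>count_space UNIV) + g * indicator {z} y \<le> ennreal (pmf (bind_pmf p K) y)"
      unfolding pmf_bind_split[of p K y q] m_def using g1 by (intro add_left_mono) (auto simp: indicator_def)
    moreover have "(\<integral>\<^sup>+x. m x * ennreal (pmf (K x) y) \<partial>count_space UNIV) + g * indicator {z} y \<le> ennreal (pmf (bind_pmf q K) y)"
      unfolding pmf_bind_split[of q K y p] m_def min.commute[of "pmf p _"] using g2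
      by (intro add_left_mono) (auto simp: indicator_def)
    ultimately show ?thesis by (simp add: min_def)
  qed
  have "overlap p q + g = (\<integral>\<^sup>+x. m x * (\<integral>\<^sup>+y. ennreal (pmf (K x) y) \<partial>count_space UNIV) \<partial>count_space UNIV) + g"
    by (simp add: overlap_def m_def nn_integral_pmf_UNIV)
  also have "\<dots> = (\<integral>\<^sup>+x. (\<integral>\<^sup>+y. m x * ennreal (pmf (K x) y) \<partial>count_space UNIV) \<partial>count_space UNIV) + g"
    by (simp add: nn_integral_cmult)
  also have "\<dots> = (\<integral>\<^sup>+y. (\<integral>\<^sup>+x. m x * ennreal (pmf (K x) y) \<partial>count_space UNIV) \<partial>count_space UNIV) + g"
    using nn_integral_fst_count_space[of "\<lambda>(x,y). m x * ennreal (pmf (K x) y)"]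
      nn_integral_snd_count_space[of "\<lambda>(x,y). m x * ennreal (pmf (K x) y)"] by simp
  also have "g = (\<integral>\<^sup>+y. g * indicator {z} y \<partial>count_space UNIV)"
    by (simp add: nn_integral_cmult)
  also have "(\<integral>\<^sup>+y. (\<integral>\<^sup>+x. m x * ennreal (pmf (K x) y) \<partial>count_space UNIV) \<partial>count_space UNIV) + (\<integral>\<^sup>+y. g * indicator {z} y \<partial>count_space UNIV)
    = (\<integral>\<^sup>+y. (\<integral>\<^sup>+x. m x * ennreal (pmf (K x) y) \<partial>count_space UNIV) + g * indicator {z} y \<partial>count_space UNIV)"
    by (simp add: nn_integral_add)
  also have "\<dots> \<le> overlap (bind_pmf p K) (bind_pmf q K)"
    unfolding overlap_def by (intro nn_integral_mono pt)
  finally show ?thesis by (simp add: g_def)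
qed

text \<open>With an empty \<open>F\<close> there is no gain, and \<open>\<eta> = 1\<close> makes the
  tail conditions trivial.\<close>

lemma overlap_bind: "overlap p q \<le> overlap (bind_pmf p K) (bind_pmf q K)"
  using overlap_bind_gain[of "{}" 0 K undefined p 1 q] by (simp add: measure_pmf.emeasure_le_1)

text \<open>Pointwise: the minimum is at most \<open>pmf p\<close> on \<open>A\<close> and at most
  \<open>pmf q\<close> off \<open>A\<close>. This is the usual bound of the difference on an event
  by the total variation distance.\<close>

lemma overlap_measure_le:
  fixes p q :: "'a pmf"
  shows  "emeasure q A + overlap p q \<le> emeasure p A + 1"
proof -
  have "emeasure q A + overlap p q = (\<integral>\<^sup>+x. ennreal (pmf q x) * indicator A x + ennreal (min (pmf p x) (pmf q x)) \<partial>count_space UNIV)"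
    by (simp add: nn_integral_add overlap_def nn_integral_count_space_indicator[symmetric] nn_integral_pmf)
  also have "\<dots> \<le> (\<integral>\<^sup>+x. ennreal (pmf p x) * indicator A x + ennreal (pmf q x) \<partial>count_space UNIV)"
    by (intro nn_integral_mono) (auto simp: indicator_def ennreal_plus[symmetric] simp del: ennreal_plus intro!: ennreal_leI)
  also have "\<dots> = emeasure p A + 1"
    by (simp add: nn_integral_add nn_integral_count_space_indicator[symmetric] nn_integral_pmf nn_integral_pmf_UNIV)
  finally show ?thesis .
qed

lemma pmf_finite_tail:
  fixes p :: "'a pmf"
  assumes "e > 0"
  obtains F where "finite F" "F \<subseteq> set_pmf p" "measure p (-F) < e"
proof -
  let ?i = "to_nat_on (set_pmf p)"
  define A where "A k = {x \<in> set_pmf p. k \<le> ?i x}" for k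
  have "(\<lambda>k. measure p (A k)) \<longlonglongrightarrow> measure p (\<Inter>k. A k)"
    by (intro measure_pmf.finite_Lim_measure_decseq) (auto simp: A_def decseq_def)
  moreover have "(\<Inter>k. A k) = {}"
  proof -
    have "x \<notin> A (Suc (?i x))" for x by (simp add: A_def)
    then show ?thesis by blast
  qed
  ultimately have "\<forall>\<^sub>F k in sequentially. measure p (A k) < e"
    using assms by (auto dest: order_tendstoD)
  then obtain k where k: "measure p (A k) < e"
    by (auto simp: eventually_sequentially)
  have "finite (?i ` (set_pmf p - A k))"
    by (rule finite_subset[of _ "{..<k}"]) (auto simp: A_def)
  then have "finite (set_pmf p - A k)"
    by (rule finite_imageD) (meson Diff_subset countable_set_pmf inj_on_subset inj_on_to_nat_on)
  moreover have "measure p (- (set_pmf p - A k)) = measure p (A k)"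
    by (rule measure_pmf.finite_measure_eq_AE) (auto simp: AE_measure_pmf_iff)
  ultimately show ?thesis using k that by auto
qed

section \<open>Iteration of a Markov kernel and convergence of the overlap\<close>

definition mc_iter :: "('a \<Rightarrow> 'a pmf) \<Rightarrow> nat \<Rightarrow> 'a pmf \<Rightarrow> 'a pmf" where
  "mc_iter K s = (\<lambda>p. bind_pmf p K) ^^ s"

lemma mc_iter_0 [simp]: "mc_iter K 0 p = p"
  by (simp add: mc_iter_def)

lemma mc_iter_Suc: "mc_iter K (Suc s) p = bind_pmf (mc_iter K s p) K"
  by (simp add: mc_iter_def)

lemma mc_iter_Suc': "mc_iter K (Suc s) p = mc_iter K s (bind_pmf p K)"
  by (induction s) (simp_all add: mc_iter_Suc)

lemma mc_iter_add: "mc_iter K (s + t) p = mc_iter K t (mc_iter K s p)"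
  by (induction t) (simp_all add: mc_iter_Suc)

lemma mc_iter_bind: "mc_iter K s p = bind_pmf p (\<lambda>x. mc_iter K s (return_pmf x))"
  by (induction s) (simp_all add: mc_iter_Suc bind_return_pmf' bind_assoc_pmf)

lemma mc_iter_stationary: "bind_pmf p K = p \<Longrightarrow> mc_iter K s p = p"
  by (induction s) (simp_all add: mc_iter_Suc)

lemma emeasure_bind_pmf_le:
  fixes p q :: "'a pmf"
  assumes "\<And>A. emeasure p A \<le> ennreal C * emeasure q A"
  shows "emeasure (bind_pmf p K) B \<le> ennreal C * emeasure (bind_pmf q K) B"
proof -
  have "ennreal (pmf p x) \<le> ennreal C * ennreal (pmf q x)" for x
    using assms[of "{x}"] by (simp add: emeasure_pmf_single)
  then have "(\<integral>\<^sup>+x. ennreal (pmf p x) * emeasure (K x) B \<partial>count_space UNIV)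
    \<le> (\<integral>\<^sup>+x. ennreal C * (ennreal (pmf q x) * emeasure (K x) B) \<partial>count_space UNIV)"
    by (intro nn_integral_mono) (auto simp: mult.assoc[symmetric] intro!: mult_right_mono)
  then show ?thesis
    by (simp add: emeasure_bind_pmf nn_integral_measure_pmf nn_integral_cmult)
qed

lemma overlap_gap_measure:
  fixes p q :: "'a pmf"
  assumes "1 - e \<le> enn2real (overlap p q)"
  shows "\<bar>measure p A - measure q A\<bar> \<le> e"
proof -
  have "measure q A + enn2real (overlap p q) \<le> measure p A + 1" for p q :: "'a pmf" and A
  proof -
    have fin: "overlap p q \<noteq> \<top>"
      using overlap_less_top[of p q] by simp
    then obtain r where "overlap p q = ennreal r" "r \<ge> 0" by (cases "overlap p q") auto
    then show ?thesis using overlap_measure_le[of q A p]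
      by (simp add: measure_pmf.emeasure_eq_measure ennreal_plus[symmetric] ennreal_1[symmetric] del: ennreal_plus ennreal_1)
  qed
  from this[of q A p] this[of p A q] assms show ?thesis
    by (simp add: overlap_commute[of q p])
qed

text \<open>The overlap with \<pi> never decreases. If it stayed below 1 by a fixed amount, it would
  grow by a fixed amount in every block of \<open>L\<close> steps and finally exceed 1. Reachability
  of \<open>z\<close> at all large times lets one \<open>L\<close> serve every state of a finite
  set; it covers aperiodicity as well as irreducibility.\<close>

theorem mc_convergence_overlap:
  fixes \<pi> \<mu> :: "'a pmf" and K :: "'a \<Rightarrow> 'a pmf"
  assumes stat: "bind_pmf \<pi> K = \<pi>"
    and dom: "\<And>x. pmf \<mu> x \<le> C * pmf \<pi> x"
    and reach: "\<And>x. x \<in> set_pmf \<pi> \<Longrightarrow> \<exists>L0. \<forall>L\<ge>L0. z \<in> set_pmf (mc_iter K L (return_pmf x))"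
  shows "(\<lambda>s. enn2real (overlap (mc_iter K s \<mu>) \<pi>)) \<longlonglongrightarrow> 1"
proof -
  define ov where "ov s = enn2real (overlap (mc_iter K s \<mu>) \<pi>)" for s
  have ov: "overlap (mc_iter K s \<mu>) \<pi> = ennreal (ov s)" for s
    unfolding ov_def by (simp add: overlap_less_top)
  have ov0: "0 \<le> ov s" and ov1: "ov s \<le> 1" for s
    using overlap_le_1[of "mc_iter K s \<mu>" \<pi>] by (simp_all add: ov_def[symmetric] ov) (simp add: ov_def)
  have mono: "ov s \<le> ov (Suc s)" for s
    using overlap_bind[of "mc_iter K s \<mu>" \<pi> K] ov0 by (simp add: stat mc_iter_Suc[symmetric] ov)
  then have inc: "incseq ov" by (simp add: incseq_SucI)
  have C: "C \<ge> 0"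
  proof -
    obtain x where "x \<in> set_pmf \<pi>" using set_pmf_not_empty by fast
    then have "0 \<le> C * pmf \<pi> x" "0 < pmf \<pi> x"
      using order_trans[OF pmf_nonneg dom[of x]] pmf_positive[of x \<pi>] by auto
    then show ?thesis by (simp add: zero_le_mult_iff)
  qed
  \<comment> \<open>Domination by \<open>C\<close> times \<pi> persists because applying
    \<open>K\<close> leaves \<pi> fixed.\<close>
  have domE: "emeasure (mc_iter K s \<mu>) A \<le> ennreal C * emeasure \<pi> A" for s A
  proof (induction s arbitrary: A)
    case 0
    have "(\<integral>\<^sup>+x. ennreal (pmf \<mu> x) * indicator A x \<partial>count_space UNIV)
       \<le> (\<integral>\<^sup>+x. ennreal C * (ennreal (pmf \<pi> x) * indicator A x) \<partial>count_space UNIV)"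
      using C dom by (intro nn_integral_mono) (auto simp: indicator_def ennreal_mult'[symmetric])
    then show ?case
      by (simp add: nn_integral_cmult nn_integral_count_space_indicator[symmetric] nn_integral_pmf)
  next
    case (Suc s)
    then show ?case
      using emeasure_bind_pmf_le[of "mc_iter K s \<mu>" C \<pi> K A] by (simp add: mc_iter_Suc stat)
  qed
  have ex: "\<exists>s. 1 - ov s < e" if e: "e > 0" for e
  proof (rule ccontr)
    assume neg: "\<not> ?thesis"
    then have es: "e \<le> 1 - ov s" for s by (auto simp: not_less)
    \<comment> \<open>Half of the gap \<open>e\<close> is given up to the mass outside
      \<open>F\<close>; the rest of the excess, at least the other half, lies in
      \<open>F\<close>.\<close>
    define \<eta> where "\<eta> = e / 2"
    \<comment> \<open>The divisor \<open>C + 1\<close> makes the tail at most \<eta> both for \<pi>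
      and, after multiplication by \<open>C\<close>, for every law dominated by it.\<close>
    obtain F where F: "finite F" "F \<subseteq> set_pmf \<pi>" "measure \<pi> (-F) < \<eta> / (C + 1)"
      using pmf_finite_tail[of "\<eta> / (C + 1)" \<pi>] e C by (auto simp: \<eta>_def)
    have CF: "(C + 1) * measure \<pi> (-F) \<le> \<eta>"
      using F(3) C by (simp add: field_simps)
    from reach F(2) obtain L0 where L0: "\<And>x L. x \<in> F \<Longrightarrow> L \<ge> L0 x \<Longrightarrow> z \<in> set_pmf (mc_iter K L (return_pmf x))"
      by (metis subsetD)
    \<comment> \<open>One time that serves all states of \<open>F\<close>; the inserted 0, like the
      inserted 1 in \<delta> below, covers an empty \<open>F\<close>.\<close>
    define L where "L = Max (insert 0 (L0 ` F))"
    have L: "\<And>x. x \<in> F \<Longrightarrow> L0 x \<le> L"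
      using F(1) by (simp add: L_def)
    define \<delta> where "\<delta> = Min (insert 1 ((\<lambda>x. pmf (mc_iter K L (return_pmf x)) z) ` F))"
    have \<delta>: "\<delta> > 0"
      using F(1) L0 L by (auto simp: \<delta>_def pmf_positive)
    have step: "ov s + \<delta> * \<eta> \<le> ov (s + L)" for s
    proof -
      have "emeasure (mc_iter K s \<mu>) (-F) \<le> ennreal C * emeasure \<pi> (-F)" by (rule domE)
      also have "\<dots> \<le> ennreal \<eta>"
        using CF C order_trans[OF _ CF, of "C * measure \<pi> (-F)"]
        by (simp add: measure_pmf.emeasure_eq_measure ennreal_mult'[symmetric] distrib_right ennreal_leI)
      finally have 1: "emeasure (mc_iter K s \<mu>) (-F) \<le> ennreal \<eta>" .
      have "0 \<le> C * measure \<pi> (-F)"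
        using C by simp
      then have "measure \<pi> (-F) \<le> \<eta>"
        using CF by (simp add: distrib_right)
      then have 2: "emeasure \<pi> (-F) \<le> ennreal \<eta>"
        by (simp add: measure_pmf.emeasure_eq_measure ennreal_leI)
      have "overlap (mc_iter K s \<mu>) \<pi> + ennreal \<delta> * (1 - overlap (mc_iter K s \<mu>) \<pi> - ennreal \<eta>)
        \<le> overlap (bind_pmf (mc_iter K s \<mu>) (\<lambda>x. mc_iter K L (return_pmf x))) (bind_pmf \<pi> (\<lambda>x. mc_iter K L (return_pmf x)))"
        using F(1) \<delta> by (intro overlap_bind_gain[where z = z and F = F] 1 2) (auto simp: \<delta>_def)
      also have "\<dots> = ennreal (ov (s + L))"
        by (simp add: mc_iter_bind[symmetric] mc_iter_add[symmetric] mc_iter_stationary[OF stat] ov)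
      also have "overlap (mc_iter K s \<mu>) \<pi> + ennreal \<delta> * (1 - overlap (mc_iter K s \<mu>) \<pi> - ennreal \<eta>)
         = ennreal (ov s + \<delta> * (1 - ov s - \<eta>))"
      proof -
        have "1 - ov s - \<eta> \<ge> 0" using e es[of s] by (simp add: \<eta>_def)
        then show ?thesis
          using e \<delta> ov0 by (simp add: ov ennreal_1[symmetric] ennreal_minus ennreal_mult'[symmetric] ennreal_plus[symmetric] \<eta>_def
             del: ennreal_1 ennreal_plus)
      qed
      finally have "ov s + \<delta> * (1 - ov s - \<eta>) \<le> ov (s + L)"
        using ov0 by simp
      moreover have "\<delta> * \<eta> \<le> \<delta> * (1 - ov s - \<eta>)"
        using es[of s] \<delta> by (intro mult_left_mono) (auto simp: \<eta>_def)
      ultimately show ?thesis by simp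
    qed
    have "of_nat k * (\<delta> * \<eta>) \<le> ov (k * L)" for k
    proof (induction k)
      case (Suc k)
      then show ?case using step[of "k * L"] by (simp add: algebra_simps)
    qed (simp add: ov0)
    moreover have "\<delta> * \<eta> > 0" using \<delta> e by (simp add: \<eta>_def)
    then obtain k :: nat where "1 < of_nat k * (\<delta> * \<eta>)"
      using reals_Archimedean3 by blast
    ultimately show False using ov1 by (meson linorder_not_less order_trans)
  qed
  have "ov \<longlonglongrightarrow> 1"
  proof (rule LIMSEQ_I)
    fix e :: real assume "e > 0"
    then obtain s where s: "1 - ov s < e" using ex by blast
    then show "\<exists>no. \<forall>n\<ge>no. norm (ov n - 1) < e"
    proof (intro exI[of _ s] allI impI)
      fix k assume "s \<le> k"
      then have "ov s \<le> ov k" using inc by (rule incseqD[rotated])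
      then show "norm (ov k - 1) < e" using s ov1[of k] by (simp add: abs_if)
    qed
  qed
  then show ?thesis by (simp add: ov_def[abs_def])
qed

text \<open>A further kernel \<open>R\<close> that reads a value off the state cannot decrease the
  overlap either.\<close>

corollary mc_convergence:
  fixes \<pi> \<mu> :: "'a pmf" and K :: "'a \<Rightarrow> 'a pmf" and R :: "'a \<Rightarrow> 'b pmf"
  assumes "bind_pmf \<pi> K = \<pi>"
    and "\<And>x. pmf \<mu> x \<le> C * pmf \<pi> x"
    and "\<And>x. x \<in> set_pmf \<pi> \<Longrightarrow> \<exists>L0. \<forall>L\<ge>L0. z \<in> set_pmf (mc_iter K L (return_pmf x))"
  shows "(\<lambda>s. measure (bind_pmf (mc_iter K s \<mu>) R) A) \<longlonglongrightarrow> measure (bind_pmf \<pi> R) A"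
proof -
  let ?o = "\<lambda>s. enn2real (overlap (mc_iter K s \<mu>) \<pi>)"
  have "(\<lambda>s. 1 - ?o s) \<longlonglongrightarrow> 1 - 1"
    by (intro tendsto_intros mc_convergence_overlap[OF assms])
  then have lim: "(\<lambda>s. 1 - ?o s) \<longlonglongrightarrow> 0" by simp
  have bound: "norm (measure (bind_pmf (mc_iter K s \<mu>) R) A - measure (bind_pmf \<pi> R) A) \<le> 1 - ?o s" for s
  proof -
    have "?o s \<le> enn2real (overlap (bind_pmf (mc_iter K s \<mu>) R) (bind_pmf \<pi> R))"
      by (intro enn2real_mono overlap_bind overlap_less_top)
    then show ?thesis
      by (simp add: overlap_gap_measure)
  qed
  have "(\<lambda>s. measure (bind_pmf (mc_iter K s \<mu>) R) A - measure (bind_pmf \<pi> R) A) \<longlonglongrightarrow> 0"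
    by (rule Lim_null_comparison[OF always_eventually[OF allI[OF bound]] lim])
  then show ?thesis by (rule LIM_zero_cancel)
qed

section \<open>Words with independent letters\<close>

definition word_measure :: "(nat \<Rightarrow> nat set) \<Rightarrow> (nat \<Rightarrow> nat) measure" where
  "word_measure A = PiM UNIV (\<lambda>t. measure_pmf (pmf_of_set (A t)))"

abbreviation word_space :: "(nat \<Rightarrow> nat) measure" where
  "word_space \<equiv> PiM UNIV (\<lambda>_. count_space UNIV)"

lemma prob_space_word_measure: "prob_space (word_measure A)"
  unfolding word_measure_def by (intro prob_space_PiM) (simp add: prob_space_measure_pmf)

lemma sets_word_measure [measurable_cong]: "sets (word_measure A) = sets word_space"
  unfolding word_measure_def by (intro sets_PiM_cong) auto

lemma space_word_measure [simp]: "space (word_measure A) = UNIV"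
  unfolding word_measure_def by (auto simp: space_PiM)

lemma UNIV_sets_word_measure [simp, measurable]: "UNIV \<in> sets (word_measure A)"
  using sets.top[of "word_measure A"] by simp

lemma emeasure_word_measure_Collect:
  assumes "finite J"
  shows "emeasure (word_measure A) {w. \<forall>i\<in>J. w i \<in> X i} = (\<Prod>i\<in>J. emeasure (measure_pmf (pmf_of_set (A i))) (X i))"
proof -
  interpret product_prob_space "\<lambda>t. measure_pmf (pmf_of_set (A t))" UNIV
    by unfold_locales
  show ?thesis
    using emeasure_PiM_Collect[of J X] assms by (simp add: word_measure_def[symmetric])
qed

text \<open>Conditioning an independent uniform letter of \<open>A t\<close> on lying in
  \<open>B t\<close> makes it uniform on \<open>B t\<close>. Restriction to the box and rescaling
  are compared as measures on cylinder sets; the bound \<open>b\<close> keeps the weight a finite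
  product.\<close>

lemma word_box:
  assumes A: "\<And>t. finite (A t)" "\<And>t. B t \<subseteq> A t" "\<And>t. B t \<noteq> {}" and b: "\<And>t. b \<le> t \<Longrightarrow> B t = A t"
    and X: "X \<in> sets word_space"
  shows "emeasure (word_measure A) ({w. \<forall>t<b. w t \<in> B t} \<inter> X) =
     ennreal (\<Prod>t<b. card (B t) / card (A t)) * emeasure (word_measure B) X"
proof -
  let ?box = "{w. \<forall>t<b. w t \<in> B t}"
  let ?W = "ennreal (\<Prod>t<b. card (B t) / card (A t))"
  have "{w \<in> space word_space. \<forall>t<b. w t \<in> B t} \<in> sets word_space"
    by measurable
  then have box[measurable]: "?box \<in> sets word_space"
    by (simp add: space_PiM)
  define w where "w i = (if i < b then card (B i) / card (A i) else 1)" for i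
  have fin: "finite (A t)" "A t \<noteq> {}" "finite (B t)" "B t \<noteq> {}" for t
    using A(1)[of t] A(2)[of t] A(3)[of t] by (auto intro: finite_subset)
  have cp: "card (A t) > 0" "card (B t) > 0" for t using fin by (auto simp: card_gt_0_iff)
  have one: "emeasure (measure_pmf (pmf_of_set (A i))) ((if i < b then B i else UNIV) \<inter> E)
      = ennreal (w i) * emeasure (measure_pmf (pmf_of_set (B i))) E" for i E
  proof (cases "i < b")
    case True
    have "A i \<inter> (B i \<inter> E) = B i \<inter> E" using A(2) by blast
    then show ?thesis using True fin cp
      by (simp add: emeasure_pmf_of_set w_def ennreal_mult'[symmetric])
  next
    case False
    then show ?thesis using b[of i] by (simp add: w_def)
  qed
  have "density (word_measure A) (indicator ?box) = scale_measure ?W (word_measure B)"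
  proof (rule measure_eqI_PiM_infinite[where I = UNIV and M = "\<lambda>_. count_space UNIV"])
    show "finite_measure (density (word_measure A) (indicator ?box))"
    proof
      have "emeasure (word_measure A) ?box \<le> 1"
        using prob_space.emeasure_le_1[OF prob_space_word_measure] .
      then show "emeasure (density (word_measure A) (indicator ?box)) (space (density (word_measure A) (indicator ?box))) \<noteq> \<infinity>"
        using le_less_trans[OF _ ennreal_one_less_top]
        by (simp add: emeasure_density top.not_eq_extremum)
    qed
    fix E :: "nat \<Rightarrow> nat set" and J :: "nat set" assume J: "finite J"
    let ?G = "\<lambda>i. (if i < b then B i else UNIV) \<inter> (if i \<in> J then E i else UNIV)"
    let ?U = "J \<union> {..<b}"
    have emb: "prod_emb UNIV (\<lambda>_. count_space UNIV) J (Pi\<^sub>E J E) = {w. \<forall>i\<in>J. w i \<in> E i}"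
      by (auto simp: prod_emb_def PiE_iff)
    have "{w \<in> space word_space. \<forall>i\<in>J. w i \<in> E i} \<in> sets word_space"
      using J by measurable
    then have [measurable]: "{w. \<forall>i\<in>J. w i \<in> E i} \<in> sets word_space"
      by (simp add: space_PiM)
    have "emeasure (density (word_measure A) (indicator ?box)) {w. \<forall>i\<in>J. w i \<in> E i}
      = emeasure (word_measure A) (?box \<inter> {w. \<forall>i\<in>J. w i \<in> E i})"
      by (simp add: emeasure_density indicator_inter_arith[symmetric])
    also have "?box \<inter> {w. \<forall>i\<in>J. w i \<in> E i} = {w. \<forall>i\<in>?U. w i \<in> ?G i}"
      by auto
    also have "emeasure (word_measure A) \<dots> = (\<Prod>i\<in>?U. ennreal (w i) * emeasure (measure_pmf (pmf_of_set (B i))) (if i \<in> J then E i else UNIV))"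
      using J by (simp only: emeasure_word_measure_Collect one finite_Un finite_lessThan simp_thms)
    also have "\<dots> = (\<Prod>i\<in>?U. ennreal (w i)) * (\<Prod>i\<in>?U. emeasure (measure_pmf (pmf_of_set (B i))) (if i \<in> J then E i else UNIV))"
      by (simp add: prod.distrib)
    also have "(\<Prod>i\<in>?U. ennreal (w i)) = (\<Prod>i<b. ennreal (w i))"
      using J by (intro prod.mono_neutral_right) (auto simp: w_def)
    also have "\<dots> = ?W"
      by (subst prod_ennreal) (auto simp: w_def)
    also have "(\<Prod>i\<in>?U. emeasure (measure_pmf (pmf_of_set (B i))) (if i \<in> J then E i else UNIV))
      = (\<Prod>i\<in>J. emeasure (measure_pmf (pmf_of_set (B i))) (E i))"
      using J measure_pmf.emeasure_space_1 by (intro prod.mono_neutral_cong_right) auto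
    also have "\<dots> = emeasure (word_measure B) {w. \<forall>i\<in>J. w i \<in> E i}"
      using J by (simp add: emeasure_word_measure_Collect)
    finally show "emeasure (density (word_measure A) (indicator ?box)) (prod_emb UNIV (\<lambda>_. count_space UNIV) J (Pi\<^sub>E J E)) =
      emeasure (scale_measure ?W (word_measure B)) (prod_emb UNIV (\<lambda>_. count_space UNIV) J (Pi\<^sub>E J E))"
      by (simp add: emb)
  qed (auto simp: sets_word_measure)
  then have "emeasure (density (word_measure A) (indicator ?box)) X = ?W * emeasure (word_measure B) X"
    by simp
  then show ?thesis using X by (simp add: emeasure_density indicator_inter_arith[symmetric])
qed

text \<open>The boxes are disjoint events with probabilities \<open>pmf \<nu> i\<close>, which add
  up to 1, so they cover almost every word, and \<open>word_box\<close> gives the conditional law in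
  each. Covering is obtained indirectly: the mixture is below \<open>word_measure A\<close> on every
  event and on its complement.\<close>

lemma word_mixture:
  fixes \<nu> :: "'i pmf" and b :: "'i \<Rightarrow> nat"
  assumes A: "\<And>t. finite (A t)"
    and B: "\<And>i t. i \<in> set_pmf \<nu> \<Longrightarrow> B i t \<subseteq> A t" "\<And>i t. i \<in> set_pmf \<nu> \<Longrightarrow> B i t \<noteq> {}"
    and b: "\<And>i t. i \<in> set_pmf \<nu> \<Longrightarrow> b i \<le> t \<Longrightarrow> B i t = A t"
    and wt: "\<And>i. i \<in> set_pmf \<nu> \<Longrightarrow> pmf \<nu> i = (\<Prod>t<b i. real (card (B i t)) / real (card (A t)))"
    and disj: "\<And>i j w. i \<in> set_pmf \<nu> \<Longrightarrow> j \<in> set_pmf \<nu> \<Longrightarrow> (\<And>t. t < b i \<Longrightarrow> w t \<in> B i t) \<Longrightarrow> (\<And>t. t < b j \<Longrightarrow> w t \<in> B j t) \<Longrightarrow> i = j"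
    and f [measurable]: "f \<in> borel_measurable word_space"
  shows "(\<integral>\<^sup>+w. f w \<partial>word_measure A) = (\<integral>\<^sup>+i. (\<integral>\<^sup>+w. f w \<partial>word_measure (B i)) \<partial>\<nu>)"
proof -
  let ?box = "\<lambda>i. {w. \<forall>t<b i. w t \<in> B i t}"
  have "{w \<in> space word_space. \<forall>t<b i. w t \<in> B i t} \<in> sets word_space" for i
    by measurable
  then have box[measurable]: "?box i \<in> sets word_space" for i
    by (simp add: space_PiM)
  define Q where "Q = measure_pmf \<nu> \<bind> (\<lambda>i. word_measure (B i))"
  have meas: "(\<lambda>i. word_measure (B i)) \<in> measurable (measure_pmf \<nu>) (subprob_algebra word_space)"
    by (auto simp: space_subprob_algebra sets_word_measure prob_space_imp_subprob_space prob_space_word_measure)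
  have setsQ: "sets Q = sets word_space"
    unfolding Q_def by (rule sets_bind) (auto simp: sets_word_measure)
  have EQ: "emeasure Q X = (\<integral>\<^sup>+i. emeasure (word_measure (B i)) X \<partial>\<nu>)" if "X \<in> sets word_space" for X
    unfolding Q_def by (rule emeasure_bind[OF _ meas that]) simp
  have le: "emeasure Q X \<le> emeasure (word_measure A) X" if X[measurable]: "X \<in> sets word_space" for X
  proof -
    have "emeasure Q X = (\<integral>\<^sup>+i. ennreal (pmf \<nu> i) * emeasure (word_measure (B i)) X \<partial>count_space UNIV)"
      by (simp add: EQ[OF X] nn_integral_measure_pmf)
    also have "\<dots> = (\<integral>\<^sup>+i. ennreal (pmf \<nu> i) * emeasure (word_measure (B i)) X \<partial>count_space (set_pmf \<nu>))"
      by (subst (2) nn_integral_count_space_indicator)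
         (auto intro!: nn_integral_cong simp: indicator_def set_pmf_iff)
    also have "\<dots> = (\<integral>\<^sup>+i. emeasure (word_measure A) (?box i \<inter> X) \<partial>count_space (set_pmf \<nu>))"
    proof (intro nn_integral_cong)
      fix i assume "i \<in> space (count_space (set_pmf \<nu>))"
      then have i: "i \<in> set_pmf \<nu>" by simp
      show "ennreal (pmf \<nu> i) * emeasure (word_measure (B i)) X = emeasure (word_measure A) (?box i \<inter> X)"
        unfolding wt[OF i] by (rule word_box[symmetric]) (use A B[OF i] b[OF i] X in auto)
    qed
    also have "\<dots> = emeasure (word_measure A) (\<Union>i\<in>set_pmf \<nu>. ?box i \<inter> X)"
      by (intro emeasure_UN_countable[symmetric])
         (auto simp: disjoint_family_on_def sets_word_measure intro: disj)
    also have "\<dots> \<le> emeasure (word_measure A) X"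
      by (intro emeasure_mono) (auto simp: sets_word_measure)
    finally show ?thesis .
  qed
  have "Q = word_measure A"
  proof (rule measure_eqI)
    interpret P: prob_space "word_measure A" by (rule prob_space_word_measure)
    fix X assume "X \<in> sets Q"
    then have X: "X \<in> sets word_space" by (simp add: setsQ)
    have cX: "UNIV - X \<in> sets word_space"
      using sets.compl_sets[OF X] by (simp add: space_PiM)
    have spQ: "space Q = UNIV" using sets_eq_imp_space_eq[OF setsQ] by (simp add: space_PiM)
    have "emeasure Q UNIV = 1"
      using EQ[of UNIV] prob_space.emeasure_space_1[OF prob_space_word_measure] sets.top[of word_space]
      by (simp add: space_PiM)
    then interpret Q: prob_space Q by (intro prob_spaceI) (simp add: spQ)
    have "measure Q X \<le> P.prob X" "Q.prob (UNIV - X) \<le> P.prob (UNIV - X)"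
      using le[OF X] le[OF cX] by (simp_all add: P.emeasure_eq_measure Q.emeasure_eq_measure)
    moreover have "Q.prob (UNIV - X) = 1 - Q.prob X" "P.prob (UNIV - X) = 1 - P.prob X"
      using Q.prob_compl[of X] P.prob_compl[of X] X by (simp_all add: spQ setsQ sets_word_measure)
    ultimately show "emeasure Q X = emeasure (word_measure A) X"
      by (simp add: P.emeasure_eq_measure Q.emeasure_eq_measure)
  qed (simp add: setsQ sets_word_measure)
  then show ?thesis
    using nn_integral_bind[OF f meas] by (simp add: Q_def)
qed

text \<open>Increasing enumeration of all positions except \<open>e\<close>: the word
  \<open>w\<close> without its letter at \<open>e\<close> is
  \<open>\<lambda>t. w (skip e t)\<close>.\<close>

definition skip :: "nat \<Rightarrow> nat \<Rightarrow> nat" where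
  "skip e t = (if t < e then t else Suc t)"

lemma inj_skip: "inj (skip e)"
  by (auto simp: inj_def skip_def split: if_splits)

lemma skip_neq [simp]: "skip e u \<noteq> e" "e \<noteq> skip e u"
  by (simp_all add: skip_def)

lemma skip_less_iff [simp]: "skip e u < skip e v \<longleftrightarrow> u < v"
  by (auto simp: skip_def)

lemma skip_eq_iff [simp]: "skip e u = skip e v \<longleftrightarrow> u = v"
  using inj_skip by (auto simp: inj_def)

lemma skip_less_self_iff: "skip e u < e \<longleftrightarrow> u < e"
  by (auto simp: skip_def)

lemma self_less_skip_iff: "e < skip e u \<longleftrightarrow> e \<le> u"
  by (auto simp: skip_def)

lemma nn_integral_word_skip:
  assumes f [measurable]: "f \<in> borel_measurable word_space"
  shows "(\<integral>\<^sup>+w. f (\<lambda>t. w (skip e t)) \<partial>word_measure A) = (\<integral>\<^sup>+w. f w \<partial>word_measure (\<lambda>t. A (skip e t)))"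
proof -
  have 1: "distr (word_measure A) (word_measure (\<lambda>t. A (skip e t))) (\<lambda>w. \<lambda>t\<in>UNIV. w (skip e t)) = word_measure (\<lambda>t. A (skip e t))"
    unfolding word_measure_def
    by (intro distr_PiM_reindex) (auto simp: prob_space_measure_pmf inj_skip)
  have "(\<integral>\<^sup>+w. f w \<partial>word_measure (\<lambda>t. A (skip e t))) =
     (\<integral>\<^sup>+w. f w \<partial>distr (word_measure A) (word_measure (\<lambda>t. A (skip e t))) (\<lambda>w. \<lambda>t\<in>UNIV. w (skip e t)))"
    by (simp only: 1)
  also have "\<dots> = (\<integral>\<^sup>+w. f (\<lambda>t\<in>UNIV. w (skip e t)) \<partial>word_measure A)"
    by (rule nn_integral_distr) (auto simp: sets_word_measure cong: measurable_cong_sets)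
  finally show ?thesis by (simp add: restrict_UNIV)
qed

lemma AE_word_measure:
  assumes "\<And>t. finite (A t)" "\<And>t. A t \<noteq> {}"
  shows "AE w in word_measure A. \<forall>t. w t \<in> A t"
  unfolding word_measure_def AE_all_countable
  using assms by (intro allI AE_PiM_component) (auto simp: prob_space_measure_pmf AE_measure_pmf_iff)

section \<open>One deletion\<close>

text \<open>Law of the first success in independent trials, trial \<open>u\<close> succeeding with
  probability \<open>a u\<close>. The function sums to 1 exactly if success is almost sure, whence
  the limit condition in \<open>pmf_first_hit\<close>.\<close>

definition first_hit :: "(nat \<Rightarrow> real) \<Rightarrow> nat pmf" where
  "first_hit a = embed_pmf (\<lambda>k. a k * (\<Prod>u<k. 1 - a u))"

lemma pmf_first_hit:
  assumes a: "\<And>u. 0 \<le> a u" "\<And>u. a u \<le> 1" and lim: "(\<lambda>k. \<Prod>u<k. 1 - a u) \<longlonglongrightarrow> 0"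
  shows "pmf (first_hit a) k = a k * (\<Prod>u<k. 1 - a u)"
  unfolding first_hit_def
proof (rule pmf_embed_pmf)
  show nonneg: "0 \<le> a k * (\<Prod>u<k. 1 - a u)" for k
    using a by (intro mult_nonneg_nonneg prod_nonneg) auto
  have "(\<Sum>k<m. a k * (\<Prod>u<k. 1 - a u)) = 1 - (\<Prod>u<m. 1 - a u)" for m
    by (induction m) (auto simp: algebra_simps)
  moreover have "(\<lambda>m. 1 - (\<Prod>u<m. 1 - a u)) \<longlonglongrightarrow> 1 - 0"
    by (intro tendsto_intros lim)
  ultimately have "(\<lambda>k. a k * (\<Prod>u<k. 1 - a u)) sums 1"
    by (simp add: sums_def)
  then show "(\<integral>\<^sup>+k. ennreal (a k * (\<Prod>u<k. 1 - a u)) \<partial>count_space UNIV) = 1"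
    unfolding nn_integral_count_space_nat by (subst suminf_ennreal_eq[OF nonneg]) simp_all
qed

text \<open>A state \<open>q\<close> maps each queue \<open>y < n\<close> to the position of its minimum in the word of present elements
  (and every other argument to 0). The letter at position \<open>t\<close> is then uniform on \<open>letters n q t\<close>.\<close>

definition letters :: "nat \<Rightarrow> (nat \<Rightarrow> nat) \<Rightarrow> nat \<Rightarrow> nat set" where
  "letters n q t = (if t \<in> q ` {..<n} then {y. y < n \<and> q y = t} else {y. y < n \<and> q y < t})"

text \<open>Position 0 always carries a minimum, since the smallest present element is the smallest
  of its queue. The values from \<open>n\<close> on are fixed so that equal positions mean equal
  functions.\<close>

definition mq_valid :: "nat \<Rightarrow> (nat \<Rightarrow> nat) \<Rightarrow> bool" where
  "mq_valid n q \<longleftrightarrow> inj_on q {..<n} \<and> 0 \<in> q ` {..<n} \<and> (\<forall>y\<ge>n. q y = 0)"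

text \<open>The minimum of queue \<open>x\<close> is deleted and its next element is found at position \<open>k\<close> of the shortened word.\<close>

definition mq_move :: "nat \<Rightarrow> (nat \<Rightarrow> nat) \<Rightarrow> nat \<Rightarrow> nat \<Rightarrow> nat \<Rightarrow> nat" where
  "mq_move n q x k = (\<lambda>y. if n \<le> y then 0 else if y = x then k else if q x < q y then q y - 1 else q y)"

text \<open>The letter sets are those of the state before the deletion, read in the shortened word.
  The value is 0 left of the deleted minimum, where queue \<open>x\<close> has no element, and at
  the minima of other queues.\<close>

definition hit_prob :: "nat \<Rightarrow> (nat \<Rightarrow> nat) \<Rightarrow> nat \<Rightarrow> nat \<Rightarrow> real" where
  "hit_prob n q x u = (if x \<in> letters n q (skip (q x) u) then 1 / card (letters n q (skip (q x) u)) else 0)"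

definition mq_hit :: "nat \<Rightarrow> (nat \<Rightarrow> nat) \<Rightarrow> nat \<Rightarrow> nat pmf" where
  "mq_hit n q x = first_hit (hit_prob n q x)"

lemma finite_letters [simp]: "finite (letters n q t)"
  by (auto simp: letters_def)

lemma letters_nonempty:
  assumes "mq_valid n q" shows "letters n q t \<noteq> {}"
proof -
  obtain y where "y < n" "q y = 0" using assms by (auto simp: mq_valid_def)
  then show ?thesis by (cases "t = 0") (auto simp: letters_def)
qed

lemma hit_prob_bounds: "0 \<le> hit_prob n q x u" "hit_prob n q x u \<le> 1"
proof -
  show "0 \<le> hit_prob n q x u" by (simp add: hit_prob_def)
  have "card (letters n q (skip (q x) u)) \<ge> 1" if "x \<in> letters n q (skip (q x) u)"
    using that by (simp add: Suc_le_eq card_gt_0_iff) auto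
  then show "hit_prob n q x u \<le> 1" by (auto simp: hit_prob_def)
qed

text \<open>Right of all minima each letter is uniform over the \<open>n\<close> queues, so the
  chance of not having met \<open>x\<close> decays like a power of 1 - 1/n and the first hit is
  almost surely finite.\<close>

lemma pmf_mq_hit:
  assumes "x < n"
  shows "pmf (mq_hit n q x) k = hit_prob n q x k * (\<Prod>u<k. 1 - hit_prob n q x u)"
  unfolding mq_hit_def
proof (rule pmf_first_hit[OF hit_prob_bounds])
  define B where "B = Max (q ` {..<n})"
  have B: "q y \<le> B" if "y < n" for y using that by (auto simp: B_def)
  have hp: "hit_prob n q x u = 1 / n" if "B \<le> u" for u
  proof -
    have "skip (q x) u = Suc u" using B[OF assms] that by (simp add: skip_def)
    moreover have less: "q y < Suc u" if "y < n" for y using B[OF that] \<open>B \<le> u\<close> by simp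
    then have "Suc u \<notin> q ` {..<n}" by (metis imageE lessThan_iff less_irrefl)
    then have "letters n q (Suc u) = {..<n}" using less by (auto simp: letters_def)
    ultimately show ?thesis using assms by (simp add: hit_prob_def)
  qed
  have nonneg: "0 \<le> (\<Prod>u<k. 1 - hit_prob n q x u)" for k
    by (intro prod_nonneg) (simp add: hit_prob_bounds)
  have bound: "(\<Prod>u<k + B. 1 - hit_prob n q x u) \<le> (1 - 1 / n) ^ k" for k
  proof (induction k)
    case 0
    show ?case by (auto intro!: prod_le_1 simp: hit_prob_bounds)
  next
    case (Suc k)
    then show ?case using assms by (simp add: hp mult.commute mult_left_mono)
  qed
  have lim: "(\<lambda>k. (1 - 1 / real n) ^ k) \<longlonglongrightarrow> 0"
    using assms by (intro LIMSEQ_realpow_zero) auto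
  have "(\<lambda>k. \<Prod>u<k + B. 1 - hit_prob n q x u) \<longlonglongrightarrow> 0"
    by (rule tendsto_sandwich[OF always_eventually[OF allI[OF nonneg]] always_eventually[OF allI[OF bound]] tendsto_const lim])
  then show "(\<lambda>k. \<Prod>u<k. 1 - hit_prob n q x u) \<longlonglongrightarrow> 0" by (rule LIMSEQ_offset)
qed

lemma mq_move_eq_iff: "y < n \<Longrightarrow> y \<noteq> x \<Longrightarrow> q y \<noteq> q x \<Longrightarrow> mq_move n q x k y = u \<longleftrightarrow> q y = skip (q x) u"
  by (auto simp: mq_move_def skip_def)

lemma mq_move_less_iff: "y < n \<Longrightarrow> y \<noteq> x \<Longrightarrow> q y \<noteq> q x \<Longrightarrow> mq_move n q x k y < u \<longleftrightarrow> q y < skip (q x) u"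
  by (auto simp: mq_move_def skip_def)

lemma mq_move_self [simp]: "x < n \<Longrightarrow> mq_move n q x k x = k"
  by (simp add: mq_move_def)

text \<open>Knowing that \<open>x\<close> first occurs at position \<open>k\<close> of the shortened
  word excludes \<open>x\<close> before \<open>k\<close>, fixes it at \<open>k\<close> and says
  nothing about later letters. The new letter sets are exactly those conditioned sets, which makes
  the description of words by states closed under deletions.\<close>

lemma letters_move:
  assumes q: "inj_on q {..<n}" and x: "x < n" and hit: "x \<in> letters n q (skip (q x) k)"
  shows "letters n (mq_move n q x k) u =
    (if u < k then letters n q (skip (q x) u) - {x} else if u = k then {x} else letters n q (skip (q x) u))"
proof -
  let ?q = "mq_move n q x k" and ?e = "q x"
  have ne: "q y \<noteq> ?e" if "y < n" "y \<noteq> x" for y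
    using q x that by (auto simp: inj_on_def)
  have eq: "?q y = v \<longleftrightarrow> q y = skip ?e v" if "y < n" "y \<noteq> x" for y v
    using mq_move_eq_iff[OF that ne[OF that]] .
  have less: "?q y < v \<longleftrightarrow> q y < skip ?e v" if "y < n" "y \<noteq> x" for y v
    using mq_move_less_iff[OF that ne[OF that]] .
  have tok: "skip ?e v \<in> q ` {..<n} \<longleftrightarrow> (\<exists>y<n. y \<noteq> x \<and> ?q y = v)" for v
  proof
    assume "skip ?e v \<in> q ` {..<n}"
    then obtain y where y: "y < n" "q y = skip ?e v" by auto
    then have "y \<noteq> x" using skip_neq(1)[of ?e v] by metis
    then show "\<exists>y<n. y \<noteq> x \<and> ?q y = v" using y eq by auto
  next
    assume "\<exists>y<n. y \<noteq> x \<and> ?q y = v"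
    then obtain y where y: "y < n" "y \<noteq> x" "?q y = v" by blast
    then have "q y = skip ?e v" using eq by blast
    then show "skip ?e v \<in> q ` {..<n}" using y(1) by (metis imageI lessThan_iff)
  qed
  have nk: "?q y \<noteq> k" if "y < n" "y \<noteq> x" for y
  proof -
    have "skip ?e k \<notin> q ` {..<n}" using hit by (auto simp: letters_def split: if_splits)
    then show ?thesis using eq[OF that, of k] that(1) by (metis imageI lessThan_iff)
  qed
  have ek: "?e \<le> k"
    using hit by (auto simp: letters_def skip_def split: if_splits)
  consider "u = k" | "u \<noteq> k" "\<exists>y<n. y \<noteq> x \<and> ?q y = u" | "u \<noteq> k" "\<not> (\<exists>y<n. y \<noteq> x \<and> ?q y = u)"
    by blast
  then show ?thesis
  proof cases
    case 1
    then have "u \<in> ?q ` {..<n}" using x by (auto intro!: image_eqI[of _ _ x])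
    then show ?thesis using 1 x nk by (auto simp: letters_def)
  next
    case 2
    then have "u \<in> ?q ` {..<n}" "skip ?e u \<in> q ` {..<n}" using tok by auto
    then have "letters n ?q u = {y. y < n \<and> y \<noteq> x \<and> q y = skip ?e u}" "letters n q (skip ?e u) = {y. y < n \<and> y \<noteq> x \<and> q y = skip ?e u}"
    proof -
      have a: "?q y = u \<longleftrightarrow> y \<noteq> x \<and> q y = skip ?e u" if "y < n" for y
        using eq[OF that] 2(1) x by (cases "y = x") auto
      assume "u \<in> ?q ` {..<n}" "skip ?e u \<in> q ` {..<n}"
      then show "letters n ?q u = {y. y < n \<and> y \<noteq> x \<and> q y = skip ?e u}"
        unfolding letters_def using a by (simp cong: conj_cong)
    next
      assume "skip ?e u \<in> q ` {..<n}"
      then show "letters n q (skip ?e u) = {y. y < n \<and> y \<noteq> x \<and> q y = skip ?e u}"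
        by (auto simp: letters_def)
    qed
    then show ?thesis using 2 by auto
  next
    case 3
    then have "u \<notin> ?q ` {..<n}" "skip ?e u \<notin> q ` {..<n}" using tok x by auto
    then have "letters n ?q u = {y. y < n \<and> ?q y < u}" "letters n q (skip ?e u) = {y. y < n \<and> q y < skip ?e u}"
      by (auto simp: letters_def)
    moreover have "?q y < u \<longleftrightarrow> (if y = x then k < u else q y < skip ?e u)" if "y < n" for y
      using less[OF that] that by auto
    moreover have "k < u \<Longrightarrow> ?e < skip ?e u" using ek by (auto simp: skip_def)
    ultimately show ?thesis using 3 x by (auto split: if_splits)
  qed
qed

lemma valid_move:
  assumes q: "mq_valid n q" and x: "x < n" and hit: "x \<in> letters n q (skip (q x) k)"
    and ne: "\<And>u. u < k \<Longrightarrow> letters n q (skip (q x) u) - {x} \<noteq> {}"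
  shows "mq_valid n (mq_move n q x k)"
proof -
  let ?q = "mq_move n q x k" and ?e = "q x"
  have inj: "inj_on q {..<n}" using q by (simp add: mq_valid_def)
  have ne': "q y \<noteq> ?e" if "y < n" "y \<noteq> x" for y
    using inj x that by (auto simp: inj_on_def)
  have eq: "?q y = v \<longleftrightarrow> q y = skip ?e v" if "y < n" "y \<noteq> x" for y v
    using mq_move_eq_iff[OF that ne'[OF that]] .
  have less: "?q y < v \<longleftrightarrow> q y < skip ?e v" if "y < n" "y \<noteq> x" for y v
    using mq_move_less_iff[OF that ne'[OF that]] .
  have nk: "?q y \<noteq> k" if "y < n" "y \<noteq> x" for y
  proof -
    have "skip ?e k \<notin> q ` {..<n}" using hit by (auto simp: letters_def split: if_splits)
    then show ?thesis using eq[OF that, of k] that(1) by (metis imageI lessThan_iff)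
  qed
  have "inj_on ?q {..<n}"
  proof (rule inj_onI)
    fix y z assume yz: "y \<in> {..<n}" "z \<in> {..<n}" "?q y = ?q z"
    show "y = z"
    proof (cases "y = x \<or> z = x")
      case True
      then show ?thesis using nk yz x by (metis lessThan_iff mq_move_self)
    next
      case False
      then have "q y = q z" using eq[of y "?q z"] eq[of z "?q z"] yz by simp
      then show ?thesis using inj yz by (auto simp: inj_on_def)
    qed
  qed
  moreover have "0 \<in> ?q ` {..<n}"
  proof (cases "k = 0")
    case True
    then show ?thesis using x by (auto intro!: image_eqI[of _ _ x])
  next
    case False
    then obtain z where z: "z \<in> letters n q (skip ?e 0)" "z \<noteq> x" using ne[of 0] by auto
    then have "z < n" by (auto simp: letters_def split: if_splits)
    with z show ?thesis using eq[of z 0] less[of z 0]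
      by (auto simp: letters_def split: if_splits intro!: image_eqI[of _ _ z])
  qed
  ultimately show ?thesis by (auto simp: mq_valid_def mq_move_def)
qed

lemma set_mq_hitD:
  assumes x: "x < n" and k: "k \<in> set_pmf (mq_hit n q x)"
  shows "x \<in> letters n q (skip (q x) k)" "\<And>u. u < k \<Longrightarrow> hit_prob n q x u < 1"
proof -
  have "hit_prob n q x k * (\<Prod>u<k. 1 - hit_prob n q x u) \<noteq> 0"
    using k pmf_mq_hit[OF x, of q k] by (simp add: set_pmf_iff)
  then have 1: "hit_prob n q x k \<noteq> 0" and 2: "\<forall>u<k. hit_prob n q x u \<noteq> 1"
    by auto
  from 1 show "x \<in> letters n q (skip (q x) k)" by (auto simp: hit_prob_def split: if_splits)
  show "hit_prob n q x u < 1" if "u < k" for u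
    using 2 that hit_prob_bounds(2)[of n q x u] by (simp add: order_less_le)
qed

lemma hit_prob_less_1D:
  assumes q: "mq_valid n q" and h: "hit_prob n q x u < 1"
  shows "letters n q (skip (q x) u) - {x} \<noteq> {}"
proof
  assume "letters n q (skip (q x) u) - {x} = {}"
  then have "letters n q (skip (q x) u) = {x}" using letters_nonempty[OF q] by blast
  then show False using h by (simp add: hit_prob_def)
qed

lemma valid_mq_hit:
  assumes "mq_valid n q" "x < n" "k \<in> set_pmf (mq_hit n q x)"
  shows "mq_valid n (mq_move n q x k)"
  by (rule valid_move[OF assms(1,2)]) (use set_mq_hitD[OF assms(2,3)] hit_prob_less_1D[OF assms(1)] in auto)

text \<open>Whether position \<open>t\<close> is shifted depends on the letters up to
  \<open>t\<close> only, so measurability can be checked position by position; a word with no letter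
  in \<open>S\<close> is left unchanged.\<close>

definition word_del :: "(nat \<Rightarrow> nat) \<Rightarrow> nat set \<Rightarrow> nat \<Rightarrow> nat" where
  "word_del w S t = (if \<exists>j\<le>t. w j \<in> S then w (Suc t) else w t)"

text \<open>A queue has no letter before its minimum and has one there, so the first letter from
  \<open>S\<close> is at the least of the minima.\<close>

lemma letters_position:
  assumes q: "mq_valid n q" and S: "S \<subseteq> {..<n}" "S \<noteq> {}" and w: "\<And>t. w t \<in> letters n q t"
  shows "w j \<in> S \<Longrightarrow> Min (q ` S) \<le> j" and "w (Min (q ` S)) \<in> S"
proof -
  have fin: "finite S" using S(1) finite_subset by blast
  { assume "w j \<in> S"
    then have "Min (q ` S) \<le> q (w j)" using fin by auto
    also have "q (w j) \<le> j" using w[of j] by (auto simp: letters_def split: if_splits)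
    finally show "Min (q ` S) \<le> j" . }
  have "Min (q ` S) \<in> q ` S" using fin S(2) by simp
  then obtain x where x: "x \<in> S" "Min (q ` S) = q x" by auto
  then have "q x \<in> q ` {..<n}" using S by auto
  then have "w (q x) = x" using w[of "q x"] x(1) S q by (auto simp: letters_def mq_valid_def inj_on_def)
  then show "w (Min (q ` S)) \<in> S" using x by simp
qed

lemma word_del_eq_skip:
  assumes "mq_valid n q" "S \<subseteq> {..<n}" "S \<noteq> {}" "\<And>t. w t \<in> letters n q t"
  shows "word_del w S = (\<lambda>t. w (skip (Min (q ` S)) t))"
proof
  fix t
  have "(\<exists>j\<le>t. w j \<in> S) \<longleftrightarrow> Min (q ` S) \<le> t"
    using letters_position[OF assms] by (meson order_trans)
  then show "word_del w S t = w (skip (Min (q ` S)) t)"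
    by (auto simp: word_del_def skip_def)
qed

lemma arg_min_on_Min:
  fixes q :: "nat \<Rightarrow> nat"
  assumes "finite S" "S \<noteq> {}"
  shows "arg_min_on q S \<in> S" "q (arg_min_on q S) = Min (q ` S)"
proof -
  note a = arg_min_if_finite[OF assms, of q]
  show 1: "arg_min_on q S \<in> S" using a by simp
  show "q (arg_min_on q S) = Min (q ` S)"
    using a assms by (intro Min_eqI[symmetric]) (auto simp: not_less)
qed

text \<open>\<open>word_mixture\<close> applied to the events that queue \<open>x\<close> next
  occurs at position \<open>k\<close>: the remaining word is a mixture, over the law of
  \<open>k\<close>, of words described by the moved state. This carries the conditional description
  through one deletion.\<close>

lemma nn_integral_word_del:
  assumes q: "mq_valid n q" and S: "S \<subseteq> {..<n}" "S \<noteq> {}" and f: "f \<in> borel_measurable word_space"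
  defines "x \<equiv> arg_min_on q S"
  shows "(\<integral>\<^sup>+w. f (word_del w S) \<partial>word_measure (letters n q)) =
    (\<integral>\<^sup>+k. (\<integral>\<^sup>+w. f w \<partial>word_measure (letters n (mq_move n q x k))) \<partial>mq_hit n q x)"
proof -
  have fin: "finite S" using S(1) finite_subset by blast
  have xS: "x \<in> S" and e: "q x = Min (q ` S)"
    unfolding x_def using arg_min_on_Min[OF fin S(2)] by auto
  have x: "x < n" using xS S by auto
  have inj: "inj_on q {..<n}" using q by (simp add: mq_valid_def)
  let ?M = "\<lambda>u. letters n q (skip (q x) u)"
  have "(\<integral>\<^sup>+w. f (word_del w S) \<partial>word_measure (letters n q)) = (\<integral>\<^sup>+w. f (\<lambda>t. w (skip (q x) t)) \<partial>word_measure (letters n q))"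
    using AE_word_measure[of "letters n q", OF finite_letters letters_nonempty[OF q]]
    by (intro nn_integral_cong_AE) (auto simp: word_del_eq_skip[OF q S] e)
  also have "\<dots> = (\<integral>\<^sup>+w. f w \<partial>word_measure ?M)"
    by (rule nn_integral_word_skip[OF f])
  also have "\<dots> = (\<integral>\<^sup>+k. (\<integral>\<^sup>+w. f w \<partial>word_measure (letters n (mq_move n q x k))) \<partial>mq_hit n q x)"
  \<comment> \<open>The event for \<open>k\<close> restricts the letters 0 to \<open>k\<close>,
    hence \<open>Suc k\<close> positions.\<close>
  proof (rule word_mixture[OF _ _ _ _ _ _ f, where b = Suc])
    fix k assume k: "k \<in> set_pmf (mq_hit n q x)"
    note hit = set_mq_hitD(1)[OF x k]
    note lm = letters_move[OF inj x hit]
    have ne: "?M u - {x} \<noteq> {}" if "u < k" for u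
      using hit_prob_less_1D[OF q set_mq_hitD(2)[OF x k that]] .
    show "letters n (mq_move n q x k) t \<subseteq> ?M t" for t
      using hit by (auto simp: lm split: if_splits)
    show "letters n (mq_move n q x k) t \<noteq> {}" for t
      by (rule letters_nonempty[OF valid_mq_hit[OF q x k]])
    show "letters n (mq_move n q x k) t = ?M t" if "Suc k \<le> t" for t
      using that by (simp add: lm)
    have "real (card (letters n (mq_move n q x k) u)) / real (card (?M u)) = 1 - hit_prob n q x u" if "u < k" for u
    proof -
      have "card (?M u) > 0" using letters_nonempty[OF q] by (simp add: card_gt_0_iff)
      then show ?thesis using that
        by (auto simp: lm hit_prob_def card_Diff_singleton_if of_nat_diff diff_divide_distrib Suc_le_eq)
    qed
    moreover have "real (card (letters n (mq_move n q x k) k)) / real (card (?M k)) = hit_prob n q x k"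
      using hit by (simp add: lm hit_prob_def)
    ultimately show "pmf (mq_hit n q x) k = (\<Prod>t<Suc k. real (card (letters n (mq_move n q x k) t)) / real (card (?M t)))"
      by (simp add: pmf_mq_hit[OF x] mult.commute)
  next
    fix k l :: nat and w :: "nat \<Rightarrow> nat"
    have first: "w k = x \<and> (\<forall>u<k. w u \<noteq> x)" if k: "k \<in> set_pmf (mq_hit n q x)"
      and w: "\<And>t. t < Suc k \<Longrightarrow> w t \<in> letters n (mq_move n q x k) t" for k
    proof -
      note lm = letters_move[OF inj x set_mq_hitD(1)[OF x k]]
      have "w u \<noteq> x" if "u < k" for u using w[of u] that by (simp add: lm)
      moreover have "w k = x" using w[of k] by (simp add: lm)
      ultimately show ?thesis by simp
    qed
    assume "k \<in> set_pmf (mq_hit n q x)" "l \<in> set_pmf (mq_hit n q x)"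
      "\<And>t. t < Suc k \<Longrightarrow> w t \<in> letters n (mq_move n q x k) t"
      "\<And>t. t < Suc l \<Longrightarrow> w t \<in> letters n (mq_move n q x l) t"
    then show "k = l" using first[of k] first[of l] by (metis linorder_neqE_nat)
  qed simp
  finally show ?thesis .
qed

section \<open>States with independent geometric gaps\<close>

text \<open>\<open>d j\<close> is the number of letters between the \<open>j\<close>-th and the \<open>(j+1)\<close>-st minimum.\<close>

definition tok_pos :: "(nat \<Rightarrow> nat) \<Rightarrow> nat \<Rightarrow> nat" where
  "tok_pos d k = k + (\<Sum>j=1..k. d j)"

text \<open>\<open>r y\<close> is the rank of queue \<open>y\<close> in the order of the minima,
  counted from 0.\<close>

definition mq_build :: "nat \<Rightarrow> (nat \<Rightarrow> nat) \<Rightarrow> (nat \<Rightarrow> nat) \<Rightarrow> nat \<Rightarrow> nat" where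
  "mq_build n r d = (\<lambda>y. if y < n then tok_pos d (r y) else 0)"

text \<open>The bound \<open>B\<close> is immaterial once it exceeds all positions, provided \<open>\<rho> n = 1\<close>.\<close>

definition tok_weight :: "(nat \<Rightarrow> real) \<Rightarrow> nat set \<Rightarrow> nat \<Rightarrow> real" where
  "tok_weight \<rho> T B = (\<Prod>t\<in>{..<B} - T. \<rho> (card (T \<inter> {..<t})))"

text \<open>\<open>geometric_pmf\<close> counts failures before a success, so the success
  probability 1 - \<rho> k gives a gap of length \<open>d\<close> a weight proportional to
  \<open>\<rho> k ^ d\<close>.\<close>

definition mq_gap_pmf :: "nat \<Rightarrow> (nat \<Rightarrow> real) \<Rightarrow> ((nat \<Rightarrow> nat) \<times> (nat \<Rightarrow> nat)) pmf" where
  "mq_gap_pmf n \<rho> = pair_pmf (pmf_of_set {r. r permutes {..<n}}) (Pi_pmf {1..<n} 0 (\<lambda>k. geometric_pmf (1 - \<rho> k)))"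

definition mq_state_pmf :: "nat \<Rightarrow> (nat \<Rightarrow> real) \<Rightarrow> (nat \<Rightarrow> nat) pmf" where
  "mq_state_pmf n \<rho> = map_pmf (\<lambda>(r, d). mq_build n r d) (mq_gap_pmf n \<rho>)"

lemma tok_pos_0 [simp]: "tok_pos d 0 = 0"
  by (simp add: tok_pos_def)

lemma tok_pos_Suc: "tok_pos d (Suc k) = Suc (tok_pos d k + d (Suc k))"
  by (simp add: tok_pos_def)

lemma strict_mono_tok_pos: "strict_mono (tok_pos d)"
  by (rule strict_monoI_Suc) (simp add: tok_pos_Suc)

lemma tok_pos_less_iff [simp]: "tok_pos d i < tok_pos d j \<longleftrightarrow> i < j"
  using strict_mono_less[OF strict_mono_tok_pos] .

text \<open>A position in gap \<open>j\<close> has \<open>j\<close> minima to its left and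
  contributes \<open>\<rho> j\<close>, so regrouping by gaps gives the product of geometric weights.
  The product over positions is the form in which the effect of moving one queue can be followed
  factor by factor.\<close>

lemma tok_weight_tok_pos:
  "tok_weight \<rho> (tok_pos d ` {..<Suc k}) (Suc (tok_pos d k)) = (\<Prod>j=1..k. \<rho> j ^ d j)"
proof (induction k)
  case 0
  then show ?case by (simp add: tok_weight_def lessThan_Suc)
next
  case (Suc k)
  let ?T = "tok_pos d ` {..<Suc k}" and ?T' = "tok_pos d ` {..<Suc (Suc k)}"
  let ?p = "tok_pos d k" and ?p' = "tok_pos d (Suc k)"
  have T': "?T' = insert ?p' ?T" by (auto simp: lessThan_Suc)
  have Tle: "t \<le> ?p" if "t \<in> ?T" for t
    using that by (auto simp: strict_mono_less_eq[OF strict_mono_tok_pos])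
  have p': "?p' = Suc (?p + d (Suc k))" by (rule tok_pos_Suc)
  have inj: "inj (tok_pos d)" using strict_mono_tok_pos by (rule strict_mono_imp_inj_on)
  have "{..<Suc ?p'} - ?T' = ({..<Suc ?p} - ?T) \<union> {Suc ?p..<?p'}"
    using Tle p' unfolding T' by (fastforce simp: less_Suc_eq)
  moreover have "({..<Suc ?p} - ?T) \<inter> {Suc ?p..<?p'} = {}" by auto
  ultimately have "tok_weight \<rho> ?T' (Suc ?p') =
    (\<Prod>t\<in>{..<Suc ?p} - ?T. \<rho> (card (?T' \<inter> {..<t}))) * (\<Prod>t\<in>{Suc ?p..<?p'}. \<rho> (card (?T' \<inter> {..<t})))"
    unfolding tok_weight_def by (simp add: prod.union_disjoint)
  also have "(\<Prod>t\<in>{..<Suc ?p} - ?T. \<rho> (card (?T' \<inter> {..<t}))) = tok_weight \<rho> ?T (Suc ?p)"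
    unfolding tok_weight_def
  proof (rule prod.cong[OF refl])
    fix t assume "t \<in> {..<Suc ?p} - ?T"
    then have "?T' \<inter> {..<t} = ?T \<inter> {..<t}" unfolding T' using p' by auto
    then show "\<rho> (card (?T' \<inter> {..<t})) = \<rho> (card (?T \<inter> {..<t}))" by simp
  qed
  also have "(\<Prod>t\<in>{Suc ?p..<?p'}. \<rho> (card (?T' \<inter> {..<t}))) = (\<Prod>t\<in>{Suc ?p..<?p'}. \<rho> (Suc k))"
  proof (rule prod.cong[OF refl])
    fix t assume t: "t \<in> {Suc ?p..<?p'}"
    then have "?T' \<inter> {..<t} = ?T" unfolding T' using Tle by force
    moreover have "card ?T = Suc k" by (subst card_image) (auto intro: inj_on_subset[OF inj])
    ultimately show "\<rho> (card (?T' \<inter> {..<t})) = \<rho> (Suc k)" by simp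
  qed
  also have "\<dots> = \<rho> (Suc k) ^ d (Suc k)" by (simp add: p')
  finally show ?case by (simp add: Suc.IH)
qed

lemma tok_weight_extend:
  assumes T: "finite T" "card T = n" "\<And>t. t \<in> T \<Longrightarrow> t < B" and \<rho>: "\<rho> n = (1::real)" and B: "B \<le> B'"
  shows "tok_weight \<rho> T B' = tok_weight \<rho> T B"
  unfolding tok_weight_def
proof (rule prod.mono_neutral_right)
  show "\<forall>t\<in>({..<B'} - T) - ({..<B} - T). \<rho> (card (T \<inter> {..<t})) = 1"
  proof
    fix t assume "t \<in> ({..<B'} - T) - ({..<B} - T)"
    then have "T \<inter> {..<t} = T" using T(3) by force
    then show "\<rho> (card (T \<inter> {..<t})) = 1" using T \<rho> by simp
  qed
qed (use B in auto)

lemma mq_build_image: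
  assumes "r permutes {..<n}" shows "mq_build n r d ` {..<n} = tok_pos d ` {..<n}"
proof -
  have "mq_build n r d ` {..<n} = tok_pos d ` r ` {..<n}"
    by (auto simp: mq_build_def image_image)
  then show ?thesis by (simp add: permutes_image[OF assms])
qed

lemma mq_valid_build:
  assumes r: "r permutes {..<n}" and n: "n \<ge> 1"
  shows "mq_valid n (mq_build n r d)"
proof -
  have "inj_on (mq_build n r d) {..<n}"
    using permutes_inj[OF r] strict_mono_eq[OF strict_mono_tok_pos]
    by (auto simp: inj_on_def mq_build_def)
  moreover have "0 \<in> tok_pos d ` {..<n}" using n by (auto intro!: image_eqI[of _ _ 0])
  moreover have "\<forall>y\<ge>n. mq_build n r d y = 0" by (simp add: mq_build_def)
  ultimately show ?thesis unfolding mq_valid_def mq_build_image[OF r] by blast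
qed

lemma card_permutes_less:
  assumes r: "r permutes {..<n}" and k: "k \<le> n"
  shows "card {y. y < n \<and> r y < k} = k"
proof -
  have "bij_betw r {y. y < n \<and> r y < k} {..<k}"
    unfolding bij_betw_def
  proof
    show "inj_on r {y. y < n \<and> r y < k}" using permutes_inj[OF r] inj_on_subset by blast
    show "r ` {y. y < n \<and> r y < k} = {..<k}"
    proof
      show "{..<k} \<subseteq> r ` {y. y < n \<and> r y < k}"
      proof
        fix i assume i: "i \<in> {..<k}"
        then have "i \<in> r ` {..<n}" using permutes_image[OF r] k by auto
        then show "i \<in> r ` {y. y < n \<and> r y < k}" using i by auto
      qed
    qed auto
  qed
  then show ?thesis using bij_betw_same_card by fastforce
qed

lemma mq_build_rank:
  assumes r: "r permutes {..<n}" and x: "x < n"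
  shows "card {y. y < n \<and> mq_build n r d y < mq_build n r d x} = r x"
proof -
  have "{y. y < n \<and> mq_build n r d y < mq_build n r d x} = {y. y < n \<and> r y < r x}"
    using x by (auto simp: mq_build_def)
  moreover have "r x < n" using permutes_in_image[OF r, of x] x by simp
  ultimately show ?thesis using card_permutes_less[OF r, of "r x"] by simp
qed

lemma mq_build_inj:
  assumes r: "r permutes {..<n}" "r' permutes {..<n}"
    and d: "\<And>k. k \<notin> {1..<n} \<Longrightarrow> d k = 0" "\<And>k. k \<notin> {1..<n} \<Longrightarrow> d' k = 0"
    and eq: "mq_build n r d = mq_build n r' d'"
  shows "r = r' \<and> d = d'"
proof -
  have rr: "r = r'"
  proof
    fix x show "r x = r' x"
    proof (cases "x < n")
      case True
      then show ?thesis using mq_build_rank[OF r(1) True, of d] mq_build_rank[OF r(2) True, of d'] eq by simp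
    next
      case False
      then show ?thesis using r by (simp add: permutes_not_in)
    qed
  qed
  have pos: "tok_pos d k = tok_pos d' k" if "k < n" for k
  proof -
    have "k \<in> r ` {..<n}" using permutes_image[OF r(1)] that by simp
    then obtain y where y: "y < n" "r y = k" by auto
    then show ?thesis using fun_cong[OF eq, of y] rr by (simp add: mq_build_def)
  qed
  have "d k = d' k" for k
  proof (cases "k \<in> {1..<n}")
    case True
    then obtain j where "k = Suc j" by (cases k) auto
    then show ?thesis using pos[of k] pos[of j] True by (simp add: tok_pos_Suc)
  qed (simp add: d)
  then show ?thesis using rr by auto
qed

lemma mq_build_surj:
  assumes q: "mq_valid n q"
  obtains r d where "r permutes {..<n}" "\<And>k. k \<notin> {1..<n} \<Longrightarrow> d k = 0" "q = mq_build n r d"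
proof -
  have inj: "inj_on q {..<n}" and out: "\<And>y. y \<ge> n \<Longrightarrow> q y = 0" using q by (auto simp: mq_valid_def)
  obtain y0 where y0: "y0 < n" "q y0 = 0" using q by (auto simp: mq_valid_def)
  define r where "r y = (if y < n then card {z. z < n \<and> q z < q y} else y)" for y
  have less: "r y < r z" if "y < n" "z < n" "q y < q z" for y z
    unfolding r_def using that by (auto intro!: psubset_card_mono)
  have less_iff: "r y < r z \<longleftrightarrow> q y < q z" if "y < n" "z < n" for y z
    using less[OF that] less[OF that(2,1)] inj that unfolding inj_on_def
    by (metis lessThan_iff linorder_neqE_nat not_less_iff_gr_or_eq)
  have rn: "r y < n" if "y < n" for y
  proof -
    have "card {z. z < n \<and> q z < q y} < card {..<n}"
      using that by (intro psubset_card_mono) auto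
    then show ?thesis using that by (simp add: r_def)
  qed
  have injr: "inj_on r {..<n}"
    using inj less_iff unfolding inj_on_def by (metis lessThan_iff linorder_neqE_nat order_less_irrefl)
  have "r ` {..<n} = {..<n}" using rn injr by (intro endo_inj_surj) auto
  then have perm: "r permutes {..<n}"
    using injr by (intro bij_imp_permutes) (auto simp: bij_betw_def r_def)
  define p where "p k = q (inv r k)" for k
  have invr: "r (inv r k) = k" "inv r (r k) = k" for k using perm by (simp_all add: permutes_inverses)
  have invn: "inv r k < n" if "k < n" for k
    using permutes_in_image[OF permutes_inv[OF perm], of k] that by simp
  have p_less: "p i < p j" if "i < j" "j < n" for i j
    unfolding p_def using less_iff[of "inv r i" "inv r j"] that invn by (simp add: invr)
  have "r y0 = 0" using y0 by (simp add: r_def)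
  then have p0: "p 0 = 0" unfolding p_def using invr(2)[of y0] y0 by simp
  define d where "d k = (if k \<in> {1..<n} then p k - p (k - 1) - 1 else 0)" for k
  have pos: "tok_pos d k = p k" if "k < n" for k
    using that
  proof (induction k)
    case 0 then show ?case by (simp add: p0)
  next
    case (Suc k)
    then show ?case using p_less[of k "Suc k"] by (simp add: tok_pos_Suc d_def)
  qed
  have d0: "d k = 0" if "k \<notin> {1..<n}" for k
    using that unfolding d_def by auto
  have qb: "q = mq_build n r d"
  proof
    fix y show "q y = mq_build n r d y"
      using pos[OF rn, of y] out[of y] by (auto simp: mq_build_def p_def invr)
  qed
  show ?thesis by (rule that[OF perm d0 qb])
qed

lemma set_mq_gap_pmf:
  assumes \<rho>: "\<And>k. k \<in> {1..<n} \<Longrightarrow> 0 < \<rho> k \<and> \<rho> k < 1"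
  shows "set_pmf (mq_gap_pmf n \<rho>) = {r. r permutes {..<n}} \<times> {d. \<forall>k. k \<notin> {1..<n} \<longrightarrow> d k = 0}"
proof -
  have fin: "finite {r. r permutes {..<n}}" "{r. r permutes {..<n}} \<noteq> {}"
    by (auto intro!: finite_permutations exI[of _ id] permutes_id)
  have "set_pmf (Pi_pmf {1..<n} 0 (\<lambda>k. geometric_pmf (1 - \<rho> k))) = {d. \<forall>k. k \<notin> {1..<n} \<longrightarrow> d k = 0}"
    using \<rho> by (subst set_Pi_pmf) (auto simp: PiE_dflt_def set_pmf_geometric)
  then show ?thesis using fin by (simp add: mq_gap_pmf_def)
qed

text \<open>1 / n! for the uniform order times the factors 1 - \<rho> k of the geometric
  laws.\<close>

definition mq_const :: "nat \<Rightarrow> (nat \<Rightarrow> real) \<Rightarrow> real" where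
  "mq_const n \<rho> = (\<Prod>k=1..<n. 1 - \<rho> k) / fact n"

lemma set_mq_state_pmf:
  assumes n: "n \<ge> 1" and \<rho>: "\<And>k. k \<in> {1..<n} \<Longrightarrow> 0 < \<rho> k \<and> \<rho> k < 1"
  shows "set_pmf (mq_state_pmf n \<rho>) = {q. mq_valid n q}"
proof -
  have "(\<lambda>(r, d). mq_build n r d) ` ({r. r permutes {..<n}} \<times> {d. \<forall>k. k \<notin> {1..<n} \<longrightarrow> d k = 0}) = {q. mq_valid n q}"
  proof (intro set_eqI iffI)
    fix q assume "q \<in> {q. mq_valid n q}"
    then obtain r d where "r permutes {..<n}" "\<And>k. k \<notin> {1..<n} \<Longrightarrow> d k = 0" "q = mq_build n r d"
      using mq_build_surj[of n q] by blast
    then show "q \<in> (\<lambda>(r, d). mq_build n r d) ` ({r. r permutes {..<n}} \<times> {d. \<forall>k. k \<notin> {1..<n} \<longrightarrow> d k = 0})"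
      by (intro image_eqI[of _ _ "(r, d)"]) auto
  qed (use mq_valid_build[OF _ n] in auto)
  then show ?thesis
    by (simp only: mq_state_pmf_def set_map_pmf set_mq_gap_pmf[of n \<rho>, OF \<rho>])
qed

text \<open>States correspond one to one to pairs of an order and a gap vector. All orders are
  equally likely, so the probability of a state depends only on the set of its positions; the
  balance computation rests on this.\<close>

lemma pmf_mq_state_pmf:
  assumes n: "n \<ge> 1" and \<rho>: "\<And>k. k \<in> {1..<n} \<Longrightarrow> 0 < \<rho> k \<and> \<rho> k < 1" and \<rho>n: "\<rho> n = 1"
    and q: "mq_valid n q" and B: "\<And>y. y < n \<Longrightarrow> q y < B"
  shows "pmf (mq_state_pmf n \<rho>) q = mq_const n \<rho> * tok_weight \<rho> (q ` {..<n}) B"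
proof -
  obtain r d where rd: "r permutes {..<n}" "\<And>k. k \<notin> {1..<n} \<Longrightarrow> d k = 0" "q = mq_build n r d"
    using mq_build_surj[OF q] by blast
  have G: "set_pmf (mq_gap_pmf n \<rho>) = {r. r permutes {..<n}} \<times> {d. \<forall>k. k \<notin> {1..<n} \<longrightarrow> d k = 0}"
    by (rule set_mq_gap_pmf) (rule \<rho>)
  have "inj_on (\<lambda>(r, d). mq_build n r d) (set_pmf (mq_gap_pmf n \<rho>))"
    unfolding G
  proof (rule inj_onI, clarify)
    fix r d r' d'
    assume "mq_build n r d = mq_build n r' d'" "r permutes {..<n}" "r' permutes {..<n}"
      "\<forall>k. k \<notin> {1..<n} \<longrightarrow> d k = 0" "\<forall>k. k \<notin> {1..<n} \<longrightarrow> d' k = 0"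
    then show "r = r' \<and> d = d'" using mq_build_inj[of r n r' d d'] by blast
  qed
  then have "pmf (mq_state_pmf n \<rho>) q = pmf (mq_gap_pmf n \<rho>) (r, d)"
    unfolding mq_state_pmf_def rd(3)
    using pmf_map_inj[of "\<lambda>(r, d). mq_build n r d" "mq_gap_pmf n \<rho>" "(r, d)"] rd(1,2)
    by (auto simp: G)
  also have "\<dots> = pmf (pmf_of_set {r. r permutes {..<n}}) r * pmf (Pi_pmf {1..<n} 0 (\<lambda>k. geometric_pmf (1 - \<rho> k))) d"
    by (simp add: mq_gap_pmf_def pmf_pair)
  also have "pmf (pmf_of_set {r. r permutes {..<n}}) r = 1 / fact n"
    using rd(1) by (subst pmf_of_set) (auto simp: finite_permutations card_permutations[OF refl])
  also have "pmf (Pi_pmf {1..<n} 0 (\<lambda>k. geometric_pmf (1 - \<rho> k))) d = (\<Prod>k=1..<n. \<rho> k ^ d k * (1 - \<rho> k))"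
  proof -
    have "pmf (geometric_pmf (1 - \<rho> k)) (d k) = \<rho> k ^ d k * (1 - \<rho> k)" if "k \<in> {1..<n}" for k
      using \<rho>[OF that] by (subst pmf_geometric) auto
    then show ?thesis using rd(2) by (subst pmf_Pi') (auto intro: prod.cong)
  qed
  also have "\<dots> = (\<Prod>k=1..<n. \<rho> k ^ d k) * (\<Prod>k=1..<n. 1 - \<rho> k)"
    by (simp add: prod.distrib)
  also have "(\<Prod>k=1..<n. \<rho> k ^ d k) = tok_weight \<rho> (q ` {..<n}) B"
  proof -
    obtain m where m: "n = Suc m" using n by (cases n) auto
    let ?T = "tok_pos d ` {..<n}"
    have T: "q ` {..<n} = ?T" unfolding rd(3) by (rule mq_build_image[OF rd(1)])
    have inj: "inj (tok_pos d)" using strict_mono_tok_pos by (rule strict_mono_imp_inj_on)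
    have card: "card ?T = n" by (subst card_image) (auto intro: inj_on_subset[OF inj])
    have le: "t < Suc (tok_pos d m)" if "t \<in> ?T" for t
      using that by (auto simp: m less_Suc_eq_le strict_mono_less_eq[OF strict_mono_tok_pos])
    have "tok_pos d m \<in> q ` {..<n}" unfolding T by (auto simp: m)
    then have "Suc (tok_pos d m) \<le> B" using B by (auto simp: Suc_le_eq)
    then have "tok_weight \<rho> ?T B = tok_weight \<rho> ?T (Suc (tok_pos d m))"
      using card le \<rho>n by (intro tok_weight_extend[of _ n]) auto
    also have "\<dots> = (\<Prod>j=1..m. \<rho> j ^ d j)" unfolding m by (rule tok_weight_tok_pos)
    also have "{1..m} = {1..<n}" by (auto simp: m)
    finally show ?thesis by (simp add: T)
  qed
  finally show ?thesis by (simp add: mq_const_def)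
qed

section \<open>The stationary law\<close>

lemma sum_pmf_le_nn_integral:
  fixes p :: "'a pmf"
  assumes "finite A"
  shows "(\<Sum>a\<in>A. ennreal (pmf p a) * f a) \<le> (\<integral>\<^sup>+x. f x \<partial>p)"
proof -
  have "(\<Sum>a\<in>A. ennreal (pmf p a) * f a) = (\<integral>\<^sup>+x. ennreal (pmf p x) * f x \<partial>count_space A)"
    using assms by (simp add: nn_integral_count_space_finite)
  also have "\<dots> = (\<integral>\<^sup>+x. ennreal (pmf p x) * f x * indicator A x \<partial>count_space UNIV)"
    by (subst nn_integral_count_space_indicator) auto
  also have "\<dots> \<le> (\<integral>\<^sup>+x. ennreal (pmf p x) * f x \<partial>count_space UNIV)"
    by (intro nn_integral_mono) (auto simp: indicator_def)
  finally show ?thesis by (simp add: nn_integral_measure_pmf)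
qed

lemma pmf_eq_of_le:
  fixes p q :: "'a pmf"
  assumes "\<And>x. pmf p x \<le> pmf q x" shows "p = q"
proof (rule pmf_eqI)
  fix x
  have "emeasure p (-{x}) \<le> emeasure q (-{x})"
    unfolding nn_integral_pmf[symmetric] by (intro nn_integral_mono ennreal_leI assms)
  then have "measure p (-{x}) \<le> measure q (-{x})"
    by (simp add: measure_pmf.emeasure_eq_measure)
  moreover have "measure r (-{x}) = 1 - pmf r x" for r :: "'a pmf"
    using measure_pmf.prob_compl[of "{x}" r] by (simp add: Compl_eq_Diff_UNIV measure_pmf_single)
  ultimately show "pmf p x = pmf q x" using assms[of x] by simp
qed

text \<open>Here \<open>k\<close> is the new and \<open>e\<close> the old position of the moved
  queue, \<open>O'\<close> holds the other minima and \<open>N u\<close> counts those left of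
  \<open>u\<close>. With \<open>R l\<close> the product of \<open>\<rho> (N u)\<close> over u < l
  outside \<open>O'\<close>, the sum over e < l is \<open>R l * P (N l)\<close>. Adding the term e =
  l turns \<open>P (N l)\<close> into \<open>P (Suc (N l))\<close>. If \<open>l\<close> carries a
  minimum, this is already the next value; otherwise all terms gain the factor
  \<open>N l / (n * P (Suc (N l)))\<close>, leaving \<open>R l * (N l / n)\<close>, which is
  \<open>R (Suc l) * P (N l)\<close> by the choice of \<rho>.\<close>

lemma telescope_weight:
  fixes P :: "nat \<Rightarrow> real" and N :: "nat \<Rightarrow> nat" and n :: nat
  assumes P: "P 0 = 0" "\<And>u. u \<le> k \<Longrightarrow> 0 < P (Suc (N u))" "\<And>u. u \<le> k \<Longrightarrow> N u \<noteq> 0 \<Longrightarrow> 0 < P (N u)"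
    and N: "N 0 = 0" "\<And>u. N (Suc u) = (if u \<in> O' then Suc (N u) else N u)"
  defines "\<rho> \<equiv> \<lambda>j. real j / (real n * P j)"
  shows "(\<Sum>e<Suc k. (\<Prod>u\<in>{..<k} - O'. if e \<le> u then N u / (n * P (Suc (N u))) else \<rho> (N u)) * (P (Suc (N e)) - P (N e)))
     = (\<Prod>u\<in>{..<k} - O'. \<rho> (N u)) * P (Suc (N k))"
proof -
  define G where "G k e = (\<Prod>u\<in>{..<k} - O'. if e \<le> u then N u / (n * P (Suc (N u))) else \<rho> (N u))" for k e
  define R where "R k = (\<Prod>u\<in>{..<k} - O'. \<rho> (N u))" for k
  have Gkk: "G k k = R k" for k
    unfolding G_def R_def by (intro prod.cong) auto
  have G_in: "G (Suc k) e = G k e" "R (Suc k) = R k" if "k \<in> O'" for k e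
    using that by (simp_all add: G_def R_def lessThan_Suc)
  have G_out: "G (Suc k) e = G k e * (N k / (n * P (Suc (N k))))" if "k \<notin> O'" "e \<le> k" for k e
    using that by (simp add: G_def lessThan_Suc insert_Diff_if)
  have R_out: "R (Suc k) = R k * \<rho> (N k)" if "k \<notin> O'" for k
    using that by (simp add: R_def lessThan_Suc insert_Diff_if)
  have main: "(\<Sum>e<l. G l e * (P (Suc (N e)) - P (N e))) = R l * P (N l)" if "l \<le> k" for l
    using that
  proof (induction l)
    case 0
    then show ?case using P N by simp
  next
    case (Suc l)
    then have IH: "(\<Sum>e<l. G l e * (P (Suc (N e)) - P (N e))) = R l * P (N l)" by simp
    have full: "(\<Sum>e<Suc l. G l e * (P (Suc (N e)) - P (N e))) = R l * P (Suc (N l))"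
      using IH by (simp add: Gkk algebra_simps)
    show ?case
    proof (cases "l \<in> O'")
      case True
      then show ?thesis using full N(2)[of l] by (simp add: G_in)
    next
      case False
      have "(\<Sum>e<Suc l. G (Suc l) e * (P (Suc (N e)) - P (N e)))
        = (\<Sum>e<Suc l. N l / (n * P (Suc (N l))) * (G l e * (P (Suc (N e)) - P (N e))))"
        using False by (intro sum.cong) (auto simp: G_out)
      also have "\<dots> = N l / (n * P (Suc (N l))) * (R l * P (Suc (N l)))"
        by (simp only: sum_distrib_left[symmetric] full)
      also have "\<dots> = R l * (N l / n)"
        using P(2)[of l] Suc.prems by simp
      \<comment> \<open>For \<open>N l = 0\<close> both sides vanish; otherwise this is the defining
        equation of \<rho>.\<close>
      also have "\<dots> = R (Suc l) * P (N (Suc l))"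
        using False N(2)[of l] P(3)[of l] Suc.prems by (cases "N l = 0") (auto simp: R_out \<rho>_def)
      finally show ?thesis .
    qed
  qed
  have "(\<Sum>e<Suc k. G k e * (P (Suc (N e)) - P (N e))) = R k * P (Suc (N k))"
    using main[of k] by (simp add: Gkk algebra_simps)
  then show ?thesis by (simp add: G_def R_def)
qed

text \<open>\<open>sel\<close> is the law of the set of selected queues, and \<open>P k\<close> is
  the probability of meeting a given set of \<open>k\<close> queues. \<open>P_gt\<close> says that
  the first \<open>k\<close> queues are served more often than by one uniform choice; it makes all
  gap ratios less than 1. \<open>P_mono\<close> makes every queue deletable in every state.\<close>

locale multiqueue =
  fixes n :: nat and sel :: "nat set pmf" and P :: "nat \<Rightarrow> real"
  assumes n: "n \<ge> 1"
    and sel: "\<And>S. S \<in> set_pmf sel \<Longrightarrow> S \<subseteq> {..<n} \<and> S \<noteq> {}"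
    and avoid: "\<And>B. B \<subseteq> {..<n} \<Longrightarrow> measure sel {S. S \<inter> B = {}} = 1 - P (card B)"
    and P0: "P 0 = 0" and Pn: "P n = 1"
    and P_mono: "\<And>k. k < n \<Longrightarrow> P k < P (Suc k)"
    and P_gt: "\<And>k. 0 < k \<Longrightarrow> k < n \<Longrightarrow> real k / n < P k"
begin

definition \<rho> :: "nat \<Rightarrow> real" where "\<rho> k = real k / (real n * P k)"

definition \<pi> :: "(nat \<Rightarrow> nat) pmf" where "\<pi> = mq_state_pmf n \<rho>"

definition K :: "(nat \<Rightarrow> nat) \<Rightarrow> (nat \<Rightarrow> nat) pmf" where
  "K q = bind_pmf (map_pmf (arg_min_on q) sel) (\<lambda>x. map_pmf (mq_move n q x) (mq_hit n q x))"

lemma P_pos: "0 < k \<Longrightarrow> k \<le> n \<Longrightarrow> 0 < P k"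
  using P_gt[of k] Pn by (cases "k = n") (auto intro: le_less_trans[rotated])

lemma \<rho>_bounds: "k \<in> {1..<n} \<Longrightarrow> 0 < \<rho> k \<and> \<rho> k < 1"
  using P_gt[of k] P_pos[of k] by (auto simp: \<rho>_def field_simps)

lemma \<rho>_n: "\<rho> n = 1"
  using n by (simp add: \<rho>_def Pn)

lemma set_\<pi>: "set_pmf \<pi> = {q. mq_valid n q}"
  unfolding \<pi>_def by (rule set_mq_state_pmf[OF n]) (rule \<rho>_bounds)

lemma pmf_\<pi>:
  assumes "mq_valid n q" "\<And>y. y < n \<Longrightarrow> q y < B"
  shows "pmf \<pi> q = mq_const n \<rho> * tok_weight \<rho> (q ` {..<n}) B"
  unfolding \<pi>_def using assms by (intro pmf_mq_state_pmf n \<rho>_n \<rho>_bounds)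

text \<open>Queue \<open>x\<close> is deleted iff the selection avoids the \<open>N\<close> queues
  with smaller minima but not these together with \<open>x\<close>.\<close>

lemma pmf_arg_min:
  fixes q :: "nat \<Rightarrow> nat"
  assumes q: "inj_on q {..<n}" and x: "x < n"
  defines "N \<equiv> card {y. y < n \<and> q y < q x}"
  shows "pmf (map_pmf (arg_min_on q) sel) x = P (Suc N) - P N"
proof -
  let ?B = "{y. y < n \<and> q y < q x}"
  have argmin: "arg_min_on q S = x \<longleftrightarrow> S \<inter> ?B = {} \<and> \<not> S \<inter> insert x ?B = {}" if "S \<in> set_pmf sel" for S
  proof -
    have S: "S \<subseteq> {..<n}" "S \<noteq> {}" "finite S" using sel[OF that] finite_subset by blast+
    note a = arg_min_on_Min[OF S(3,2), of q]
    show ?thesis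
    proof
      assume "arg_min_on q S = x"
      then have "x \<in> S" "q x = Min (q ` S)" using a by auto
      moreover have "Min (q ` S) \<le> q y" if "y \<in> S" for y using S(3) that by simp
      ultimately show "S \<inter> ?B = {} \<and> \<not> S \<inter> insert x ?B = {}" by (force simp: not_less[symmetric])
    next
      assume as: "S \<inter> ?B = {} \<and> \<not> S \<inter> insert x ?B = {}"
      then have "x \<in> S" by auto
      then have "q (arg_min_on q S) \<le> q x" using a S(3) by auto
      moreover have "\<not> q (arg_min_on q S) < q x" using as a(1) S(1) by auto
      ultimately have "q (arg_min_on q S) = q x" by simp
      then show "arg_min_on q S = x" using q a(1) S(1) x by (auto simp: inj_on_def)
    qed
  qed
  have "pmf (map_pmf (arg_min_on q) sel) x = measure sel (arg_min_on q -` {x})"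
    by (simp add: pmf_map)
  also have "\<dots> = measure sel ({S. S \<inter> ?B = {}} - {S. S \<inter> insert x ?B = {}})"
    by (intro measure_pmf.finite_measure_eq_AE) (auto simp: AE_measure_pmf_iff argmin)
  also have "\<dots> = measure sel {S. S \<inter> ?B = {}} - measure sel {S. S \<inter> insert x ?B = {}}"
    by (intro measure_pmf.finite_measure_Diff) auto
  also have "\<dots> = (1 - P N) - (1 - P (Suc N))"
    using x by (subst (1 2) avoid) (auto simp: N_def)
  finally show ?thesis by simp
qed

text \<open>The state before queue \<open>x\<close> moved from position \<open>e\<close>, if \<open>q\<close> is the state afterwards.\<close>

definition pred_state :: "(nat \<Rightarrow> nat) \<Rightarrow> nat \<Rightarrow> nat \<Rightarrow> nat \<Rightarrow> nat" where
  "pred_state q x e = (\<lambda>y. if n \<le> y then 0 else if y = x then e else skip e (q y))"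

text \<open>The states from which a move of \<open>x\<close> leads to \<open>q\<close> are indexed
  by the old position \<open>e\<close>, at most \<open>q x\<close>. The flow into \<open>q\<close>
  by moves of \<open>x\<close> is the same for each of the \<open>n\<close> queues, which allows the
  balance to be checked queue by queue.\<close>

lemma pred_state_balance:
  assumes q: "mq_valid n q" and x: "x < n"
  shows "(\<Sum>e<Suc (q x). pmf \<pi> (pred_state q x e) * (pmf (map_pmf (arg_min_on (pred_state q x e)) sel) x *
     pmf (mq_hit n (pred_state q x e) x) (q x))) = pmf \<pi> q / n"
proof -
  define k where "k = q x"
  define O' where "O' = q ` ({..<n} - {x})"
  define N where "N u = card (O' \<inter> {..<u})" for u
  define B where "B = Suc (Max (q ` {..<n}))"
  define U where "U = {..<B} - O' - {k}"
  let ?G = "\<lambda>e. \<Prod>u\<in>{..<k} - O'. if e \<le> u then N u / (n * P (Suc (N u))) else \<rho> (N u)"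
  have inj: "inj_on q {..<n}" using q by (simp add: mq_valid_def)
  have B: "q y < B" if "y < n" for y using that by (auto simp: B_def less_Suc_eq_le)
  have kB: "k < B" using B[OF x] by (simp add: k_def)
  have finO: "finite O'" by (simp add: O'_def)
  have kO: "k \<notin> O'" using inj x by (auto simp: k_def O'_def inj_on_def)
  have cardO: "card O' = n - 1"
    unfolding O'_def using x by (subst card_image) (auto intro: inj_on_subset[OF inj])
  have imq: "q ` {..<n} = insert k O'" using x by (auto simp: O'_def k_def)
  have N_le: "Suc (N u) \<le> n" for u
  proof -
    have "N u \<le> card O'" unfolding N_def by (intro card_mono finO) auto
    then show ?thesis using cardO n by simp
  qed
  have N0: "N 0 = 0" by (simp add: N_def)
  have NSuc: "N (Suc u) = (if u \<in> O' then Suc (N u) else N u)" for u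
  proof -
    have "O' \<inter> {..<Suc u} = (if u \<in> O' then insert u (O' \<inter> {..<u}) else O' \<inter> {..<u})"
      by (auto simp: less_Suc_eq)
    then show ?thesis using finO by (auto simp: N_def)
  qed
  have card_less: "card {y. y < n \<and> y \<noteq> x \<and> q y < u} = N u" for u
  proof -
    have "O' \<inter> {..<u} = q ` {y. y < n \<and> y \<noteq> x \<and> q y < u}" by (auto simp: O'_def)
    then show ?thesis unfolding N_def by (simp add: card_image inj_on_subset[OF inj] subset_iff)
  qed
  \<comment> \<open>Right of \<open>k\<close> the minimum of \<open>x\<close> lies to the left
    before and after the move, so this factor is common to all predecessors.\<close>
  define Z where "Z = (\<Prod>u\<in>U \<inter> {k<..}. \<rho> (Suc (N u)))"
  have Usplit: "U = ({..<k} - O') \<union> (U \<inter> {k<..})" "({..<k} - O') \<inter> (U \<inter> {k<..}) = {}" "finite U"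
    using kB by (auto simp: U_def)
  have wq: "pmf \<pi> q = mq_const n \<rho> * ((\<Prod>u\<in>{..<k} - O'. \<rho> (N u)) * Z)"
  proof -
    have "pmf \<pi> q = mq_const n \<rho> * tok_weight \<rho> (q ` {..<n}) B"
      by (rule pmf_\<pi>[OF q B])
    also have "tok_weight \<rho> (q ` {..<n}) B = (\<Prod>u\<in>U. \<rho> (N u + (if k < u then 1 else 0)))"
      unfolding tok_weight_def imq
    proof (rule prod.cong)
      fix u assume "u \<in> U"
      have "insert k O' \<inter> {..<u} = (if k < u then insert k (O' \<inter> {..<u}) else O' \<inter> {..<u})" by auto
      then show "\<rho> (card (insert k O' \<inter> {..<u})) = \<rho> (N u + (if k < u then 1 else 0))"
        using kO finO by (auto simp: N_def)
    qed (auto simp: U_def)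
    also have "\<dots> = (\<Prod>u\<in>{..<k} - O'. \<rho> (N u + (if k < u then 1 else 0))) * (\<Prod>u\<in>U \<inter> {k<..}. \<rho> (N u + (if k < u then 1 else 0)))"
      using Usplit by (subst Usplit(1), intro prod.union_disjoint) auto
    also have "\<dots> = (\<Prod>u\<in>{..<k} - O'. \<rho> (N u)) * Z"
      unfolding Z_def by (intro arg_cong2[where f = "(*)"] prod.cong) auto
    finally show ?thesis .
  qed
  have summand: "pmf \<pi> (pred_state q x e) * (pmf (map_pmf (arg_min_on (pred_state q x e)) sel) x *
     pmf (mq_hit n (pred_state q x e) x) k) =
     mq_const n \<rho> * Z / (n * P (Suc (N k))) *
     (?G e * (P (Suc (N e)) - P (N e)))"
    if e: "e < Suc k" for e
  proof -
    let ?p = "pred_state q x e"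
    have px: "?p x = e" using x by (simp add: pred_state_def)
    have py: "?p y = skip e (q y)" if "y < n" "y \<noteq> x" for y using that by (simp add: pred_state_def)
    have pinj: "inj_on ?p {..<n}"
    proof (rule inj_onI)
      fix y z assume yz: "y \<in> {..<n}" "z \<in> {..<n}" "?p y = ?p z"
      then show "y = z"
        using inj by (auto simp: pred_state_def inj_on_def split: if_splits)
    qed
    have "0 \<in> ?p ` {..<n}"
    proof (cases "e = 0")
      case True
      then show ?thesis using px x by (auto intro!: image_eqI[of _ _ x])
    next
      case False
      obtain y where y: "y < n" "q y = 0" using q by (auto simp: mq_valid_def)
      have "y \<noteq> x" using y False e by (auto simp: k_def)
      then have "?p y = 0" using py[OF y(1)] y False by (simp add: skip_def)
      then show ?thesis using y by (auto intro!: image_eqI[of _ _ y])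
    qed
    then have pvalid: "mq_valid n ?p" using pinj by (auto simp: mq_valid_def pred_state_def)
    have imp: "?p ` {..<n} = insert e (skip e ` O')"
    proof -
      have "?p ` {..<n} = insert (?p x) (?p ` ({..<n} - {x}))" using x by auto
      moreover have "?p ` ({..<n} - {x}) = skip e ` O'"
        unfolding O'_def image_image using py by (intro image_cong) auto
      ultimately show ?thesis by (simp add: px)
    qed
    have pB: "?p y < Suc B" if "y < n" for y
      using B[OF that] kB e by (auto simp: pred_state_def skip_def)
    have "card {y. y < n \<and> ?p y < ?p x} = N e"
    proof -
      have "{y. y < n \<and> ?p y < ?p x} = {y. y < n \<and> y \<noteq> x \<and> q y < e}"
        using px py by (auto simp: skip_less_self_iff pred_state_def split: if_splits)
      then show ?thesis by (simp add: card_less)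
    qed
    then have am: "pmf (map_pmf (arg_min_on ?p) sel) x = P (Suc (N e)) - P (N e)"
      using pmf_arg_min[OF pinj x] by simp
    have tok: "skip e u \<in> ?p ` {..<n} \<longleftrightarrow> u \<in> O'" for u
      unfolding imp by (auto simp: image_iff)
    \<comment> \<open>From the old position \<open>e\<close> on, the admissible letters are
      \<open>x\<close> and the \<open>N u\<close> other queues whose minima lie to the left; before
      \<open>e\<close> the queue \<open>x\<close> has no letter.\<close>
    have hp: "hit_prob n ?p x u = (if u \<in> O' \<or> u < e then 0 else 1 / (Suc (N u)))" for u
    proof (cases "u \<in> O'")
      case True
      then have "x \<notin> letters n ?p (skip e u)" using tok[of u] px by (simp add: letters_def)
      then show ?thesis using True by (simp add: hit_prob_def px)
    next
      case False
      then have L: "letters n ?p (skip e u) = {y. y < n \<and> ?p y < skip e u}" using tok[of u] by (simp add: letters_def)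
      have "{y. y < n \<and> ?p y < skip e u} = {y. y < n \<and> y \<noteq> x \<and> q y < u} \<union> (if e \<le> u then {x} else {})"
        using x by (auto simp: pred_state_def self_less_skip_iff split: if_splits)
      then have "card (letters n ?p (skip e u)) = N u + (if e \<le> u then 1 else 0)"
        unfolding L using card_less[of u] by (simp add: card_insert_if)
      moreover have "x \<in> letters n ?p (skip e u) \<longleftrightarrow> e \<le> u"
        unfolding L using x px by (simp add: self_less_skip_iff)
      ultimately show ?thesis using False by (auto simp: hit_prob_def px)
    qed
    have hit: "pmf (mq_hit n ?p x) k = 1 / Suc (N k) * (\<Prod>u\<in>{..<k} - O'. if e \<le> u then N u / Suc (N u) else 1)"
    proof -
      have "(\<Prod>u<k. 1 - hit_prob n ?p x u) = (\<Prod>u\<in>{..<k} - O'. if e \<le> u then N u / Suc (N u) else 1)"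
        by (intro prod.mono_neutral_cong_right) (auto simp: hp field_simps)
      then show ?thesis unfolding pmf_mq_hit[OF x] using e kO by (simp add: hp)
    qed
    have wp: "pmf \<pi> ?p = mq_const n \<rho> * (\<rho> (Suc (N k)) * (\<Prod>u\<in>{..<k} - O'. \<rho> (N u + (if e \<le> u then 1 else 0))) * Z)"
    proof -
      have "pmf \<pi> ?p = mq_const n \<rho> * tok_weight \<rho> (?p ` {..<n}) (Suc B)"
        by (rule pmf_\<pi>[OF pvalid pB])
      also have "tok_weight \<rho> (?p ` {..<n}) (Suc B) = (\<Prod>t\<in>skip e ` ({..<B} - O'). \<rho> (card (?p ` {..<n} \<inter> {..<t})))"
      proof -
        have "{..<Suc B} - ?p ` {..<n} = skip e ` ({..<B} - O')"
        proof (intro set_eqI iffI)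
          fix t assume t: "t \<in> {..<Suc B} - ?p ` {..<n}"
          then have te: "t \<noteq> e" unfolding imp by auto
          define u where "u = (if t < e then t else t - 1)"
          have tu: "t = skip e u" using te by (auto simp: u_def skip_def)
          moreover have "u < B" using t te e kB by (auto simp: u_def)
          moreover have "u \<notin> O'" using t tok[of u] tu by auto
          ultimately show "t \<in> skip e ` ({..<B} - O')" by auto
        next
          fix t assume "t \<in> skip e ` ({..<B} - O')"
          then obtain u where u: "t = skip e u" "u < B" "u \<notin> O'" by auto
          then show "t \<in> {..<Suc B} - ?p ` {..<n}" using tok[of u] by (auto simp: skip_def)
        qed
        then show ?thesis by (simp add: tok_weight_def)
      qed
      also have "\<dots> = (\<Prod>u\<in>{..<B} - O'. \<rho> (card (?p ` {..<n} \<inter> {..<skip e u})))"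
        by (subst prod.reindex) (auto intro: inj_on_subset[OF inj_skip])
      also have "\<dots> = (\<Prod>u\<in>{..<B} - O'. \<rho> (N u + (if e \<le> u then 1 else 0)))"
      proof (intro prod.cong refl arg_cong[where f = \<rho>])
        fix u
        have "?p ` {..<n} \<inter> {..<skip e u} = skip e ` (O' \<inter> {..<u}) \<union> (if e \<le> u then {e} else {})"
          unfolding imp by (auto simp: self_less_skip_iff)
        moreover have "card (skip e ` (O' \<inter> {..<u})) = N u"
          unfolding N_def by (intro card_image inj_on_subset[OF inj_skip]) auto
        moreover have "e \<notin> skip e ` (O' \<inter> {..<u})" by auto
        ultimately show "card (?p ` {..<n} \<inter> {..<skip e u}) = N u + (if e \<le> u then 1 else 0)"
          using finO by simp
      qed
      \<comment> \<open>In the predecessor the letter that ends up at \<open>k\<close> is no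
        minimum, so it contributes \<open>\<rho> (Suc (N k))\<close>; with the hit probability
        \<open>1 / Suc (N k)\<close> this forms the common factor computed in \<open>r\<close>
        below.\<close>
      also have "{..<B} - O' = insert k U" using kB kO by (auto simp: U_def)
      also have "(\<Prod>u\<in>insert k U. \<rho> (N u + (if e \<le> u then 1 else 0))) = \<rho> (Suc (N k)) * (\<Prod>u\<in>U. \<rho> (N u + (if e \<le> u then 1 else 0)))"
        using Usplit(3) e by (subst prod.insert) (auto simp: U_def)
      also have "(\<Prod>u\<in>U. \<rho> (N u + (if e \<le> u then 1 else 0))) =
        (\<Prod>u\<in>{..<k} - O'. \<rho> (N u + (if e \<le> u then 1 else 0))) * (\<Prod>u\<in>U \<inter> {k<..}. \<rho> (N u + (if e \<le> u then 1 else 0)))"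
        using Usplit by (subst Usplit(1), intro prod.union_disjoint) auto
      also have "(\<Prod>u\<in>U \<inter> {k<..}. \<rho> (N u + (if e \<le> u then 1 else 0))) = Z"
        unfolding Z_def using e by (intro prod.cong) auto
      finally show ?thesis by (simp add: mult.assoc)
    qed
    have "(\<Prod>u\<in>{..<k} - O'. \<rho> (N u + (if e \<le> u then 1 else 0))) * (\<Prod>u\<in>{..<k} - O'. if e \<le> u then N u / Suc (N u) else 1)
      = ?G e"
      unfolding prod.distrib[symmetric]
    proof (rule prod.cong[OF refl])
      fix u
      \<comment> \<open>The numerator \<open>Suc (N u)\<close> of \<rho> cancels against the
        survival probability \<open>N u / Suc (N u)\<close>; the result is the factor that
        \<open>telescope_weight\<close> expects.\<close>
      have "\<rho> (Suc (N u)) * (real (N u) / real (Suc (N u))) = N u / (n * P (Suc (N u)))"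
        unfolding \<rho>_def by (simp del: of_nat_Suc)
      then show "\<rho> (N u + (if e \<le> u then 1 else 0)) * (if e \<le> u then real (N u) / real (Suc (N u)) else 1)
        = (if e \<le> u then real (N u) / (real n * P (Suc (N u))) else \<rho> (N u))"
        by (cases "e \<le> u") (simp_all del: of_nat_Suc)
    qed
    note c = this
    have r: "\<rho> (Suc (N k)) * (1 / Suc (N k)) = 1 / (n * P (Suc (N k)))"
      by (simp add: \<rho>_def del: of_nat_Suc)
    have arrange: "C * (r * a * Z) * (A * (i * b)) = C * Z * (r * i) * ((a * b) * A)" for C r a A i b :: real
      by (simp only: mult_ac)
    show ?thesis unfolding wp am hit arrange c r by simp
  qed
  have Ppos: "0 < P (Suc (N u))" "N u \<noteq> 0 \<Longrightarrow> 0 < P (N u)" for u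
    using P_pos N_le[of u] by auto
  have tel: "(\<Sum>e<Suc k. ?G e * (P (Suc (N e)) - P (N e)))
     = (\<Prod>u\<in>{..<k} - O'. \<rho> (N u)) * P (Suc (N k))"
    using telescope_weight[of P k N O' n, OF P0 Ppos(1) Ppos(2) N0 NSuc] unfolding \<rho>_def .
  have "(\<Sum>e<Suc k. pmf \<pi> (pred_state q x e) * (pmf (map_pmf (arg_min_on (pred_state q x e)) sel) x *
     pmf (mq_hit n (pred_state q x e) x) k)) =
     (\<Sum>e<Suc k. mq_const n \<rho> * Z / (n * P (Suc (N k))) *
     (?G e * (P (Suc (N e)) - P (N e))))"
    by (intro sum.cong refl summand) simp
  also have "\<dots> = mq_const n \<rho> * Z / (n * P (Suc (N k))) * ((\<Prod>u\<in>{..<k} - O'. \<rho> (N u)) * P (Suc (N k)))"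
    by (simp only: sum_distrib_left[symmetric] tel)
  also have "\<dots> = pmf \<pi> q / n"
    using Ppos(1)[of k] by (simp add: wq)
  finally show ?thesis by (simp add: k_def)
qed

lemma mq_move_pred_state:
  assumes "mq_valid n q" "x < n" "e \<le> q x"
  shows "mq_move n (pred_state q x e) x (q x) = q"
proof
  fix y
  show "mq_move n (pred_state q x e) x (q x) y = q y"
    using assms by (auto simp: mq_move_def pred_state_def skip_def mq_valid_def)
qed

text \<open>For each \<open>x\<close> only the hit at position \<open>q x\<close> is counted. A
  lower bound is enough for stationarity.\<close>

lemma pmf_K_ge:
  "(\<Sum>x<n. ennreal (pmf (map_pmf (arg_min_on p) sel) x * pmf (mq_hit n p x) (q x)) *
     indicator {p. mq_move n p x (q x) = q} p) \<le> ennreal (pmf (K p) q)"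
proof -
  have le: "pmf (mq_hit n p x) (q x) \<le> pmf (map_pmf (mq_move n p x) (mq_hit n p x)) q"
    if "mq_move n p x (q x) = q" for x
  proof -
    have "measure (mq_hit n p x) {q x} \<le> measure (mq_hit n p x) (mq_move n p x -` {q})"
      using that by (intro measure_pmf.finite_measure_mono) auto
    then show ?thesis by (simp add: pmf_map measure_pmf_single)
  qed
  have "(\<Sum>x<n. ennreal (pmf (map_pmf (arg_min_on p) sel) x * pmf (mq_hit n p x) (q x)) *
     indicator {p. mq_move n p x (q x) = q} p) \<le>
    (\<Sum>x<n. ennreal (pmf (map_pmf (arg_min_on p) sel) x) * ennreal (pmf (map_pmf (mq_move n p x) (mq_hit n p x)) q))"
    using le by (intro sum_mono) (auto simp: indicator_def ennreal_mult'[symmetric] intro!: ennreal_leI mult_left_mono)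
  also have "\<dots> \<le> (\<integral>\<^sup>+x. ennreal (pmf (map_pmf (mq_move n p x) (mq_hit n p x)) q) \<partial>map_pmf (arg_min_on p) sel)"
    by (rule sum_pmf_le_nn_integral) simp
  finally show ?thesis by (simp add: K_def ennreal_pmf_bind)
qed

text \<open>The \<open>n\<close> equal shares of \<open>pred_state_balance\<close> add up to
  \<open>pmf \<pi> q\<close>, so \<pi> is pointwise at most its image under \<open>K\<close>, and
  \<open>pmf_eq_of_le\<close> applies.\<close>

theorem stationary: "bind_pmf \<pi> K = \<pi>"
proof (rule pmf_eq_of_le[symmetric])
  fix q
  show "pmf \<pi> q \<le> pmf (bind_pmf \<pi> K) q"
  proof (cases "mq_valid n q")
    case False
    then have "pmf \<pi> q = 0" using set_\<pi> by (simp add: pmf_eq_0_set_pmf)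
    then show ?thesis by simp
  next
    case True
    let ?g = "\<lambda>x p. ennreal (pmf (map_pmf (arg_min_on p) sel) x * pmf (mq_hit n p x) (q x)) * indicator {p. mq_move n p x (q x) = q} p"
    have "ennreal (pmf \<pi> q) = (\<Sum>x<n. ennreal (pmf \<pi> q / n))"
      using n by (subst sum_ennreal) auto
    also have "\<dots> = (\<Sum>x<n. \<Sum>e<Suc (q x). ennreal (pmf \<pi> (pred_state q x e)) * ?g x (pred_state q x e))"
    proof (intro sum.cong refl)
      fix x assume "x \<in> {..<n}"
      then have x: "x < n" by simp
      have "ennreal (pmf \<pi> q / n) = ennreal (\<Sum>e<Suc (q x). pmf \<pi> (pred_state q x e) * (pmf (map_pmf (arg_min_on (pred_state q x e)) sel) x *
         pmf (mq_hit n (pred_state q x e) x) (q x)))"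
        by (simp only: pred_state_balance[OF True x])
      also have "\<dots> = (\<Sum>e<Suc (q x). ennreal (pmf \<pi> (pred_state q x e) * (pmf (map_pmf (arg_min_on (pred_state q x e)) sel) x *
         pmf (mq_hit n (pred_state q x e) x) (q x))))"
        by (rule sum_ennreal[symmetric]) simp
      also have "\<dots> = (\<Sum>e<Suc (q x). ennreal (pmf \<pi> (pred_state q x e)) * ?g x (pred_state q x e))"
        using mq_move_pred_state[OF True x] by (intro sum.cong refl) (auto simp: ennreal_mult' less_Suc_eq_le)
      finally show "ennreal (pmf \<pi> q / n) = (\<Sum>e<Suc (q x). ennreal (pmf \<pi> (pred_state q x e)) * ?g x (pred_state q x e))" .
    qed
    also have "\<dots> \<le> (\<Sum>x<n. \<integral>\<^sup>+p. ?g x p \<partial>\<pi>)"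
    proof (rule sum_mono)
      fix x assume "x \<in> {..<n}"
      then have x: "x < n" by simp
      \<comment> \<open>Different old positions give different predecessors, so the finite sum is
        part of the integral over \<pi>.\<close>
      have inj: "inj_on (pred_state q x) {..<Suc (q x)}"
        using x by (auto intro!: inj_onI simp: pred_state_def fun_eq_iff split: if_splits)
      have "(\<Sum>e<Suc (q x). ennreal (pmf \<pi> (pred_state q x e)) * ?g x (pred_state q x e)) =
        (\<Sum>p\<in>pred_state q x ` {..<Suc (q x)}. ennreal (pmf \<pi> p) * ?g x p)"
        by (simp only: sum.reindex[OF inj] o_def)
      also have "\<dots> \<le> (\<integral>\<^sup>+p. ?g x p \<partial>\<pi>)" by (rule sum_pmf_le_nn_integral) simp
      finally show "(\<Sum>e<Suc (q x). ennreal (pmf \<pi> (pred_state q x e)) * ?g x (pred_state q x e)) \<le> (\<integral>\<^sup>+p. ?g x p \<partial>\<pi>)" .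
    qed
    also have "\<dots> = (\<integral>\<^sup>+p. (\<Sum>x<n. ?g x p) \<partial>\<pi>)" by (rule nn_integral_sum[symmetric]) simp
    also have "\<dots> \<le> (\<integral>\<^sup>+p. ennreal (pmf (K p) q) \<partial>\<pi>)" by (intro nn_integral_mono pmf_K_ge)
    also have "\<dots> = ennreal (pmf (bind_pmf \<pi> K) q)" by (simp add: ennreal_pmf_bind)
    finally show ?thesis by simp
  qed
qed

section \<open>Reachability of the sorted state from every state\<close>

lemma K_reach:
  assumes q: "mq_valid n q" and x: "x < n" and hit: "x \<in> letters n q (skip (q x) k)"
    and ne: "\<And>u. u < k \<Longrightarrow> letters n q (skip (q x) u) \<noteq> {x}"
  shows "mq_move n q x k \<in> set_pmf (K q)"
proof -
  have inj: "inj_on q {..<n}" using q by (simp add: mq_valid_def)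
  let ?N = "card {y. y < n \<and> q y < q x}"
  have "?N < card {..<n}" using x by (intro psubset_card_mono) auto
  then have "pmf (map_pmf (arg_min_on q) sel) x > 0"
    using pmf_arg_min[OF inj x] P_mono[of ?N] by simp
  then have 1: "x \<in> set_pmf (map_pmf (arg_min_on q) sel)" by (simp only: set_pmf_iff)
  have "hit_prob n q x u < 1" if "u < k" for u
  proof -
    let ?L = "letters n q (skip (q x) u)"
    have "x \<in> ?L \<Longrightarrow> 1 < card ?L"
      using ne[OF that] by (metis One_nat_def card_1_singletonE card_gt_0_iff emptyE finite_letters less_one nat_neq_iff singletonD)
    then show ?thesis by (auto simp: hit_prob_def)
  qed
  then have "0 < (\<Prod>u<k. 1 - hit_prob n q x u)" by (intro prod_pos) auto
  moreover have "0 < hit_prob n q x k"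
    using hit by (auto simp: hit_prob_def card_gt_0_iff)
  ultimately have "pmf (mq_hit n q x) k > 0" by (simp add: pmf_mq_hit[OF x])
  then have "k \<in> set_pmf (mq_hit n q x)" by (simp add: set_pmf_iff)
  then show ?thesis using 1 unfolding K_def by (auto simp: set_bind_pmf)
qed

lemma K_valid:
  assumes q: "mq_valid n q" and q': "q' \<in> set_pmf (K q)"
  shows "mq_valid n q'"
proof -
  obtain S k where S: "S \<in> set_pmf sel" and k: "k \<in> set_pmf (mq_hit n q (arg_min_on q S))"
    and q'_eq: "q' = mq_move n q (arg_min_on q S) k"
    using q' by (auto simp: K_def set_bind_pmf)
  have "finite S" "S \<noteq> {}" using sel[OF S] finite_subset by blast+
  then have "arg_min_on q S \<in> S" by (rule arg_min_on_Min)
  then have "arg_min_on q S < n" using sel[OF S] by auto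
  then show ?thesis unfolding q'_eq by (intro valid_mq_hit[OF q _ k])
qed

definition sorted_state :: "nat \<Rightarrow> nat" where "sorted_state y = (if y < n then y else 0)"

definition reaches_sorted :: "(nat \<Rightarrow> nat) \<Rightarrow> bool" where
  "reaches_sorted q \<longleftrightarrow> (\<exists>L0. \<forall>L\<ge>L0. sorted_state \<in> set_pmf (mc_iter K L (return_pmf q)))"

lemma mc_iter_step:
  "q' \<in> set_pmf (K q) \<Longrightarrow> sorted_state \<in> set_pmf (mc_iter K L (return_pmf q')) \<Longrightarrow> sorted_state \<in> set_pmf (mc_iter K (Suc L) (return_pmf q))"
  unfolding mc_iter_Suc' bind_return_pmf by (subst mc_iter_bind) (auto simp: set_bind_pmf)

lemma reaches_sorted_step:
  assumes "q' \<in> set_pmf (K q)" "reaches_sorted q'" shows "reaches_sorted q"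
proof -
  obtain L0 where L0: "\<And>L. L \<ge> L0 \<Longrightarrow> sorted_state \<in> set_pmf (mc_iter K L (return_pmf q'))"
    using assms(2) by (auto simp: reaches_sorted_def)
  have "sorted_state \<in> set_pmf (mc_iter K L (return_pmf q))" if L: "L \<ge> Suc L0" for L
  proof -
    obtain L' where L': "L = Suc L'" "L' \<ge> L0" using L by (cases L) auto
    then show ?thesis using mc_iter_step[OF assms(1) L0] by simp
  qed
  then show ?thesis unfolding reaches_sorted_def by blast
qed

text \<open>If the minima fill the positions below \<open>n\<close>, the other minima occupy the
  positions below n - 1 after the deletion, and the first letter behind them may belong to any
  queue.\<close>

lemma perm_move:
  assumes p: "mq_valid n p" "p ` {..<n} = {..<n}" and x: "x < n"
  shows "mq_move n p x (n - 1) \<in> set_pmf (K p)"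
proof (rule K_reach[OF p(1) x])
  have px: "p x < n" using p(2) x by auto
  have "skip (p x) (n - 1) = n" using px by (auto simp: skip_def)
  moreover have "letters n p n = {..<n}" using p(2) by (auto simp: letters_def)
  ultimately show "x \<in> letters n p (skip (p x) (n - 1))" using x by simp
  fix u assume "u < n - 1"
  then have "skip (p x) u \<in> p ` {..<n}" unfolding p(2) by (auto simp: skip_def)
  then have "x \<notin> letters n p (skip (p x) u)" by (simp add: letters_def)
  then show "letters n p (skip (p x) u) \<noteq> {x}" by auto
qed

lemma sorted_state_valid: "mq_valid n sorted_state" "sorted_state ` {..<n} = {..<n}"
  using n by (auto simp: mq_valid_def sorted_state_def inj_on_def)

text \<open>Deleting the last queue and finding it again at once leaves the sorted state unchanged;
  this loop turns reachability at one time into reachability at all later times.\<close>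

lemma reaches_sorted_self: "reaches_sorted sorted_state"
proof -
  have "mq_move n sorted_state (n - 1) (n - 1) = sorted_state"
  proof
    fix y show "mq_move n sorted_state (n - 1) (n - 1) y = sorted_state y"
      using n by (auto simp: mq_move_def sorted_state_def)
  qed
  then have loop: "sorted_state \<in> set_pmf (K sorted_state)" using perm_move[OF sorted_state_valid, of "n - 1"] n by simp
  have "sorted_state \<in> set_pmf (mc_iter K L (return_pmf sorted_state))" for L
    by (induction L) (auto intro: mc_iter_step[OF loop])
  then show ?thesis by (auto simp: reaches_sorted_def)
qed

text \<open>Sending queues 0, 1, ..., n - 1 to the end in turn sorts them; after \<open>j\<close>
  moves the queues below \<open>j\<close> fill the last \<open>j\<close> positions in order.\<close>

lemma reaches_sorted_perm:
  assumes "mq_valid n p" "p ` {..<n} = {..<n}" "j \<le> n" "\<And>y. y < j \<Longrightarrow> p y = n - j + y"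
  shows "reaches_sorted p"
  using assms
proof (induction "n - j" arbitrary: j p)
  case 0
  then have "j = n" by simp
  have "p = sorted_state"
  proof
    fix y show "p y = sorted_state y" using 0 \<open>j = n\<close> by (auto simp: sorted_state_def mq_valid_def)
  qed
  then show ?case using reaches_sorted_self by simp
next
  case (Suc i)
  then have j: "j < n" by simp
  have inj: "inj_on p {..<n}" using Suc.prems(1) by (simp add: mq_valid_def)
  have pn: "p y < n" if "y < n" for y using Suc.prems(2) that by auto
  let ?p = "mq_move n p j (n - 1)"
  have mem: "?p \<in> set_pmf (K p)" by (rule perm_move[OF Suc.prems(1,2) j])
  have valid: "mq_valid n ?p" by (rule K_valid[OF Suc.prems(1) mem])
  have less: "?p y < n" if "y < n" for y
    using pn[OF that] n by (auto simp: mq_move_def)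
  have im: "?p ` {..<n} = {..<n}"
    using valid less by (intro endo_inj_surj) (auto simp: mq_valid_def)
  \<comment> \<open>The last \<open>j\<close> positions are taken by the queues below
    \<open>j\<close>, so queue \<open>j\<close> lies to their left and its deletion shifts them all
    by one.\<close>
  have pj: "p j < n - j"
  proof (rule ccontr)
    assume "\<not> p j < n - j"
    then have y: "p j - (n - j) < j" "p (p j - (n - j)) = p j"
      using pn[OF j] j Suc.prems(4)[of "p j - (n - j)"] by auto
    then have "p j - (n - j) = j" using inj j by (auto simp: inj_on_def)
    then show False using y(1) by simp
  qed
  have "?p y = n - Suc j + y" if "y < Suc j" for y
  proof (cases "y = j")
    case True then show ?thesis using j by (simp add: mq_move_def)
  next
    case False
    then have "y < j" using that by simp
    then show ?thesis using Suc.prems(4)[of y] pj j by (simp add: mq_move_def)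
  qed
  then have "reaches_sorted ?p"
    using Suc.hyps(2) j by (intro Suc.hyps(1)[of "Suc j"] valid im) auto
  then show ?case by (rule reaches_sorted_step[OF mem])
qed

text \<open>Moving the first queue into the leftmost hole decreases the sum of the positions, until
  the minima fill the positions below \<open>n\<close> and \<open>reaches_sorted_perm\<close>
  applies.\<close>

lemma reaches_sorted:
  assumes "mq_valid n q" shows "reaches_sorted q"
  using assms
proof (induction "\<Sum>y<n. q y" arbitrary: q rule: less_induct)
  case less
  show ?case
  proof (cases "q ` {..<n} = {..<n}")
    case True
    then show ?thesis using reaches_sorted_perm[of q 0] less.prems by simp
  next
    case False
    have inj: "inj_on q {..<n}" using less.prems by (simp add: mq_valid_def)
    obtain x where x: "x < n" "q x = 0" using less.prems by (auto simp: mq_valid_def)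
    have "\<exists>k. Suc k \<notin> q ` {..<n}"
    proof (rule ccontr)
      assume "\<not> ?thesis"
      then have "range Suc \<subseteq> q ` {..<n}" by auto
      then have "finite (range Suc)" by (rule finite_subset) simp
      then show False using finite_imageD[of Suc UNIV] by simp
    qed
    \<comment> \<open>\<open>Suc k\<close> is the leftmost position without a minimum; once position
      0 is deleted it becomes position \<open>k\<close>.\<close>
    define k where "k = (LEAST k. Suc k \<notin> q ` {..<n})"
    have k: "Suc k \<notin> q ` {..<n}" unfolding k_def using \<open>\<exists>k. _\<close> by (rule LeastI_ex)
    have kl: "Suc u \<in> q ` {..<n}" if "u < k" for u
      using not_less_Least[of u "\<lambda>k. Suc k \<notin> q ` {..<n}"] that by (auto simp: k_def)
    have skip0: "skip (q x) u = Suc u" for u by (simp add: x skip_def)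
    have mem: "mq_move n q x k \<in> set_pmf (K q)"
    proof (rule K_reach[OF less.prems x(1)])
      show "x \<in> letters n q (skip (q x) k)" unfolding skip0 using k x by (simp add: letters_def)
      fix u assume "u < k"
      then have "x \<notin> letters n q (Suc u)" using kl[of u] x by (simp add: letters_def)
      then show "letters n q (skip (q x) u) \<noteq> {x}" unfolding skip0 by auto
    qed
    have sub: "{..k} \<subseteq> q ` {..<n}"
    proof
      fix t assume "t \<in> {..k}"
      then show "t \<in> q ` {..<n}" using x kl by (cases t) (auto intro!: image_eqI[of _ _ x])
    qed
    have cardq: "card (q ` {..<n}) = n" using card_image[OF inj] by simp
    have "Suc k < n"
    proof -
      have "card {..k} \<le> n" using card_mono[OF _ sub] cardq by simp
      moreover have "{..k} \<noteq> q ` {..<n}" if "Suc k = n"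
        using False that lessThan_Suc_atMost[of k] by metis
      then have "Suc k \<noteq> n"
        using card_subset_eq[OF _ sub] cardq by auto
      ultimately show ?thesis by simp
    qed
    have pos: "q y > 0" if "y < n" "y \<noteq> x" for y
      using inj x that by (auto simp: inj_on_def intro!: gr0I)
    \<comment> \<open>Queue \<open>x\<close> rises from 0 to \<open>k\<close> with k < n - 1, while
      each of the other n - 1 minima, being positive, drops by one.\<close>
    have "(\<Sum>y<n. mq_move n q x k y) + (n - 1) < (\<Sum>y<n. q y) + (n - 1)"
    proof -
      have "(\<Sum>y<n. mq_move n q x k y) = k + (\<Sum>y\<in>{..<n} - {x}. q y - 1)"
      proof -
        have "mq_move n q x k y = q y - 1" if "y \<in> {..<n} - {x}" for y
          using pos[of y] that x by (auto simp: mq_move_def)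
        then show ?thesis using x by (subst sum.remove[of _ x]) auto
      qed
      moreover have "(\<Sum>y\<in>{..<n} - {x}. q y) = (\<Sum>y\<in>{..<n} - {x}. (q y - 1) + 1)"
        using pos by (intro sum.cong) auto
      moreover have "\<dots> = (\<Sum>y\<in>{..<n} - {x}. q y - 1) + (n - 1)"
        using x by (subst sum.distrib) simp
      moreover have "(\<Sum>y<n. q y) = (\<Sum>y\<in>{..<n} - {x}. q y)"
        using x by (subst sum.remove[of _ x]) auto
      ultimately show ?thesis using \<open>Suc k < n\<close> by simp
    qed
    then have "reaches_sorted (mq_move n q x k)"
      using less.hyps K_valid[OF less.prems mem] by simp
    then show ?thesis by (rule reaches_sorted_step[OF mem])
  qed
qed

section \<open>The initial law and its domination by the stationary law\<close>

definition \<mu>0 :: "(nat \<Rightarrow> nat) pmf" where "\<mu>0 = mq_state_pmf n (\<lambda>k. k / n)"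

lemma set_\<mu>0: "set_pmf \<mu>0 = {q. mq_valid n q}"
  unfolding \<mu>0_def by (rule set_mq_state_pmf[OF n]) auto

lemma P_le_1: "k \<le> n \<Longrightarrow> P k \<le> 1"
  using avoid[of "{..<k}"] measure_nonneg[of sel "{S. S \<inter> {..<k} = {}}"] by auto

lemma pmf_\<mu>0:
  assumes "mq_valid n q" "\<And>y. y < n \<Longrightarrow> q y < B"
  shows "pmf \<mu>0 q = mq_const n (\<lambda>k. k / n) * tok_weight (\<lambda>k. k / n) (q ` {..<n}) B"
  unfolding \<mu>0_def using assms n by (intro pmf_mq_state_pmf) auto

text \<open>Since \<open>P k \<le> 1\<close>, each ratio k / n is at most \<rho> k, so the weights
  are ordered factor by factor; the constant is the quotient of the normalising constants.\<close>

lemma \<mu>0_dominated: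
  "pmf \<mu>0 q \<le> mq_const n (\<lambda>k. k / n) / mq_const n \<rho> * pmf \<pi> q"
proof (cases "mq_valid n q")
  case False
  then have "pmf \<mu>0 q = 0" "pmf \<pi> q = 0" using set_\<pi> set_\<mu>0 by (simp_all add: pmf_eq_0_set_pmf)
  then show ?thesis by simp
next
  case True
  define B where "B = Suc (Max (q ` {..<n}))"
  have B: "q y < B" if "y < n" for y using that by (auto simp: B_def less_Suc_eq_le)
  have pos: "0 < mq_const n \<rho>"
    unfolding mq_const_def using \<rho>_bounds by (intro divide_pos_pos prod_pos) auto
  have "tok_weight (\<lambda>k. k / n) (q ` {..<n}) B \<le> tok_weight \<rho> (q ` {..<n}) B"
    unfolding tok_weight_def
  proof (rule prod_mono, safe)
    fix t
    let ?k = "card (q ` {..<n} \<inter> {..<t})"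
    have "?k \<le> card (q ` {..<n})" by (intro card_mono) auto
    also have "\<dots> \<le> n" using card_image_le[of "{..<n}" q] by simp
    finally have k: "?k \<le> n" .
    show "0 \<le> real ?k / real n" by simp
    show "real ?k / real n \<le> \<rho> ?k"
    proof (cases "?k = 0")
      case False
      then have "0 < ?k" by linarith
      then have "0 < P ?k" "0 < real n" using P_pos[OF _ k] n by auto
      then show ?thesis using P_le_1[OF k]
        unfolding \<rho>_def by (intro divide_left_mono) auto
    qed (simp add: \<rho>_def)
  qed
  moreover have "0 \<le> mq_const n (\<lambda>k. k / n)"
    unfolding mq_const_def by (intro divide_nonneg_nonneg prod_nonneg) auto
  ultimately show ?thesis
    using pos by (simp add: pmf_\<mu>0[OF True B] pmf_\<pi>[OF True B] mult_left_mono)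
qed

section \<open>Limit law and stationary mean of the position of the deleted letter\<close>

definition rank_pmf :: "(nat \<Rightarrow> nat) \<Rightarrow> nat pmf" where
  "rank_pmf q = map_pmf (\<lambda>S. Min (q ` S)) sel"

theorem rank_convergence:
  "(\<lambda>s. measure (bind_pmf (mc_iter K s \<mu>0) rank_pmf) A) \<longlonglongrightarrow> measure (bind_pmf \<pi> rank_pmf) A"
  by (rule mc_convergence[OF stationary \<mu>0_dominated, where z = sorted_state])
     (use reaches_sorted set_\<pi> in \<open>auto simp: reaches_sorted_def\<close>)

text \<open>The position of the deleted minimum is the sum of the distances \<open>1 + d j\<close>
  between successive minima up to it, and distance \<open>j\<close> is counted iff the selection
  avoids the first \<open>j\<close> queues.\<close>

lemma nn_integral_rank:
  assumes r: "r permutes {..<n}"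
  shows "(\<integral>\<^sup>+S. ennreal (real (Min (mq_build n r d ` S))) \<partial>sel) = (\<Sum>j=1..<n. ennreal (1 - P j) * ennreal (1 + real (d j)))"
proof -
  let ?A = "\<lambda>j. {S. S \<inter> {y. y < n \<and> r y < j} = {}}"
  have Min_eq: "ennreal (real (Min (mq_build n r d ` S))) =
     (\<Sum>j=1..<n. ennreal (1 + real (d j)) * indicator (?A j) S)"
    if "S \<in> set_pmf sel" for S
  proof -
    have S: "S \<subseteq> {..<n}" "S \<noteq> {}" "finite S" using sel[OF that] finite_subset by blast+
    define i where "i = Min (r ` S)"
    have iS: "i \<in> r ` S" unfolding i_def using S by simp
    then obtain x where x: "x \<in> S" "r x = i" by auto
    have "i < n" using x S permutes_in_image[OF r, of x] by auto
    have "Min (mq_build n r d ` S) = tok_pos d i"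
    proof (rule Min_eqI)
      show "tok_pos d i \<in> mq_build n r d ` S" using x S by (auto simp: mq_build_def intro!: image_eqI[of _ _ x])
      fix v assume "v \<in> mq_build n r d ` S"
      then obtain y where y: "y \<in> S" "v = tok_pos d (r y)" using S by (auto simp: mq_build_def)
      have "i \<le> r y" unfolding i_def using y S by simp
      then show "tok_pos d i \<le> v" unfolding y(2) by (simp add: strict_mono_less_eq[OF strict_mono_tok_pos])
    qed (use S in auto)
    then have "real (Min (mq_build n r d ` S)) = (\<Sum>j=1..i. 1 + real (d j))"
      by (simp add: tok_pos_def sum.distrib)
    also have "\<dots> = (\<Sum>j=1..<n. (1 + real (d j)) * indicator (?A j) S)"
    proof (rule sum.mono_neutral_cong_left)
      have iff: "S \<inter> {y. y < n \<and> r y < j} = {} \<longleftrightarrow> j \<le> i" for j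
      proof -
        have "j \<le> i \<longleftrightarrow> (\<forall>v\<in>r ` S. j \<le> v)" unfolding i_def using S by simp
        then show ?thesis using S(1) by (auto simp: not_less[symmetric])
      qed
      show "\<forall>j\<in>{1..<n} - {1..i}. (1 + real (d j)) * indicator (?A j) S = 0"
        using iff by (auto simp: indicator_def)
      show "1 + real (d j) = (1 + real (d j)) * indicator (?A j) S" if "j \<in> {1..i}" for j
        using iff[of j] that by simp
    qed (use \<open>i < n\<close> in auto)
    finally have "ennreal (real (Min (mq_build n r d ` S))) =
      (\<Sum>j=1..<n. ennreal ((1 + real (d j)) * indicator (?A j) S))"
      by (subst sum_ennreal) auto
    also have "\<dots> = (\<Sum>j=1..<n. ennreal (1 + real (d j)) * indicator (?A j) S)"
      by (intro sum.cong) (auto simp: indicator_def)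
    finally show ?thesis .
  qed
  have "(\<integral>\<^sup>+S. ennreal (real (Min (mq_build n r d ` S))) \<partial>sel) =
    (\<integral>\<^sup>+S. (\<Sum>j=1..<n. ennreal (1 + real (d j)) * indicator (?A j) S) \<partial>sel)"
    by (intro nn_integral_cong_AE) (simp add: AE_measure_pmf_iff Min_eq)
  also have "\<dots> = (\<Sum>j=1..<n. ennreal (1 + real (d j)) * emeasure sel (?A j))"
    by (subst nn_integral_sum) (auto intro!: sum.cong nn_integral_cmult_indicator)
  also have "\<dots> = (\<Sum>j=1..<n. ennreal (1 - P j) * ennreal (1 + real (d j)))"
  proof (rule sum.cong[OF refl])
    fix j assume "j \<in> {1..<n}"
    then have "measure sel (?A j) = 1 - P j"
      by (subst avoid) (auto simp: card_permutes_less[OF r])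
    then show "ennreal (1 + real (d j)) * emeasure sel (?A j) = ennreal (1 - P j) * ennreal (1 + real (d j))"
      by (simp add: measure_pmf.emeasure_eq_measure mult.commute)
  qed
  finally show ?thesis .
qed

text \<open>The conditional mean given the gaps does not depend on the order of the queues, so only
  mean gaps enter: \<open>1 + d j\<close> has mean 1 / (1 - \<rho> j).\<close>

theorem nn_integral_rank_stationary:
  "(\<integral>\<^sup>+v. ennreal (real v) \<partial>bind_pmf \<pi> rank_pmf) = ennreal (\<Sum>j=1..<n. (1 - P j) / (1 - \<rho> j))"
proof -
  let ?G = "Pi_pmf {1..<n} 0 (\<lambda>k. geometric_pmf (1 - \<rho> k))"
  have fin: "finite {r. r permutes {..<n}}" "{r. r permutes {..<n}} \<noteq> {}"
    by (auto intro!: finite_permutations exI[of _ id] permutes_id)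
  have "(\<integral>\<^sup>+v. ennreal (real v) \<partial>bind_pmf \<pi> rank_pmf) = (\<integral>\<^sup>+q. (\<integral>\<^sup>+S. ennreal (real (Min (q ` S))) \<partial>sel) \<partial>\<pi>)"
    by (simp add: rank_pmf_def)
  also have "\<dots> = (\<integral>\<^sup>+r. \<integral>\<^sup>+d. (\<integral>\<^sup>+S. ennreal (real (Min (mq_build n r d ` S))) \<partial>sel) \<partial>?G \<partial>pmf_of_set {r. r permutes {..<n}})"
    by (simp add: \<pi>_def mq_state_pmf_def mq_gap_pmf_def nn_integral_pair_pmf' case_prod_unfold)
  also have "\<dots> = (\<integral>\<^sup>+r. \<integral>\<^sup>+d. (\<Sum>j=1..<n. ennreal (1 - P j) * ennreal (1 + real (d j))) \<partial>?G \<partial>pmf_of_set {r. r permutes {..<n}})"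
    by (intro nn_integral_cong_AE) (use fin in \<open>simp add: AE_measure_pmf_iff nn_integral_rank\<close>)
  also have "\<dots> = (\<integral>\<^sup>+d. (\<Sum>j=1..<n. ennreal (1 - P j) * ennreal (1 + real (d j))) \<partial>?G)"
    by (simp add: measure_pmf.emeasure_space_1)
  also have "\<dots> = (\<Sum>j=1..<n. ennreal (1 - P j) * (\<integral>\<^sup>+d. ennreal (1 + real (d j)) \<partial>?G))"
    by (simp add: nn_integral_sum nn_integral_cmult)
  also have "\<dots> = (\<Sum>j=1..<n. ennreal ((1 - P j) / (1 - \<rho> j)))"
  proof (rule sum.cong[OF refl])
    fix j assume j: "j \<in> {1..<n}"
    have \<rho>j: "1 - \<rho> j \<in> {0<..1}" using \<rho>_bounds[OF j] by auto
    have "(\<integral>\<^sup>+d. ennreal (1 + real (d j)) \<partial>?G) = (\<integral>\<^sup>+k. ennreal (1 + real k) \<partial>map_pmf (\<lambda>d. d j) ?G)"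
      by simp
    also have "map_pmf (\<lambda>d. d j) ?G = geometric_pmf (1 - \<rho> j)"
      using j by (subst Pi_pmf_component) auto
    also have "(\<integral>\<^sup>+k. ennreal (1 + real k) \<partial>geometric_pmf (1 - \<rho> j)) = ennreal (\<integral>k. 1 + real k \<partial>geometric_pmf (1 - \<rho> j))"
      using integrable_real_geometric_pmf[OF \<rho>j] by (intro nn_integral_eq_integral) auto
    also have "(\<integral>k. 1 + real k \<partial>geometric_pmf (1 - \<rho> j)) = 1 / (1 - \<rho> j)"
      using integrable_real_geometric_pmf[OF \<rho>j] expectation_geometric_pmf[OF \<rho>j] \<rho>_bounds[OF j]
      by (simp add: field_simps)
    finally show "ennreal (1 - P j) * (\<integral>\<^sup>+d. ennreal (1 + real (d j)) \<partial>?G) = ennreal ((1 - P j) / (1 - \<rho> j))"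
      using P_le_1[of j] j by (simp add: ennreal_mult'[symmetric])
  qed
  also have "\<dots> = ennreal (\<Sum>j=1..<n. (1 - P j) / (1 - \<rho> j))"
  proof (rule sum_ennreal)
    fix j assume j: "j \<in> {1..<n}"
    then show "0 \<le> (1 - P j) / (1 - \<rho> j)" using \<rho>_bounds[OF j] P_le_1[of j] by auto
  qed
  finally show ?thesis .
qed

end

section \<open>The law of the rank error\<close>

abbreviation sel_space :: "(nat \<Rightarrow> nat set) measure" where
  "sel_space \<equiv> PiM UNIV (\<lambda>_. count_space UNIV)"

text \<open>The recursion peels off the earliest deletion, so that an induction over
  \<open>s\<close> can condition on the first selection.\<close>

fun word_rank :: "(nat \<Rightarrow> nat) \<Rightarrow> (nat \<Rightarrow> nat set) \<Rightarrow> nat \<Rightarrow> nat" where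
  "word_rank w S 0 = (LEAST k. w k \<in> S 0)"
| "word_rank w S (Suc s) = word_rank (word_del w (S 0)) (\<lambda>t. S (Suc t)) s"

text \<open>The selections form an uncountable type, so membership is split according to the
  countably many values of the letter.\<close>

lemma pred_word_in_sel [measurable]:
  "Measurable.pred (word_space \<Otimes>\<^sub>M sel_space) (\<lambda>x. fst x k \<in> snd x t)"
proof -
  have "(\<lambda>x. fst x k \<in> snd x t) = (\<lambda>x :: (nat \<Rightarrow> nat) \<times> (nat \<Rightarrow> nat set). \<exists>j. fst x k = j \<and> j \<in> snd x t)"
    by auto
  also have "Measurable.pred (word_space \<Otimes>\<^sub>M sel_space) \<dots>"
  proof (intro pred_intros_countable pred_intros_logic)
    fix j :: nat
    show "Measurable.pred (word_space \<Otimes>\<^sub>M sel_space) (\<lambda>x. fst x k = j)" by measurable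
    have "(\<lambda>x. snd x t) \<in> measurable (word_space \<Otimes>\<^sub>M sel_space) (count_space UNIV)" by measurable
    from measurable_compose[OF this, of "\<lambda>A. j \<in> A" "count_space UNIV"]
    show "Measurable.pred (word_space \<Otimes>\<^sub>M sel_space) (\<lambda>x. j \<in> snd x t)" by simp
  qed
  finally show ?thesis .
qed

lemma measurable_word_del_pair [measurable]:
  "(\<lambda>x. word_del (fst x) (snd x 0)) \<in> measurable (word_space \<Otimes>\<^sub>M sel_space) word_space"
  unfolding word_del_def by (intro measurable_abs_UNIV) measurable

lemma measurable_word_rank:
  "(\<lambda>x. word_rank (fst x) (snd x) s) \<in> measurable (word_space \<Otimes>\<^sub>M sel_space) (count_space UNIV)"
proof (induction s)
  case 0
  show ?case by simp
next
  case (Suc s)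
  have "(\<lambda>x. (word_del (fst x) (snd x 0), \<lambda>t. snd x (Suc t))) \<in> measurable (word_space \<Otimes>\<^sub>M sel_space) (word_space \<Otimes>\<^sub>M sel_space)"
    by (intro measurable_Pair measurable_word_del_pair measurable_abs_UNIV) measurable
  from measurable_compose[OF this Suc] show ?case by simp
qed

context multiqueue begin

definition sel_seq :: "(nat \<Rightarrow> nat set) measure" where "sel_seq = PiM UNIV (\<lambda>_. measure_pmf sel)"

lemma sets_sel_seq [measurable_cong]: "sets sel_seq = sets sel_space"
  unfolding sel_seq_def by (intro sets_PiM_cong) auto

lemma prob_space_sel_seq: "prob_space sel_seq"
  unfolding sel_seq_def by (intro prob_space_PiM) (simp add: prob_space_measure_pmf)

lemma word_rank_ind_measurable [measurable]:
  "(\<lambda>x. indicator V (word_rank (fst x) (snd x) s) :: ennreal) \<in> borel_measurable (word_space \<Otimes>\<^sub>M sel_seq)"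
proof -
  have "(\<lambda>x. indicator V (word_rank (fst x) (snd x) s) :: ennreal) \<in> borel_measurable (word_space \<Otimes>\<^sub>M sel_space)"
    by (rule measurable_compose[OF measurable_word_rank]) simp
  then show ?thesis by (simp cong: measurable_cong_sets sets_pair_measure_cong add: sets_sel_seq)
qed

text \<open>Averaging over the selections first leaves a function of the word, to which
  \<open>nn_integral_word_del\<close> applies.\<close>

definition rank_law :: "nat set \<Rightarrow> nat \<Rightarrow> (nat \<Rightarrow> nat) \<Rightarrow> ennreal" where
  "rank_law V s w = (\<integral>\<^sup>+S. indicator V (word_rank w S s) \<partial>sel_seq)"

lemma rank_law_measurable [measurable]: "rank_law V s \<in> borel_measurable word_space"
proof -
  interpret prob_space sel_seq by (rule prob_space_sel_seq)
  show ?thesis unfolding rank_law_def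
    using borel_measurable_nn_integral_fst[OF word_rank_ind_measurable[of V s]] by simp
qed

lemma nn_integral_sel_seq_split:
  assumes [measurable]: "f \<in> borel_measurable sel_seq"
  shows "(\<integral>\<^sup>+S. f S \<partial>sel_seq) = (\<integral>\<^sup>+A. \<integral>\<^sup>+S. f (case_nat A S) \<partial>sel_seq \<partial>sel)"
proof -
  interpret sequence_space "measure_pmf sel" by unfold_locales
  interpret Sq: prob_space sel_seq by (rule prob_space_sel_seq)
  have eq: "S = sel_seq" by (simp add: sel_seq_def)
  have m: "(\<lambda>(s, \<omega>). case_nat s \<omega>) \<in> measurable (measure_pmf sel \<Otimes>\<^sub>M S) S" by measurable
  have "(\<integral>\<^sup>+S. f S \<partial>sel_seq) = (\<integral>\<^sup>+S. f S \<partial>distr (measure_pmf sel \<Otimes>\<^sub>M S) S (\<lambda>(s, \<omega>). case_nat s \<omega>))"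
    by (simp only: PiM_iter[unfolded eq] eq)
  also have "\<dots> = (\<integral>\<^sup>+x. f (case x of (s, \<omega>) \<Rightarrow> case_nat s \<omega>) \<partial>(measure_pmf sel \<Otimes>\<^sub>M S))"
    using m by (intro nn_integral_distr) (simp_all add: eq)
  also have "\<dots> = (\<integral>\<^sup>+A. \<integral>\<^sup>+S. f (case_nat A S) \<partial>sel_seq \<partial>sel)"
    unfolding eq using m by (subst Sq.nn_integral_fst[symmetric]) (auto simp: eq intro!: measurable_compose[OF m[unfolded eq]])
  finally show ?thesis .
qed

lemma rank_law_Suc:
  "rank_law V (Suc s) w = (\<integral>\<^sup>+A. rank_law V s (word_del w A) \<partial>sel)"
proof -
  have "(\<lambda>S. indicator V (word_rank w S (Suc s)) :: ennreal) \<in> borel_measurable sel_seq"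
    using measurable_compose[OF measurable_Pair1'[of w word_space sel_seq] word_rank_ind_measurable[of V "Suc s"]]
    by (simp add: space_PiM)
  then show ?thesis unfolding rank_law_def
    by (subst nn_integral_sel_seq_split) simp_all
qed

lemma nn_integral_rank_law_0:
  assumes q: "mq_valid n q"
  shows "(\<integral>\<^sup>+w. rank_law V 0 w \<partial>word_measure (letters n q)) = emeasure (rank_pmf q) V"
proof -
  interpret W: prob_space "word_measure (letters n q)" by (rule prob_space_word_measure)
  have AE_S: "AE S in sel_seq. S 0 \<in> set_pmf sel"
    unfolding sel_seq_def by (intro AE_PiM_component) (auto simp: prob_space_measure_pmf AE_measure_pmf)
  have "rank_law V 0 w = emeasure (rank_pmf q) V" if w: "\<forall>t. w t \<in> letters n q t" for w
  proof -
    have "word_rank w S 0 = Min (q ` S 0)" if S: "S 0 \<in> set_pmf sel" for S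
    proof -
      have "S 0 \<subseteq> {..<n}" "S 0 \<noteq> {}" using sel[OF S] by auto
      note pos = letters_position[OF q this, of w]
      show ?thesis using w pos by (auto intro!: Least_equality)
    qed
    then have "rank_law V 0 w = (\<integral>\<^sup>+S. indicator V (Min (q ` S 0)) \<partial>sel_seq)"
      unfolding rank_law_def using AE_S by (intro nn_integral_cong_AE) auto
    also have "\<dots> = (\<integral>\<^sup>+A. indicator V (Min (q ` A)) \<partial>distr sel_seq (measure_pmf sel) (\<lambda>S. S 0))"
      unfolding sel_seq_def by (subst nn_integral_distr) auto
    also have "distr sel_seq (measure_pmf sel) (\<lambda>S. S 0) = measure_pmf sel"
      unfolding sel_seq_def by (intro distr_PiM_component) (auto simp: prob_space_measure_pmf)
    also have "(\<integral>\<^sup>+A. indicator V (Min (q ` A)) \<partial>sel) = (\<integral>\<^sup>+v. indicator V v \<partial>rank_pmf q)"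
      by (simp add: rank_pmf_def)
    finally show ?thesis by simp
  qed
  then have "(\<integral>\<^sup>+w. rank_law V 0 w \<partial>word_measure (letters n q)) = (\<integral>\<^sup>+w. emeasure (rank_pmf q) V \<partial>word_measure (letters n q))"
    using AE_word_measure[of "letters n q", OF finite_letters letters_nonempty[OF q]]
    by (intro nn_integral_cong_AE) auto
  then show ?thesis using W.emeasure_space_1 by simp
qed

text \<open>Exchanging the order of integration fixes the first selection;
  \<open>nn_integral_word_del\<close> then replaces the shortened word by a mixture over moved
  states, and averaging over the selection gives one step of \<open>K\<close>.\<close>

lemma nn_integral_rank_law:
  assumes q: "mq_valid n q"
  shows "(\<integral>\<^sup>+w. rank_law V s w \<partial>word_measure (letters n q)) = emeasure (bind_pmf (mc_iter K s (return_pmf q)) rank_pmf) V"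
  using q
proof (induction s arbitrary: q)
  case 0
  then show ?case by (simp add: nn_integral_rank_law_0 bind_return_pmf)
next
  case (Suc s)
  let ?H = "\<lambda>A. \<integral>\<^sup>+k. emeasure (bind_pmf (mc_iter K s (return_pmf (mq_move n q (arg_min_on q A) k))) rank_pmf) V \<partial>mq_hit n q (arg_min_on q A)"
  interpret W: prob_space "word_measure (letters n q)" by (rule prob_space_word_measure)
  interpret PS: pair_sigma_finite "word_measure (letters n q)" "measure_pmf sel"
    by (simp add: pair_sigma_finite_def W.sigma_finite_measure_axioms measure_pmf.sigma_finite_measure_axioms)
  have "(\<lambda>x. word_del (fst x) (snd x)) \<in> measurable (word_space \<Otimes>\<^sub>M count_space UNIV) word_space"
  proof -
    have "(\<lambda>x. (fst x, \<lambda>_. snd x)) \<in> measurable (word_space \<Otimes>\<^sub>M count_space UNIV) (word_space \<Otimes>\<^sub>M sel_space)"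
      by (intro measurable_Pair measurable_abs_UNIV) measurable
    from measurable_compose[OF this measurable_word_del_pair] show ?thesis by simp
  qed
  from measurable_compose[OF this rank_law_measurable[of V s]]
  have "(\<lambda>x. rank_law V s (word_del (fst x) (snd x))) \<in> borel_measurable (word_space \<Otimes>\<^sub>M count_space UNIV)" .
  also have "borel_measurable (word_space \<Otimes>\<^sub>M count_space UNIV) = borel_measurable (word_measure (letters n q) \<Otimes>\<^sub>M measure_pmf sel)"
    by (intro measurable_cong_sets sets_pair_measure_cong refl) (simp_all add: sets_word_measure)
  finally have m: "(\<lambda>x. rank_law V s (word_del (fst x) (snd x))) \<in> borel_measurable (word_measure (letters n q) \<Otimes>\<^sub>M measure_pmf sel)" .
  have "(\<integral>\<^sup>+w. rank_law V (Suc s) w \<partial>word_measure (letters n q)) = (\<integral>\<^sup>+w. \<integral>\<^sup>+A. rank_law V s (word_del w A) \<partial>sel \<partial>word_measure (letters n q))"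
    by (simp add: rank_law_Suc)
  also have "\<dots> = (\<integral>\<^sup>+A. \<integral>\<^sup>+w. rank_law V s (word_del w A) \<partial>word_measure (letters n q) \<partial>sel)"
    using PS.Fubini'[of "\<lambda>w A. rank_law V s (word_del w A)"] m by (simp add: case_prod_unfold)
  also have "\<dots> = (\<integral>\<^sup>+A. ?H A \<partial>sel)"
  proof (intro nn_integral_cong_AE, simp only: AE_measure_pmf_iff, intro ballI)
    fix A assume A: "A \<in> set_pmf sel"
    have A': "A \<subseteq> {..<n}" "A \<noteq> {}" "finite A" using sel[OF A] finite_subset by blast+
    then have x: "arg_min_on q A < n" using arg_min_on_Min[of A q] by auto
    have "(\<integral>\<^sup>+w. rank_law V s (word_del w A) \<partial>word_measure (letters n q)) =
      (\<integral>\<^sup>+k. (\<integral>\<^sup>+w. rank_law V s w \<partial>word_measure (letters n (mq_move n q (arg_min_on q A) k))) \<partial>mq_hit n q (arg_min_on q A))"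
      by (rule nn_integral_word_del[OF Suc.prems A'(1,2) rank_law_measurable])
    also have "\<dots> = ?H A"
      using valid_mq_hit[OF Suc.prems x] by (intro nn_integral_cong_AE) (auto simp: AE_measure_pmf_iff Suc.IH)
    finally show "(\<integral>\<^sup>+w. rank_law V s (word_del w A) \<partial>word_measure (letters n q)) =
      ?H A" .
  qed
  also have "\<dots> = (\<integral>\<^sup>+p. emeasure (bind_pmf (mc_iter K s (return_pmf p)) rank_pmf) V \<partial>K q)"
    by (simp add: K_def)
  also have "\<dots> = emeasure (bind_pmf (mc_iter K (Suc s) (return_pmf q)) rank_pmf) V"
    unfolding mc_iter_Suc' bind_return_pmf
    by (subst (2) mc_iter_bind) (simp add: bind_assoc_pmf emeasure_bind_pmf[of "K q"])
  finally show ?case .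
qed

text \<open>Used to identify the normalising constant for the ratios k / n with the probability 1 /
  \<open>n ^ n\<close> of the prescribed letters at the \<open>n\<close> minima.\<close>

lemma prod_one_minus_frac: "(\<Prod>k=1..<n. 1 - real k / n) * (n ^ n) = fact n"
proof -
  have "(\<Prod>k=1..<n. 1 - real k / n) = (\<Prod>k=1..<n. real (n - k) / n)"
    using n by (intro prod.cong) (auto simp: of_nat_diff diff_divide_distrib)
  also have "\<dots> = (\<Prod>k=1..<n. real k / n)"
    by (rule prod.reindex_bij_witness[of _ "\<lambda>k. n - k" "\<lambda>k. n - k"]) auto
  also have "\<dots> = (\<Prod>k=1..<n. real k) / n ^ (n - 1)"
    by (simp add: prod_dividef)
  also have "(\<Prod>k=1..<n. real k) = fact (n - 1)"
  proof -
    have "{1..<n} = {1..n - 1}" using n by auto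
    then show ?thesis by (simp add: fact_prod)
  qed
  finally have "(\<Prod>k=1..<n. 1 - real k / n) * n ^ n = fact (n - 1) / n ^ (n - 1) * (n * n ^ (n - 1))"
    using n by (simp add: power_eq_if)
  also have "\<dots> = n * fact (n - 1)" using n by simp
  also have "\<dots> = fact n" using n by (simp add: fact_reduce[of n])
  finally show ?thesis .
qed

text \<open>In a uniform word the first occurrences behave as in coupon collecting: with
  \<open>k\<close> queues seen, the next letter is an old one with probability k / n. The box of
  \<open>q\<close> is the event that each queue \<open>y\<close> first occurs at
  \<open>q y\<close>.\<close>

lemma nn_integral_word_initial:
  assumes f: "f \<in> borel_measurable word_space"
  shows "(\<integral>\<^sup>+w. f w \<partial>word_measure (\<lambda>_. {..<n})) = (\<integral>\<^sup>+q. (\<integral>\<^sup>+w. f w \<partial>word_measure (letters n q)) \<partial>\<mu>0)"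
proof (rule word_mixture[OF _ _ _ _ _ _ f, where b = "\<lambda>q. Suc (Max (q ` {..<n}))"])
  fix q assume "q \<in> set_pmf \<mu>0"
  then have q: "mq_valid n q" by (simp add: set_\<mu>0)
  have inj: "inj_on q {..<n}" using q by (simp add: mq_valid_def)
  let ?B = "Suc (Max (q ` {..<n}))" and ?T = "q ` {..<n}"
  have B: "q y < ?B" if "y < n" for y using that by (auto simp: less_Suc_eq_le)
  show "letters n q t \<subseteq> {..<n}" for t by (auto simp: letters_def)
  show "letters n q t \<noteq> {}" for t by (rule letters_nonempty[OF q])
  show "letters n q t = {..<n}" if t: "?B \<le> t" for t
  proof -
    have lt: "q y < t" if "y < n" for y using B[OF that] t by simp
    then have "t \<notin> ?T" by (metis imageE lessThan_iff less_irrefl)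
    then show ?thesis using lt by (auto simp: letters_def)
  qed
  have cT: "card (letters n q t) = 1" if t: "t \<in> ?T" for t
  proof -
    obtain y where y: "y < n" "t = q y" using t by auto
    then have "letters n q t = {y}" using inj by (auto simp: letters_def inj_on_def)
    then show ?thesis by simp
  qed
  have cN: "card (letters n q t) = card (?T \<inter> {..<t})" if "t \<notin> ?T" for t
  proof -
    have "?T \<inter> {..<t} = q ` {y. y < n \<and> q y < t}" by auto
    then show ?thesis using that by (simp add: letters_def card_image inj_on_subset[OF inj] subset_iff)
  qed
  have "(\<Prod>t<?B. real (card (letters n q t)) / real (card {..<n})) = (\<Prod>t\<in>({..<?B} - ?T) \<union> ?T. real (card (letters n q t)) / n)"
    using B by (intro prod.cong) auto
  also have "\<dots> = (\<Prod>t\<in>{..<?B} - ?T. real (card (letters n q t)) / n) * (\<Prod>t\<in>?T. real (card (letters n q t)) / n)"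
    by (rule prod.union_disjoint) auto
  also have "(\<Prod>t\<in>{..<?B} - ?T. real (card (letters n q t)) / n) = tok_weight (\<lambda>k. k / n) ?T ?B"
    unfolding tok_weight_def by (intro prod.cong) (auto simp: cN)
  also have "(\<Prod>t\<in>?T. real (card (letters n q t)) / n) = (1 / n) ^ n"
    using card_image[OF inj] by (simp add: cT)
  also have "(1 / n) ^ n = mq_const n (\<lambda>k. k / n)"
    unfolding mq_const_def using prod_one_minus_frac n by (simp add: field_simps power_divide)
  finally show "pmf \<mu>0 q = (\<Prod>t<?B. real (card (letters n q t)) / real (card {..<n}))"
    by (simp only: pmf_\<mu>0[OF q B] mult.commute)
next
  fix q q' w
  assume q: "q \<in> set_pmf \<mu>0" and q': "q' \<in> set_pmf \<mu>0"
    and w: "\<And>t. t < Suc (Max (q ` {..<n})) \<Longrightarrow> w t \<in> letters n q t"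
    and w': "\<And>t. t < Suc (Max (q' ` {..<n})) \<Longrightarrow> w t \<in> letters n q' t"
  \<comment> \<open>The word determines the state, as \<open>q y\<close> is the first occurrence of
    \<open>y\<close>; hence the boxes are disjoint.\<close>
  have first: "(LEAST t. w t = y) = q y" if q: "mq_valid n q" and y: "y < n"
    and w: "\<And>t. t < Suc (Max (q ` {..<n})) \<Longrightarrow> w t \<in> letters n q t" for q y
  proof (rule Least_equality)
    have le: "q y \<le> Max (q ` {..<n})" using y by auto
    show "w (q y) = y"
      using w[of "q y"] le y q by (auto simp: letters_def mq_valid_def inj_on_def)
    fix t assume t: "w t = y"
    show "q y \<le> t"
    proof (rule ccontr)
      assume "\<not> q y \<le> t"
      then have "y \<in> letters n q t" using w[of t] t le by simp
      then show False using \<open>\<not> q y \<le> t\<close> by (auto simp: letters_def split: if_splits)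
    qed
  qed
  show "q = q'"
  proof
    fix y show "q y = q' y"
    proof (cases "y < n")
      case True
      then show ?thesis using first[of q y] first[of q' y] q q' w w' by (simp add: set_\<mu>0)
    next
      case False
      then show ?thesis using q q' by (simp add: set_\<mu>0 mq_valid_def)
    qed
  qed
qed simp

theorem nn_integral_rank_law_initial:
  "(\<integral>\<^sup>+w. rank_law V s w \<partial>word_measure (\<lambda>_. {..<n})) = emeasure (bind_pmf (mc_iter K s \<mu>0) rank_pmf) V"
proof -
  have "(\<integral>\<^sup>+w. rank_law V s w \<partial>word_measure (\<lambda>_. {..<n})) =
     (\<integral>\<^sup>+q. emeasure (bind_pmf (mc_iter K s (return_pmf q)) rank_pmf) V \<partial>\<mu>0)"
    unfolding nn_integral_word_initial[OF rank_law_measurable]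
    by (intro nn_integral_cong_AE) (auto simp: AE_measure_pmf_iff set_\<mu>0 nn_integral_rank_law)
  also have "\<dots> = emeasure (bind_pmf \<mu>0 (\<lambda>q. bind_pmf (mc_iter K s (return_pmf q)) rank_pmf)) V"
    by (rule emeasure_bind_pmf[symmetric])
  also have "bind_pmf \<mu>0 (\<lambda>q. bind_pmf (mc_iter K s (return_pmf q)) rank_pmf) = bind_pmf (mc_iter K s \<mu>0) rank_pmf"
    by (subst (2) mc_iter_bind) (simp add: bind_assoc_pmf)
  finally show ?thesis .
qed

end

section \<open>The Riemann sum\<close>

text \<open>On \<open>[0,1)\<close>, \<open>f_c = h (1 - x h) / (1 - h)\<close>. Since \<open>1 - h = (1 - x) u\<close> with a polynomial \<open>u > 0\<close>, this is
  \<open>h (1 + h / u)\<close>, where \<open>h\<close> and \<open>h / u\<close> are increasing.\<close>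

definition mq_h :: "nat \<Rightarrow> real \<Rightarrow> real \<Rightarrow> real" where
  "mq_h m e x = x ^ (m - 1) * (1 - e + e * x)"

definition mq_u :: "nat \<Rightarrow> real \<Rightarrow> real \<Rightarrow> real" where
  "mq_u m e x = (\<Sum>i<m - 1. x ^ i) + e * x ^ (m - 1)"

definition mq_F :: "nat \<Rightarrow> real \<Rightarrow> real \<Rightarrow> real" where
  "mq_F m e x = mq_h m e x * (1 + mq_h m e x / mq_u m e x)"

locale mq_analysis =
  fixes m :: nat and e :: real
  assumes m: "m \<ge> 1" and e0: "0 \<le> e" and e1: "e < 1" and me: "1 < m + e"
begin

lemma one_minus_h: "1 - mq_h m e x = (1 - x) * mq_u m e x"
proof -
  have "(1 - x) * mq_u m e x = (1 - x) * (\<Sum>i<m - 1. x ^ i) + (1 - x) * (e * x ^ (m - 1))"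
    by (simp add: mq_u_def distrib_left)
  also have "(1 - x) * (\<Sum>i<m - 1. x ^ i) = 1 - x ^ (m - 1)"
    by (simp add: one_diff_power_eq)
  finally show ?thesis by (simp add: mq_h_def algebra_simps)
qed

text \<open>For m = 1 this is the constant \<open>e\<close>, positive because m + e > 1; for larger
  \<open>m\<close> the sum contains the term 1.\<close>

lemma u_pos: "0 \<le> x \<Longrightarrow> 0 < mq_u m e x"
proof -
  assume x: "0 \<le> x"
  show ?thesis
  proof (cases "m = 1")
    case True then show ?thesis using me by (simp add: mq_u_def)
  next
    case False
    then have "(\<Sum>i<m - 1. x ^ i) \<ge> (\<Sum>i\<in>{0}. x ^ i)"
      using m x by (intro sum_mono2) auto
    then show ?thesis using e0 x by (simp add: mq_u_def add_pos_nonneg)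
  qed
qed

lemma h_nonneg: "0 \<le> x \<Longrightarrow> 0 \<le> mq_h m e x"
  using e0 e1 by (simp add: mq_h_def)

lemma h_mono: "0 \<le> x \<Longrightarrow> x \<le> y \<Longrightarrow> mq_h m e x \<le> mq_h m e y"
  unfolding mq_h_def using e0 e1 by (intro mult_mono power_mono add_left_mono mult_left_mono) auto

text \<open>After cross-multiplication it remains to compare \<open>x ^ (m - 1) * y ^ i\<close> with
  \<open>y ^ (m - 1) * x ^ i\<close> for i < m - 1; the linear factor of \<open>mq_h\<close> is
  monotone by itself.\<close>

lemma hu_mono:
  assumes "0 \<le> x" "x \<le> y"
  shows "mq_h m e x / mq_u m e x \<le> mq_h m e y / mq_u m e y"
proof -
  have 1: "x ^ (m - 1) * y ^ i \<le> y ^ (m - 1) * x ^ i" if "i < m - 1" for i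
  proof -
    have "x ^ (m - 1) * y ^ i = (x ^ i * y ^ i) * x ^ (m - 1 - i)"
      using that by (simp add: power_add[symmetric] mult.commute mult.left_commute)
    also have "\<dots> \<le> (x ^ i * y ^ i) * y ^ (m - 1 - i)"
      using assms by (intro mult_left_mono power_mono) auto
    also have "\<dots> = y ^ (m - 1) * x ^ i"
      using that by (simp add: power_add[symmetric] mult.commute mult.left_commute)
    finally show ?thesis .
  qed
  have "x ^ (m - 1) * mq_u m e y \<le> y ^ (m - 1) * mq_u m e x"
    unfolding mq_u_def distrib_left sum_distrib_left
    using 1 by (intro add_mono sum_mono) auto
  then have "x ^ (m - 1) * mq_u m e y * (1 - e + e * x) \<le> y ^ (m - 1) * mq_u m e x * (1 - e + e * y)"
    by (rule mult_mono) (use assms e0 e1 u_pos[of x] in \<open>auto intro!: mult_left_mono\<close>)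
  then have "mq_h m e x * mq_u m e y \<le> mq_h m e y * mq_u m e x"
    by (simp add: mq_h_def mult_ac)
  then show ?thesis
    using u_pos assms by (simp add: divide_le_eq pos_le_divide_eq)
qed

lemma hu_nonneg: "0 \<le> x \<Longrightarrow> 0 \<le> mq_h m e x / mq_u m e x"
  by (intro divide_nonneg_pos h_nonneg u_pos)

lemma F_nonneg: "0 \<le> x \<Longrightarrow> 0 \<le> mq_F m e x"
  unfolding mq_F_def using h_nonneg hu_nonneg by (intro mult_nonneg_nonneg) (auto simp: add_nonneg_nonneg)

lemma F_mono: "0 \<le> x \<Longrightarrow> x \<le> y \<Longrightarrow> mq_F m e x \<le> mq_F m e y"
  unfolding mq_F_def using hu_nonneg[of x] hu_mono[of x y]
  by (intro mult_mono h_mono h_nonneg add_left_mono) auto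

lemma hu_1: "mq_h m e 1 / mq_u m e 1 = 1 / (m + e - 1)"
  using m by (simp add: mq_h_def mq_u_def of_nat_diff algebra_simps)

text \<open>The limit of f_c at 1, where its formula reads 0 / 0. It becomes the error term c / (c -
  1).\<close>

lemma F_1: "mq_F m e 1 = (m + e) / (m + e - 1)"
  unfolding mq_F_def hu_1 using me by (simp add: mq_h_def field_simps)

lemma F_le: "0 \<le> x \<Longrightarrow> x \<le> 1 \<Longrightarrow> mq_F m e x \<le> mq_h m e x * ((m + e) / (m + e - 1))"
proof -
  assume x: "0 \<le> x" "x \<le> 1"
  have "1 + mq_h m e x / mq_u m e x \<le> (m + e) / (m + e - 1)"
    using hu_mono[OF x] me unfolding hu_1 by (simp add: field_simps)
  then show ?thesis unfolding mq_F_def using h_nonneg[OF x(1)] by (rule mult_left_mono)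
qed

lemma F_ge: "0 \<le> x \<Longrightarrow> mq_h m e x \<le> mq_F m e x"
  using mult_nonneg_nonneg[OF h_nonneg hu_nonneg, of x x] by (simp add: mq_F_def distrib_left)

lemma F_eq:
  assumes "0 \<le> x" "x < 1"
  shows "mq_h m e x * ((1 - x * mq_h m e x) / (1 - mq_h m e x)) = mq_F m e x"
proof -
  have "1 - x * mq_h m e x = (1 - mq_h m e x) + (1 - x) * mq_h m e x"
    by (simp add: algebra_simps)
  then show ?thesis
    using u_pos[of x] assms by (simp add: mq_F_def one_minus_h add_divide_distrib)
qed

lemma continuous_F: "continuous_on {0..1} (mq_F m e)"
proof -
  have "\<forall>x\<in>{0..1}. mq_u m e x \<noteq> 0" using u_pos by fastforce
  then show ?thesis
    unfolding mq_F_def mq_h_def mq_u_def by (intro continuous_intros) auto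
qed

end

lemma integral_mono_bounds:
  fixes F :: "real \<Rightarrow> real" and n k :: nat
  assumes F: "continuous_on {0..1} F" and mono: "\<And>x y. 0 \<le> x \<Longrightarrow> x \<le> y \<Longrightarrow> y \<le> 1 \<Longrightarrow> F x \<le> F y"
    and n: "n \<ge> 1" and k: "k \<le> n"
  shows "(\<Sum>j<k. F (j / n)) \<le> n * integral {0..k / n} F \<and> n * integral {0..k / n} F \<le> (\<Sum>j<k. F (Suc j / n))"
  using k
proof (induction k)
  case 0
  then show ?case by simp
next
  case (Suc k)
  let ?a = "k / n" and ?b = "Suc k / n"
  have ab: "0 \<le> ?a" "?a \<le> ?b" "?b \<le> 1" "?b - ?a = 1 / n"
    using Suc.prems n by (auto simp: field_simps divide_simps)
  have int: "F integrable_on {a..b}" if "0 \<le> a" "b \<le> 1" for a b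
    using that by (intro integrable_continuous_interval continuous_on_subset[OF F]) auto
  have 1: "integral {0..?b} F = integral {0..?a} F + integral {?a..?b} F"
    using ab by (intro Henstock_Kurzweil_Integration.integral_combine[symmetric] int) auto
  have "integral {?a..?b} (\<lambda>_. F ?a) \<le> integral {?a..?b} F"
    using ab by (intro integral_le int) (auto intro: mono)
  moreover have "integral {?a..?b} F \<le> integral {?a..?b} (\<lambda>_. F ?b)"
    using ab order_trans[OF ab(1)] by (intro integral_le int) (auto intro!: mono)
  ultimately have "F ?a \<le> n * integral {?a..?b} F" "n * integral {?a..?b} F \<le> F ?b"
    using ab n by (simp_all add: field_simps)
  then show ?case using Suc 1 by (simp add: distrib_left)
qed

section \<open>Elementary integrals and sums, and the bounds for the mean\<close>

lemma integral_power_01: "integral {0..1} (\<lambda>x::real. x ^ k) = 1 / (k + 1)"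
proof -
  have "((\<lambda>x::real. x ^ k) has_integral (1 ^ Suc k / Suc k - 0 ^ Suc k / Suc k)) {0..1}"
  proof (rule fundamental_theorem_of_calculus)
    fix x :: real
    have "DERIV (\<lambda>x. x ^ Suc k / Suc k) x :> x ^ k"
      by (intro derivative_eq_intros) auto
    then show "((\<lambda>x. x ^ Suc k / Suc k) has_vector_derivative x ^ k) (at x within {0..1})"
      by (simp add: has_real_derivative_iff_has_vector_derivative has_vector_derivative_at_within)
  qed simp
  then show ?thesis by (simp add: integral_unique)
qed

lemma sum_real_upto: "(\<Sum>j=1..<n. real j) = real n * (real n - 1) / 2" if "n \<ge> 1"
  using that by (induction n rule: dec_induct) (auto simp: field_simps)

lemma sum_real_sq_upto: "(\<Sum>j=1..<n. (real j)\<^sup>2) = (real n - 1) * real n * (2 * real n - 1) / 6" if "n \<ge> 1"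
  using that by (induction n rule: dec_induct) (auto simp: field_simps power2_eq_square)

text \<open>\<open>E\<close> runs over the interior nodes: it lacks the node 0 of the left Riemann
  sum, whose value is nonnegative, and the node 1 of the right one, which costs
  \<open>F 1\<close>.\<close>

lemma mq_bounds:
  fixes c :: real and n :: nat
  assumes c: "c > 1" and n: "n \<ge> 1"
  defines "E \<equiv> \<Sum>j=1..<n. mq_f c (real j / real n)"
  shows "c = 2 \<Longrightarrow> E = 5/6 * n - 1 + 1 / (6 * n)"
    and "0 < mq_eps c \<Longrightarrow> mq_eps c < 1 \<Longrightarrow> c = 1 + mq_eps c \<Longrightarrow>
        E = (1 / mq_eps c - mq_eps c / 6) * n - 1 / mq_eps c + mq_eps c / (6 * n)"
    and "n * (LBINT x=0..1. mq_f c x) - c / (c - 1) \<le> E"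
    and "E \<le> n * (LBINT x=0..1. mq_f c x)"
    and "c \<ge> 2 \<Longrightarrow> n / real_of_int \<lceil>c\<rceil> - c / (c - 1) \<le> E"
    and "c \<ge> 2 \<Longrightarrow> E \<le> n / (real_of_int \<lfloor>c\<rfloor> - 1)"
proof -
  define m where "m = mq_floor c"
  define e where "e = mq_eps c"
  have ce: "c = m + e"
    using c by (simp add: m_def e_def mq_floor_def mq_eps_def)
  interpret mq_analysis m e
    using c by unfold_locales (auto simp: ce[symmetric] m_def e_def mq_floor_def mq_eps_def le_nat_iff, linarith+)
  define F where "F = mq_F m e"
  have fF: "mq_f c x = F x" if "0 \<le> x" "x < 1" for x
  proof -
    have "x ^ m = x * x ^ (m - 1)"
      using m by (cases m) auto
    then show ?thesis
      using F_eq[OF that] unfolding F_def mq_f_def Let_def m_def[symmetric] e_def[symmetric]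
      by (simp add: mq_h_def mult.assoc)
  qed
  have EF: "E = (\<Sum>j=1..<n. F (real j / real n))"
    unfolding E_def using n by (intro sum.cong fF) auto
  have int: "F integrable_on {0..1}"
    unfolding F_def by (intro integrable_continuous_interval continuous_F)
  have I: "(LBINT x=0..1. mq_f c x) = integral {0..1} F"
  proof -
    \<comment> \<open>Equality is needed on the open interval only; at 1 the expression
      \<open>mq_f c\<close> divides by zero.\<close>
    have "(LBINT x=ereal 0..ereal 1. mq_f c x) = (LBINT x=ereal 0..ereal 1. F x)"
      by (intro interval_integral_cong) (auto simp: fF einterval_eq)
    also have "\<dots> = integral {0..1} F"
      unfolding F_def by (intro interval_integral_eq_integral borel_integrable_atLeastAtMost' continuous_F) auto
    finally show ?thesis by (simp add: zero_ereal_def one_ereal_def)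
  qed
  have R: "(\<Sum>j<n. F (j / n)) \<le> n * integral {0..1} F" "n * integral {0..1} F \<le> (\<Sum>j<n. F (Suc j / n))"
    using integral_mono_bounds[OF continuous_F F_mono n order_refl] n by (auto simp: F_def)
  have s1: "(\<Sum>j<n. F (j / n)) = F 0 + E"
    using n by (simp add: EF atLeast0LessThan[symmetric] sum.atLeast_Suc_lessThan)
  have s2: "(\<Sum>j<n. F (Suc j / n)) = E + F 1"
  proof -
    obtain k where k: "n = Suc k" using n by (cases n) auto
    have "(\<Sum>j<n. F (Suc j / n)) = (\<Sum>j<k. F (Suc j / n)) + F 1"
      using n by (simp add: k)
    also have "(\<Sum>j<k. F (Suc j / n)) = E"
      unfolding EF k using sum.shift_bounds_Suc_ivl[of "\<lambda>j. F (j / Suc k)" 0 k] by (simp add: atLeast0LessThan)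
    finally show ?thesis .
  qed
  show up: "E \<le> n * (LBINT x=0..1. mq_f c x)"
    using R(1) F_nonneg[of 0] unfolding s1 I by (simp add: F_def)
  show lo: "n * (LBINT x=0..1. mq_f c x) - c / (c - 1) \<le> E"
    using R(2) F_1 unfolding s2 I by (simp add: F_def ce)
  show "E = 5/6 * n - 1 + 1 / (6 * n)" if "c = 2"
  proof -
    have me: "m = 2" "e = 0" using that by (auto simp: m_def e_def mq_floor_def mq_eps_def)
    have "F x = x + x\<^sup>2" for x
      by (simp add: F_def mq_F_def mq_h_def mq_u_def me power2_eq_square distrib_left)
    then have EE: "E = (\<Sum>j=1..<n. real j) / n + (\<Sum>j=1..<n. (real j)\<^sup>2) / n\<^sup>2"
      by (simp add: EF sum.distrib sum_divide_distrib power_divide)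
    show ?thesis unfolding EE sum_real_upto[OF n] sum_real_sq_upto[OF n]
      using n by (simp add: power2_eq_square field_simps)
  qed
  show "E = (1 / mq_eps c - mq_eps c / 6) * n - 1 / mq_eps c + mq_eps c / (6 * n)"
    if "0 < mq_eps c" "mq_eps c < 1" "c = 1 + mq_eps c"
  proof -
    have e: "e > 0" using that(1) by (simp only: e_def)
    have "real m = 1" using that(3) ce unfolding e_def by linarith
    then have m1: "m = 1" by simp
    \<comment> \<open>For m = 1 the function \<open>mq_u\<close> is the constant \<open>e\<close>,
      so \<open>F\<close> is a quadratic polynomial and the sum has a closed form.\<close>
    have "F x = (1 - e) / e + (2 - e) * x + e * x\<^sup>2" for x
      using e by (simp add: F_def mq_F_def mq_h_def mq_u_def m1 field_simps power2_eq_square)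
    then have EE: "E = (real n - 1) * ((1 - e) / e) + (2 - e) * ((\<Sum>j=1..<n. real j) / n) + e * ((\<Sum>j=1..<n. (real j)\<^sup>2) / n\<^sup>2)"
      using n by (simp add: EF sum.distrib sum_divide_distrib power_divide sum_distrib_left of_nat_diff)
    show ?thesis unfolding e_def[symmetric] EE sum_real_upto[OF n] sum_real_sq_upto[OF n]
      using n e by (simp add: power2_eq_square field_simps)
  qed
  show "n / real_of_int \<lceil>c\<rceil> - c / (c - 1) \<le> E" if "c \<ge> 2"
  proof -
    \<comment> \<open>The exponent is chosen so that \<open>x ^ k\<close> lies below
      \<open>F\<close> and integrates to 1 / \<lceil>c\<rceil>.\<close>
    define k where "k = nat \<lceil>c\<rceil> - 1"
    have k: "real k + 1 = real_of_int \<lceil>c\<rceil>" using c by (simp add: k_def of_nat_diff) linarith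
    have "x ^ k \<le> F x" if x: "0 \<le> x" "x \<le> 1" for x
    proof -
      have "x ^ k \<le> mq_h m e x"
      proof (cases "e = 0")
        case True
        then have "\<lceil>c\<rceil> = int m" by (simp add: ce)
        then show ?thesis using True by (simp add: mq_h_def k_def)
      next
        case False
        then have "\<lceil>c\<rceil> = int m + 1" using e0 e1 by (simp add: ce ceiling_eq_iff)
        then have "k = Suc (m - 1)" using m by (simp add: k_def)
        moreover have "x \<le> 1 - e + e * x"
          using mult_right_mono[of e 1 "1 - x"] x e1 by (simp add: algebra_simps)
        ultimately show ?thesis using x unfolding mq_h_def by (simp add: mult.commute[of x] mult_left_mono)
      qed
      then show ?thesis using F_ge[OF x(1)] by (simp add: F_def)
    qed
    then have "integral {0..1} (\<lambda>x. x ^ k) \<le> integral {0..1} F"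
      by (intro integral_le int) (auto intro!: integrable_continuous_interval continuous_intros)
    then have "1 / real_of_int \<lceil>c\<rceil> \<le> integral {0..1} F"
      by (simp add: integral_power_01 k[symmetric] add.commute)
    then have "n * (1 / real_of_int \<lceil>c\<rceil>) \<le> n * integral {0..1} F"
      by (rule mult_left_mono) simp
    then show ?thesis using lo unfolding I by simp
  qed
  show "E \<le> n / (real_of_int \<lfloor>c\<rfloor> - 1)" if c2: "c \<ge> 2"
  proof -
    have m2: "m \<ge> 2" using c2 by (simp add: m_def mq_floor_def le_nat_iff le_floor_iff)
    have fm: "real_of_int \<lfloor>c\<rfloor> = m" using c by (simp add: m_def mq_floor_def)
    \<comment> \<open>The linear factor is at most 1 and c / (c - 1) decreases in \<open>c\<close>,
      so \<open>e\<close> can be replaced by 0; the bound integrates to 1 / (m - 1).\<close>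
    have "F x \<le> x ^ (m - 1) * (m / (m - 1))" if x: "0 \<le> x" "x \<le> 1" for x
    proof -
      have "F x \<le> mq_h m e x * ((m + e) / (m + e - 1))" unfolding F_def by (rule F_le[OF x])
      also have "\<dots> \<le> x ^ (m - 1) * (m / (m - 1))"
      proof (rule mult_mono)
        show "mq_h m e x \<le> x ^ (m - 1)"
          unfolding mq_h_def using x e0 mult_left_mono[of x 1 e] by (intro mult_left_le) auto
        show "(m + e) / (m + e - 1) \<le> m / real (m - 1)"
          using m2 e0 by (simp add: of_nat_diff field_simps)
      qed (use x m2 e0 in auto)
      finally show ?thesis .
    qed
    then have "integral {0..1} F \<le> integral {0..1} (\<lambda>x. x ^ (m - 1) * (m / (m - 1)))"
      by (intro integral_le int integrable_continuous_interval continuous_intros) (use m2 in auto)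
    also have "\<dots> = 1 / (real m - 1)"
      using m2 by (simp add: integral_power_01 of_nat_diff)
    finally have "n * integral {0..1} F \<le> n * (1 / (real m - 1))"
      by (rule mult_left_mono) simp
    then show ?thesis using up unfolding I fm by simp
  qed
qed

section \<open>From the MultiQueue to words\<close>

abbreviation iid_seq :: "'a pmf \<Rightarrow> (nat \<Rightarrow> 'a) measure" where
  "iid_seq p \<equiv> PiM UNIV (\<lambda>_. measure_pmf p)"

lemma nn_integral_PiM_prod:
  fixes p :: "'a pmf" and J :: "nat set"
  assumes J: "finite J"
  shows "(\<integral>\<^sup>+a. (\<Prod>t\<in>J. f t (a t)) \<partial>iid_seq p) = (\<Prod>t\<in>J. \<integral>\<^sup>+x. f t x \<partial>p)"
proof -
  interpret product_prob_space "\<lambda>_::nat. measure_pmf p" UNIV by unfold_locales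
  have "(\<integral>\<^sup>+a. (\<Prod>t\<in>J. f t (a t)) \<partial>iid_seq p) =
    (\<integral>\<^sup>+a. (\<Prod>t\<in>J. f t (restrict a J t)) \<partial>iid_seq p)"
    by (intro nn_integral_cong prod.cong) auto
  also have "\<dots> = (\<integral>\<^sup>+a. (\<Prod>t\<in>J. f t (a t)) \<partial>distr (iid_seq p) (PiM J (\<lambda>_. measure_pmf p)) (\<lambda>x. restrict x J))"
  proof -
    have m1: "(\<lambda>a. \<Prod>t\<in>J. f t (a t)) \<in> borel_measurable (PiM J (\<lambda>_. measure_pmf p))"
      by (intro borel_measurable_prod_ennreal measurable_compose[OF measurable_component_singleton[of _ J "\<lambda>_. measure_pmf p"]]) auto
    have m2: "(\<lambda>x. restrict x J) \<in> measurable (iid_seq p) (PiM J (\<lambda>_. measure_pmf p))"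
      by (rule measurable_restrict_subset) simp
    show ?thesis by (subst nn_integral_distr[OF m2]) (use m1 in simp_all)
  qed
  also have "\<dots> = (\<integral>\<^sup>+a. (\<Prod>t\<in>J. f t (a t)) \<partial>PiM J (\<lambda>_. measure_pmf p))"
    by (subst distr_PiM_restrict_finite[OF J]) auto
  also have "\<dots> = (\<Prod>t\<in>J. \<integral>\<^sup>+x. f t x \<partial>p)"
    by (rule product_nn_integral_prod[OF J]) simp
  finally show ?thesis .
qed

text \<open>The second type may be uncountable, and a product of discrete measurable spaces need not
  be discrete; countability of the first type allows its values to be treated one at a time.\<close>

lemma measurable_zip_seq:
  fixes p :: "'a::countable pmf" and r :: "'b pmf"
  shows "(\<lambda>x t. (fst x t, snd x t)) \<in> measurable (iid_seq p \<Otimes>\<^sub>M iid_seq r)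
     (iid_seq (pair_pmf p r))"
proof (rule measurable_abs_UNIV)
  fix t :: nat
  let ?N = "iid_seq p \<Otimes>\<^sub>M iid_seq r"
  have "(\<lambda>x. (fst x t, snd x t)) \<in> measurable ?N (count_space UNIV)"
  proof (rule measurable_compose_countable'[where f = "\<lambda>i x. (i, snd x t)" and g = "\<lambda>x. fst x t" and I = UNIV])
    have a: "(\<lambda>x. fst x t) \<in> measurable ?N (measure_pmf p)" by measurable
    then show "(\<lambda>x. fst x t) \<in> measurable ?N (count_space UNIV)" by simp
    have b: "(\<lambda>x. snd x t) \<in> measurable ?N (measure_pmf r)" by measurable
    show "(\<lambda>x. (i, snd x t)) \<in> measurable ?N (count_space UNIV)" for i :: 'a
      by (rule measurable_compose[OF b]) simp
  qed auto
  then show "(\<lambda>x. (fst x t, snd x t)) \<in> measurable ?N (measure_pmf (pair_pmf p r))" by simp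
qed

text \<open>\<open>mq_space\<close> interleaves queue assignments and deletion choices; this
  separates them into two independent sequences. For a fixed first sequence a cylinder event
  restricts finitely many coordinates of the second, and integrating over the first gives a product
  again.\<close>

lemma distr_zip_seq:
  fixes p :: "'a::countable pmf" and r :: "'b pmf"
  shows "distr (iid_seq p \<Otimes>\<^sub>M iid_seq r)
     (iid_seq (pair_pmf p r)) (\<lambda>x t. (fst x t, snd x t)) = iid_seq (pair_pmf p r)"
proof -
  let ?P = "iid_seq p" and ?R = "iid_seq r"
  interpret Q: product_prob_space "\<lambda>_::nat. measure_pmf (pair_pmf p r)" UNIV by unfold_locales
  interpret R: product_prob_space "\<lambda>_::nat. measure_pmf r" UNIV by unfold_locales
  show ?thesis
  proof (rule Q.PiM_eq)
    fix J :: "nat set" and E :: "nat \<Rightarrow> ('a \<times> 'b) set"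
    assume J: "finite J"
    let ?X = "prod_emb UNIV (\<lambda>_. measure_pmf (pair_pmf p r)) J (Pi\<^sub>E J E)"
    let ?Y = "(\<lambda>x t. (fst x t, snd x t)) -` ?X \<inter> space (?P \<Otimes>\<^sub>M ?R)"
    have X: "?X \<in> sets (iid_seq (pair_pmf p r))"
      using J by (intro sets_PiM_I) auto
    have Y: "?Y \<in> sets (?P \<Otimes>\<^sub>M ?R)" by (rule measurable_sets[OF measurable_zip_seq X])
    have slice: "Pair a -` ?Y = {b. \<forall>t\<in>J. b t \<in> {y. (a t, y) \<in> E t}}" for a
      by (auto simp: prod_emb_def PiE_iff space_pair_measure space_PiM)
    have "emeasure (distr (?P \<Otimes>\<^sub>M ?R) (iid_seq (pair_pmf p r)) (\<lambda>x t. (fst x t, snd x t))) ?X = emeasure (?P \<Otimes>\<^sub>M ?R) ?Y"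
      by (rule emeasure_distr[OF measurable_zip_seq X])
    also have "\<dots> = (\<integral>\<^sup>+a. emeasure ?R (Pair a -` ?Y) \<partial>?P)"
      by (rule R.emeasure_pair_measure_alt[OF Y])
    also have "\<dots> = (\<integral>\<^sup>+a. (\<Prod>t\<in>J. emeasure r {y. (a t, y) \<in> E t}) \<partial>?P)"
      unfolding slice using R.emeasure_PiM_Collect[of J "\<lambda>t. {y. (_ t, y) \<in> E t}"] J
      by (intro nn_integral_cong) (simp add: space_PiM R.emeasure_PiM_Collect[of J, simplified space_PiM, simplified])
    also have "\<dots> = (\<Prod>t\<in>J. \<integral>\<^sup>+x. emeasure r {y. (x, y) \<in> E t} \<partial>p)"
      by (rule nn_integral_PiM_prod[OF J])
    also have "\<dots> = (\<Prod>t\<in>J. emeasure (pair_pmf p r) (E t))"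
    proof (rule prod.cong[OF refl])
      fix t
      have "emeasure (pair_pmf p r) (E t) = (\<integral>\<^sup>+z. indicator (E t) z \<partial>pair_pmf p r)" by simp
      also have "\<dots> = (\<integral>\<^sup>+x. \<integral>\<^sup>+y. indicator (E t) (x, y) \<partial>r \<partial>p)" by (rule nn_integral_pair_pmf')
      also have "\<dots> = (\<integral>\<^sup>+x. emeasure r {y. (x, y) \<in> E t} \<partial>p)"
      proof (rule nn_integral_cong)
        fix x
        have "(\<lambda>y. indicator (E t) (x, y)) = (indicator {y. (x, y) \<in> E t} :: 'b \<Rightarrow> ennreal)" by (auto simp: indicator_def)
        then show "(\<integral>\<^sup>+y. indicator (E t) (x, y) \<partial>r) = emeasure r {y. (x, y) \<in> E t}" by simp
      qed
      finally show "(\<integral>\<^sup>+x. emeasure r {y. (x, y) \<in> E t} \<partial>p) = emeasure (pair_pmf p r) (E t)" by simp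
    qed
    finally show "emeasure (distr (?P \<Otimes>\<^sub>M ?R) (iid_seq (pair_pmf p r)) (\<lambda>x t. (fst x t, snd x t))) ?X =
      (\<Prod>t\<in>J. emeasure (pair_pmf p r) (E t))" .
  qed simp
qed

lemma distr_map_seq:
  fixes r :: "'b pmf" and h :: "'b \<Rightarrow> 'c"
  shows "distr (iid_seq r) (iid_seq (map_pmf h r)) (\<lambda>b t. h (b t)) = iid_seq (map_pmf h r)"
    and measurable_map_seq: "(\<lambda>b t. h (b t)) \<in> measurable (iid_seq r) (iid_seq (map_pmf h r))"
proof -
  let ?R = "iid_seq r" and ?S = "iid_seq (map_pmf h r)"
  interpret Q: product_prob_space "\<lambda>_::nat. measure_pmf (map_pmf h r)" UNIV by unfold_locales
  interpret R: product_prob_space "\<lambda>_::nat. measure_pmf r" UNIV by unfold_locales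
  show m: "(\<lambda>b t. h (b t)) \<in> measurable ?R ?S"
  proof (rule measurable_abs_UNIV)
    fix t :: nat
    have "(\<lambda>b. b t) \<in> measurable ?R (measure_pmf r)" by measurable
    then show "(\<lambda>b. h (b t)) \<in> measurable ?R (measure_pmf (map_pmf h r))" by (rule measurable_compose) simp
  qed
  show "distr ?R ?S (\<lambda>b t. h (b t)) = ?S"
  proof (rule Q.PiM_eq)
    fix J :: "nat set" and E :: "nat \<Rightarrow> 'c set"
    assume J: "finite J"
    let ?X = "prod_emb UNIV (\<lambda>_. measure_pmf (map_pmf h r)) J (Pi\<^sub>E J E)"
    have X: "?X \<in> sets ?S" using J by (intro sets_PiM_I) auto
    have pre: "(\<lambda>b t. h (b t)) -` ?X \<inter> space ?R = {b \<in> space ?R. \<forall>t\<in>J. b t \<in> h -` E t}"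
      by (auto simp: prod_emb_def PiE_iff space_PiM)
    have "emeasure ?R {b \<in> space ?R. \<forall>t\<in>J. b t \<in> h -` E t} = (\<Prod>t\<in>J. emeasure r (h -` E t))"
      by (rule R.emeasure_PiM_Collect) (use J in auto)
    then show "emeasure (distr ?R ?S (\<lambda>b t. h (b t))) ?X = (\<Prod>t\<in>J. emeasure (map_pmf h r) (E t))"
      by (simp only: emeasure_distr[OF m X] pre emeasure_map_pmf)
  qed simp
qed

text \<open>Appends deletions at the end, as \<open>mq_deleted\<close> does, whereas
  \<open>word_rank\<close> recurses on the first deletion; \<open>word_rank_iter\<close> reconciles
  the two.\<close>

definition word_iter :: "(nat \<Rightarrow> nat) \<Rightarrow> (nat \<Rightarrow> nat set) \<Rightarrow> nat \<Rightarrow> nat \<Rightarrow> nat" where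
  "word_iter w S s = rec_nat w (\<lambda>s v. word_del v (S s)) s"

lemma word_iter_simps [simp]:
  "word_iter w S 0 = w" "word_iter w S (Suc s) = word_del (word_iter w S s) (S s)"
  by (simp_all add: word_iter_def)

lemma word_iter_shift: "word_iter w S (Suc s) = word_iter (word_del w (S 0)) (\<lambda>t. S (Suc t)) s"
  by (induction s) simp_all

lemma word_rank_iter: "word_rank w S s = (LEAST k. word_iter w S s k \<in> S s)"
proof (induction s arbitrary: w S)
  case (Suc s)
  show ?case by (simp only: word_rank.simps Suc word_iter_shift)
qed simp

text \<open>The elements present, listed in increasing order by \<open>g\<close>, spell the word \<open>word_iter\<close>.\<close>

lemma mq_present_word:
  fixes \<omega> :: "nat \<Rightarrow> nat \<times> bool \<times> (nat \<Rightarrow> nat)"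
  assumes inf: "\<And>y N. y < n \<Longrightarrow> \<exists>t\<ge>N. fst (\<omega> t) = y"
    and S: "\<And>s. mq_selected c \<omega> s \<subseteq> {..<n} \<and> mq_selected c \<omega> s \<noteq> {}"
  shows "mq_rank_error c \<omega> s = word_rank (\<lambda>t. fst (\<omega> t)) (mq_selected c \<omega>) s"
proof -
  let ?a = "\<lambda>t. fst (\<omega> t)" and ?S = "mq_selected c \<omega>"
  let ?W = "word_iter ?a ?S"
  have key: "mq_rank_error c \<omega> s = (LEAST k. ?W s k \<in> ?S s) \<and>
      (\<exists>g. strict_mono g \<and> range g = - mq_deleted c \<omega> (Suc s) \<and> ?W (Suc s) = (\<lambda>k. ?a (g k)))"
    if g: "strict_mono g" "range g = - mq_deleted c \<omega> s" "?W s = (\<lambda>k. ?a (g k))" for s g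
  proof -
    let ?D = "mq_deleted c \<omega> s"
    have fin: "finite ?D" by (induction s) auto
    have gD: "g k \<notin> ?D" for k using g(2) by auto
    have sur: "\<exists>k. i = g k" if "i \<notin> ?D" for i using that g(2) by auto
    \<comment> \<open>Only finitely many elements are deleted while every queue receives infinitely
      many, so the \<open>LEAST\<close> in \<open>mq_del_elem\<close> has a witness.\<close>
    obtain y where y: "y \<in> ?S s" "y < n" using S[of s] by auto
    obtain N where N: "\<And>i. i \<in> ?D \<Longrightarrow> i < N" using fin finite_nat_set_iff_bounded by auto
    obtain t where t: "t \<ge> N" "?a t = y" using inf[OF y(2)] by blast
    then have "t \<notin> ?D" using N by force
    then obtain k where "t = g k" using sur by blast
    then have ex: "\<exists>k. ?W s k \<in> ?S s" using t y g(3) by auto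
    define e where "e = (LEAST k. ?W s k \<in> ?S s)"
    have e: "?W s e \<in> ?S s" unfolding e_def using ex by (rule LeastI_ex)
    have e_le: "e \<le> k" if "?W s k \<in> ?S s" for k unfolding e_def using that by (rule Least_le)
    have del: "mq_del_elem c \<omega> s ?D = g e"
      unfolding mq_del_elem_def
    proof (rule Least_equality)
      show "g e \<notin> ?D \<and> ?a (g e) \<in> ?S s" using gD e g(3) by auto
      fix i assume i: "i \<notin> ?D \<and> ?a i \<in> ?S s"
      then obtain k where k: "i = g k" using sur by blast
      then have "e \<le> k" using i g(3) by (intro e_le) auto
      then show "g e \<le> i" unfolding k by (simp add: strict_mono_less_eq[OF g(1)])
    qed
    \<comment> \<open>The present elements below \<open>g e\<close> are the first \<open>e\<close>
      entries of the list, so the rank error is the position \<open>e\<close>.\<close>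
    have "{i. i \<notin> ?D \<and> i < g e} = g ` {..<e}"
    proof (intro set_eqI iffI)
      fix i assume i: "i \<in> {i. i \<notin> ?D \<and> i < g e}"
      then obtain k where "i = g k" using sur by blast
      then show "i \<in> g ` {..<e}" using i by (auto simp: strict_mono_less[OF g(1)])
    qed (auto simp: gD strict_mono_less[OF g(1)])
    moreover have "card (g ` {..<e}) = e"
      using card_image[OF strict_mono_imp_inj_on[OF g(1)]] by simp
    ultimately have rank: "mq_rank_error c \<omega> s = e"
      by (simp add: mq_rank_error_def Let_def del)
    let ?g = "\<lambda>k. g (skip e k)"
    have "strict_mono ?g"
      by (auto simp: strict_mono_def strict_mono_less[OF g(1)] skip_def)
    moreover have "range ?g = - mq_deleted c \<omega> (Suc s)"
    proof -
      have "range (skip e) = - {e}"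
      proof (intro set_eqI iffI)
        fix v assume "v \<in> - {e}"
        then have "v = skip e (if v < e then v else v - 1)" by (auto simp: skip_def)
        then show "v \<in> range (skip e)" by blast
      qed auto
      then have "range ?g = g ` (- {e})" by (metis image_image)
      also have "\<dots> = range g - {g e}"
        using strict_mono_eq[OF g(1)] by auto
      finally show ?thesis using g(2) by (auto simp: del)
    qed
    moreover have "?W (Suc s) = (\<lambda>k. ?a (?g k))"
    proof
      fix k
      have "(\<exists>j\<le>k. ?W s j \<in> ?S s) \<longleftrightarrow> e \<le> k" using e e_le order_trans by blast
      then show "?W (Suc s) k = ?a (?g k)" by (auto simp: word_del_def skip_def g(3))
    qed
    ultimately show ?thesis using rank by (auto simp: e_def)
  qed
  have "\<exists>g. strict_mono g \<and> range g = - mq_deleted c \<omega> s \<and> ?W s = (\<lambda>k. ?a (g k))"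
  proof (induction s)
    case 0
    show ?case by (intro exI[of _ id]) (auto simp: strict_mono_def)
  next
    case (Suc s)
    then show ?case using key[of _ s] by blast
  qed
  then show ?thesis using key[of _ s] by (auto simp: word_rank_iter)
qed

text \<open>Missing a queue on \<open>k\<close> given positions has probability (1 - 1/n)^k, which
  tends to 0.\<close>

lemma AE_word_infinitely_often:
  assumes n: "n \<ge> 1"
  shows "AE w in word_measure (\<lambda>_. {..<n}). \<forall>y<n. \<forall>N. \<exists>t\<ge>N. w t = y"
proof -
  let ?M = "word_measure (\<lambda>_. {..<n})"
  interpret prob_space "?M" by (rule prob_space_word_measure)
  have "AE w in ?M. \<exists>t\<ge>N. w t = y" if y: "y < n" for y N
  proof (rule AE_I[of _ _ "{w. \<forall>t\<ge>N. w t \<noteq> y}"])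
    let ?Z = "{w. \<forall>t\<ge>N. w t \<noteq> y}"
    have "{w \<in> space word_space. \<forall>t\<ge>N. w t \<noteq> y} \<in> sets word_space" by measurable
    then show Z: "?Z \<in> sets (?M)" by (simp add: space_PiM sets_word_measure)
    have "measure (?M) ?Z \<le> (1 - 1 / n) ^ k" for k
    proof -
      let ?E = "{w. \<forall>t\<in>{N..<N + k}. w t \<in> - {y}}"
      have one: "emeasure (measure_pmf (pmf_of_set {..<n})) (- {y}) = ennreal (1 - 1 / real n)"
      proof -
        have "measure (measure_pmf (pmf_of_set {..<n})) (- {y}) = 1 - measure (measure_pmf (pmf_of_set {..<n})) {y}"
          using measure_pmf.prob_compl[of "{y}" "pmf_of_set {..<n}"] by (simp add: Compl_eq_Diff_UNIV)
        also have "measure (measure_pmf (pmf_of_set {..<n})) {y} = 1 / real n"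
          using y by (subst measure_pmf_single, subst pmf_of_set) auto
        finally show ?thesis by (simp add: measure_pmf.emeasure_eq_measure)
      qed
      have "emeasure (?M) ?E = ennreal ((1 - 1 / n) ^ k)"
        using n by (subst emeasure_word_measure_Collect) (auto simp: one ennreal_power)
      moreover have "?E \<in> sets (?M)"
      proof -
        have "{w \<in> space word_space. \<forall>t\<in>{N..<N + k}. w t \<noteq> y} \<in> sets word_space" by measurable
        then show ?thesis by (simp add: space_PiM sets_word_measure)
      qed
      then have "emeasure (?M) ?Z \<le> emeasure (?M) ?E"
        by (intro emeasure_mono) auto
      ultimately show ?thesis using n by (simp add: emeasure_eq_measure)
    qed
    moreover have "(\<lambda>k. (1 - 1 / real n) ^ k) \<longlonglongrightarrow> 0"
      using n by (intro LIMSEQ_realpow_zero) auto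
    ultimately have "measure (?M) ?Z \<le> 0"
      by (intro LIMSEQ_le_const[where X = "\<lambda>k. (1 - 1 / real n) ^ k"]) auto
    then show "emeasure (?M) ?Z = 0"
      by (simp add: emeasure_eq_measure measure_le_0_iff)
  qed auto
  then show ?thesis by (simp add: AE_all_countable)
qed

section \<open>The MultiQueue\<close>

definition mq_choice_pmf :: "real \<Rightarrow> nat \<Rightarrow> (bool \<times> (nat \<Rightarrow> nat)) pmf" where
  "mq_choice_pmf c n = pair_pmf (bernoulli_pmf (mq_eps c)) (Pi_pmf {..<mq_floor c + 1} 0 (\<lambda>_. pmf_of_set {..<n}))"

definition mq_chosen :: "real \<Rightarrow> bool \<times> (nat \<Rightarrow> nat) \<Rightarrow> nat set" where
  "mq_chosen c x = snd x ` {..<(if fst x then mq_floor c + 1 else mq_floor c)}"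

definition mq_sel_pmf :: "real \<Rightarrow> nat \<Rightarrow> nat set pmf" where
  "mq_sel_pmf c n = map_pmf (mq_chosen c) (mq_choice_pmf c n)"

text \<open>With y = 1 - k/n and m = \<lfloor>c\<rfloor> this is 1 - y^m (1 - \<epsilon> +
  \<epsilon> y), the index probability of the model, because 1 - \<epsilon> + \<epsilon> y = 1 -
  \<epsilon> k/n. Writing it with \<open>mq_h\<close> makes the estimates for f_c available.\<close>

definition mq_P :: "real \<Rightarrow> nat \<Rightarrow> nat \<Rightarrow> real" where
  "mq_P c n k = 1 - (1 - k / n) * mq_h (mq_floor c) (mq_eps c) (1 - k / n)"

lemma mq_eps_bounds: "0 \<le> mq_eps c" "mq_eps c < 1"
  by (simp_all add: mq_eps_def) linarith

lemma mq_floor_eps: "c > 1 \<Longrightarrow> c = mq_floor c + mq_eps c" "c > 1 \<Longrightarrow> mq_floor c \<ge> 1"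
  by (simp_all add: mq_floor_def mq_eps_def le_nat_iff)

lemma mq_analysis_floor_eps: "c > 1 \<Longrightarrow> mq_analysis (mq_floor c) (mq_eps c)"
  using mq_floor_eps[of c] mq_eps_bounds[of c] by unfold_locales auto

lemma mq_selected_eq: "mq_selected c \<omega> s = mq_chosen c (snd (\<omega> s))"
  by (simp add: mq_selected_def mq_chosen_def)

lemma mq_sel_pmf_set:
  assumes c: "c > 1" and n: "n \<ge> 1" and S: "S \<in> set_pmf (mq_sel_pmf c n)"
  shows "S \<subseteq> {..<n} \<and> S \<noteq> {}"
proof -
  obtain b ch where bc: "(b, ch) \<in> set_pmf (mq_choice_pmf c n)" "S = mq_chosen c (b, ch)"
    using S by (auto simp: mq_sel_pmf_def)
  have "ch \<in> set_pmf (Pi_pmf {..<mq_floor c + 1} 0 (\<lambda>_. pmf_of_set {..<n}))"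
    using bc(1) by (simp add: mq_choice_pmf_def)
  then have ch: "ch i < n" if "i < mq_floor c + 1" for i
    using that n by (subst (asm) set_Pi_pmf) (auto simp: PiE_dflt_def set_pmf_of_set lessThan_empty_iff)
  show ?thesis
    using ch mq_floor_eps(2)[OF c] unfolding bc(2) mq_chosen_def by (auto simp: lessThan_empty_iff)
qed

text \<open>The chosen queues are independent and each avoids \<open>B\<close> with probability
  \<open>y\<close>; averaging over the number of choices, \<open>m\<close> or \<open>m + 1\<close>,
  gives \<open>y * mq_h m e y\<close>.\<close>

lemma mq_sel_pmf_avoid:
  assumes c: "c > 1" and n: "n \<ge> 1" and B: "B \<subseteq> {..<n}"
  shows "measure (mq_sel_pmf c n) {S. S \<inter> B = {}} = 1 - mq_P c n (card B)"
proof -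
  define m where "m = mq_floor c"
  define e where "e = mq_eps c"
  define y where "y = 1 - real (card B) / n"
  let ?Q = "Pi_pmf {..<m + 1} 0 (\<lambda>_. pmf_of_set {..<n})"
  let ?X = "{x. mq_chosen c x \<inter> B = {}}"
  have e: "0 \<le> e" "e \<le> 1" using mq_eps_bounds[of c] by (auto simp: e_def)
  have cB: "card B \<le> n" using card_mono[OF _ B] by simp
  have y0: "0 \<le> y" using cB n by (simp add: y_def)
  have one: "measure (measure_pmf (pmf_of_set {..<n})) (- B) = y"
  proof -
    have "measure (measure_pmf (pmf_of_set {..<n})) (- B) = card ({..<n} \<inter> - B) / card {..<n}"
      using n by (subst measure_pmf_of_set) (auto simp: lessThan_empty_iff)
    also have "{..<n} \<inter> - B = {..<n} - B" by auto
    also have "card ({..<n} - B) = n - card B" using B finite_subset by (subst card_Diff_subset) auto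
    finally show ?thesis using n cB by (simp add: y_def of_nat_diff diff_divide_distrib)
  qed
  have Pi: "measure (?Q) {ch. ch ` {..<l} \<inter> B = {}} = y ^ l" if l: "l \<le> m + 1" for l
  proof -
    have eq: "{ch. ch ` {..<l} \<inter> B = {}} = Pi {..<m + 1} (\<lambda>i. if i < l then - B else UNIV)"
      using l by (fastforce simp: Pi_iff disjoint_iff split: if_splits)
    have "measure (?Q) {ch. ch ` {..<l} \<inter> B = {}}
       = (\<Prod>i<m + 1. measure (measure_pmf (pmf_of_set {..<n})) (if i < l then - B else UNIV))"
      unfolding eq by (rule measure_Pi_pmf_Pi) simp
    also have "\<dots> = (\<Prod>i<l. y)"
      using l measure_pmf.prob_space[of "pmf_of_set {..<n}"]
      by (intro prod.mono_neutral_cong_right) (auto simp: one)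
    finally show ?thesis by simp
  qed
  have "emeasure (mq_sel_pmf c n) {S. S \<inter> B = {}} = (\<integral>\<^sup>+x. indicator ?X x \<partial>mq_choice_pmf c n)"
    by (simp add: mq_sel_pmf_def vimage_def)
  also have "\<dots> = (\<integral>\<^sup>+b. \<integral>\<^sup>+ch. indicator ?X (b, ch) \<partial>?Q \<partial>bernoulli_pmf e)"
    by (simp add: mq_choice_pmf_def nn_integral_pair_pmf' m_def e_def)
  also have "\<dots> = (\<integral>\<^sup>+b. ennreal (y ^ (if b then m + 1 else m)) \<partial>bernoulli_pmf e)"
  proof (rule nn_integral_cong)
    fix b
    have "(\<integral>\<^sup>+ch. indicator ?X (b, ch) \<partial>?Q)
      = (\<integral>\<^sup>+ch. indicator {ch. ch ` {..<(if b then m + 1 else m)} \<inter> B = {}} ch \<partial>?Q)"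
      by (intro nn_integral_cong) (auto simp: indicator_def mq_chosen_def m_def)
    also have "\<dots> = ennreal (y ^ (if b then m + 1 else m))"
      by (simp only: nn_integral_indicator sets_measure_pmf UNIV_I measure_pmf.emeasure_eq_measure) (subst Pi, auto)
    finally show "(\<integral>\<^sup>+ch. indicator ?X (b, ch) \<partial>?Q) = ennreal (y ^ (if b then m + 1 else m))" .
  qed
  also have "\<dots> = ennreal (y ^ (m + 1) * e + y ^ m * (1 - e))"
    using e y0 by (subst nn_integral_bernoulli_pmf) (auto simp: ennreal_mult'[symmetric] ennreal_plus[symmetric] simp del: ennreal_plus)
  also have "y ^ (m + 1) * e + y ^ m * (1 - e) = y * mq_h m e y"
    using mq_floor_eps(2)[OF c] by (cases m) (auto simp: mq_h_def m_def[symmetric] algebra_simps)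
  finally have "measure (mq_sel_pmf c n) {S. S \<inter> B = {}} = y * mq_h m e y"
    using y0 e by (simp add: measure_def mq_h_def)
  then show ?thesis by (simp add: mq_P_def y_def m_def e_def)
qed

lemma multiqueue_mq:
  assumes c: "c > 1" and n: "n \<ge> 1"
  shows "multiqueue n (mq_sel_pmf c n) (mq_P c n)"
proof -
  define m where "m = mq_floor c"
  define e where "e = mq_eps c"
  interpret mq_analysis m e unfolding m_def e_def by (rule mq_analysis_floor_eps[OF c])
  show ?thesis
  proof
    show "n \<ge> 1" by fact
    show "S \<subseteq> {..<n} \<and> S \<noteq> {}" if "S \<in> set_pmf (mq_sel_pmf c n)" for S
      using mq_sel_pmf_set[OF c n that] .
    show "measure (mq_sel_pmf c n) {S. S \<inter> B = {}} = 1 - mq_P c n (card B)" if "B \<subseteq> {..<n}" for B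
      using mq_sel_pmf_avoid[OF c n that] .
    show "mq_P c n 0 = 0" by (simp add: mq_P_def mq_h_def)
    show "mq_P c n n = 1" using n by (simp add: mq_P_def)
    show "mq_P c n k < mq_P c n (Suc k)" if "k < n" for k
    proof -
      let ?y = "1 - real k / n" and ?z = "1 - real (Suc k) / n"
      have yz: "0 \<le> ?z" "?z < ?y" using that by (auto simp: field_simps)
      have "0 < mq_h m e ?y" using yz e0 e1 unfolding mq_h_def by (intro mult_pos_pos zero_less_power add_pos_nonneg) auto
      then have "?z * mq_h m e ?z < ?y * mq_h m e ?y"
        using h_mono[of ?z ?y] yz by (smt (verit) mult_left_mono mult_strict_right_mono)
      then show ?thesis by (simp add: mq_P_def m_def e_def)
    qed
    \<comment> \<open>Equivalent to \<open>mq_h m e ?y < 1\<close>, that is, to positivity of the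
      product of \<open>1 - ?y\<close> and \<open>mq_u m e ?y\<close>; c > 1 enters through
      \<open>u_pos\<close>.\<close>
    show "real k / real n < mq_P c n k" if "0 < k" "k < n" for k
    proof -
      let ?y = "1 - real k / n"
      have y: "0 < ?y" "?y < 1" using that by (auto simp: field_simps)
      have "mq_h m e ?y < 1"
        using one_minus_h[of ?y] u_pos[of ?y] mult_pos_pos[of "1 - ?y" "mq_u m e ?y"] y by simp
      then have "?y * mq_h m e ?y < ?y * 1" using y by (intro mult_strict_left_mono) auto
      then show ?thesis by (simp add: mq_P_def m_def e_def)
    qed
  qed
qed

text \<open>With y = 1 - j/n and h the value of \<open>mq_h\<close> at y, 1 - P j = y h and 1 -
  \<rho> j = y (1 - h) / (1 - y h), so the quotient is f_c(y). Reversing the order of summation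
  replaces y by j / n.\<close>

lemma mq_expectation_sum:
  assumes c: "c > 1" and n: "n \<ge> 1"
  shows "(\<Sum>j=1..<n. (1 - mq_P c n j) / (1 - multiqueue.\<rho> n (mq_P c n) j)) = (\<Sum>j=1..<n. mq_f c (real j / real n))"
proof -
  define m where "m = mq_floor c"
  define e where "e = mq_eps c"
  interpret mq_analysis m e unfolding m_def e_def by (rule mq_analysis_floor_eps[OF c])
  interpret multiqueue n "mq_sel_pmf c n" "mq_P c n" by (rule multiqueue_mq[OF c n])
  have "(1 - mq_P c n j) / (1 - \<rho> j) = mq_f c (real (n - j) / n)" if j: "j \<in> {1..<n}" for j
  proof -
    define y where "y = real (n - j) / n"
    have y_eq: "y = 1 - real j / n" using j by (simp add: y_def of_nat_diff diff_divide_distrib)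
    have y: "0 < y" "y < 1" using j by (auto simp: y_def)
    define h where "h = mq_h m e y"
    have P: "mq_P c n j = 1 - y * h" by (simp add: mq_P_def y_eq h_def m_def e_def)
    have Ppos: "0 < mq_P c n j" using P_pos[of j] j by auto
    have "\<rho> j = (1 - y) / (1 - y * h)" unfolding \<rho>_def P using y_eq by (simp add: divide_simps)
    then have "1 - \<rho> j = (y * (1 - h)) / (1 - y * h)"
      using Ppos by (simp add: P field_simps)
    then have "(1 - mq_P c n j) / (1 - \<rho> j) = (y * h) / ((y * (1 - h)) / (1 - y * h))"
      by (simp add: P)
    also have "\<dots> = h * ((1 - y * h) / (1 - h))"
      using y by simp
    also have "\<dots> = mq_f c y"
    proof -
      have "y ^ m = y * y ^ (m - 1)" using m by (cases m) auto
      then show ?thesis unfolding mq_f_def Let_def m_def[symmetric] e_def[symmetric] h_def mq_h_def by (simp add: mult.assoc)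
    qed
    finally show ?thesis by (simp add: y_def)
  qed
  then have "(\<Sum>j=1..<n. (1 - mq_P c n j) / (1 - \<rho> j)) = (\<Sum>j=1..<n. mq_f c (real (n - j) / n))"
    by (intro sum.cong) auto
  also have "\<dots> = (\<Sum>j=1..<n. mq_f c (real j / real n))"
    by (rule sum.reindex_bij_witness[of _ "\<lambda>k. n - k" "\<lambda>k. n - k"]) auto
  finally show ?thesis .
qed

section \<open>Measurability of the rank error and its law after finitely many deletions\<close>

lemma measurable_mq_coord: "(\<lambda>\<omega>. f (\<omega> t)) \<in> measurable (mq_space c n) (count_space UNIV)"
proof -
  have "(\<lambda>\<omega>. \<omega> t) \<in> measurable (mq_space c n) (measure_pmf (mq_step_pmf c n))"
    unfolding mq_space_def by measurable
  then show ?thesis by (rule measurable_compose) simp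
qed

lemma pred_mq_deleted [measurable]: "Measurable.pred (mq_space c n) (\<lambda>\<omega>. j \<in> mq_deleted c \<omega> s)"
  and measurable_mq_del_elem [measurable]:
    "(\<lambda>\<omega>. mq_del_elem c \<omega> s (mq_deleted c \<omega> s)) \<in> measurable (mq_space c n) (count_space UNIV)"
proof -
  have [measurable]: "Measurable.pred (mq_space c n) (\<lambda>\<omega>. fst (\<omega> j) \<in> mq_selected c \<omega> s)" for j s
  proof -
    have "(\<lambda>\<omega>. fst (\<omega> j) \<in> mq_selected c \<omega> s) = (\<lambda>\<omega>. \<exists>i. fst (\<omega> j) = i \<and> i \<in> mq_chosen c (snd (\<omega> s)))"
      by (auto simp: mq_selected_eq)
    also have "Measurable.pred (mq_space c n) \<dots>"
      using measurable_mq_coord[of "\<lambda>x. fst x = _" j c n] measurable_mq_coord[of "\<lambda>x. _ \<in> mq_chosen c (snd x)" s c n]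
      by (intro pred_intros_countable pred_intros_logic)
    finally show ?thesis .
  qed
  have step: "(\<lambda>\<omega>. mq_del_elem c \<omega> s (mq_deleted c \<omega> s)) \<in> measurable (mq_space c n) (count_space UNIV)"
    if [measurable]: "\<And>j. Measurable.pred (mq_space c n) (\<lambda>\<omega>. j \<in> mq_deleted c \<omega> s)" for s
    unfolding mq_del_elem_def by measurable
  have del: "Measurable.pred (mq_space c n) (\<lambda>\<omega>. j \<in> mq_deleted c \<omega> s)" for j s
  proof (induction s arbitrary: j)
    case 0
    then show ?case by simp
  next
    case (Suc s)
    note [measurable] = Suc step[OF Suc]
    have "Measurable.pred (mq_space c n) (\<lambda>\<omega>. j = mq_del_elem c \<omega> s (mq_deleted c \<omega> s) \<or> j \<in> mq_deleted c \<omega> s)"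
      by measurable
    then show ?case by simp
  qed
  show "Measurable.pred (mq_space c n) (\<lambda>\<omega>. j \<in> mq_deleted c \<omega> s)" by (rule del)
  show "(\<lambda>\<omega>. mq_del_elem c \<omega> s (mq_deleted c \<omega> s)) \<in> measurable (mq_space c n) (count_space UNIV)"
    by (rule step[OF del])
qed

text \<open>For a fixed bound \<open>d\<close> the count is measurable by induction on
  \<open>d\<close>; the deleted element takes countably many values and is then substituted for
  \<open>d\<close>.\<close>

lemma measurable_mq_rank_error [measurable]:
  "(\<lambda>\<omega>. mq_rank_error c \<omega> s) \<in> measurable (mq_space c n) (count_space UNIV)"
proof -
  let ?X = "\<lambda>\<omega> d. {i. i \<notin> mq_deleted c \<omega> s \<and> i < d}"
  have card: "(\<lambda>\<omega>. card (?X \<omega> d)) \<in> measurable (mq_space c n) (count_space UNIV)" for d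
  proof (induction d)
    case (Suc d)
    have "card {i. i \<notin> mq_deleted c \<omega> s \<and> i < Suc d} =
      (if d \<in> mq_deleted c \<omega> s then card (?X \<omega> d) else Suc (card (?X \<omega> d)))" for \<omega>
    proof -
      have "{i. i \<notin> mq_deleted c \<omega> s \<and> i < Suc d} = (if d \<in> mq_deleted c \<omega> s then (?X \<omega> d) else insert d (?X \<omega> d))"
        by (auto simp: less_Suc_eq)
      then show ?thesis by auto
    qed
    moreover note [measurable] = Suc
    ultimately show ?case by simp
  qed simp
  show ?thesis unfolding mq_rank_error_def Let_def
    by (rule measurable_compose_countable[OF card measurable_mq_del_elem])
qed

text \<open>For almost every assignment each queue receives infinitely many elements; there
  \<open>mq_present_word\<close> identifies the rank error with \<open>word_rank\<close>. Averaging
  over the choices gives \<open>rank_law\<close>, and averaging that over uniform words gives the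
  chain started in \<open>\<mu>0\<close>.\<close>

lemma emeasure_mq_rank_error:
  assumes c: "c > 1" and n: "n \<ge> 1"
  shows "emeasure (mq_space c n) {\<omega> \<in> space (mq_space c n). mq_rank_error c \<omega> s \<in> V} =
    emeasure (bind_pmf (mc_iter (multiqueue.K n (mq_sel_pmf c n)) s (multiqueue.\<mu>0 n)) (multiqueue.rank_pmf (mq_sel_pmf c n))) V"
proof -
  interpret multiqueue n "mq_sel_pmf c n" "mq_P c n" by (rule multiqueue_mq[OF c n])
  let ?A = "iid_seq (pmf_of_set {..<n})" and ?R = "iid_seq (mq_choice_pmf c n)"
  interpret R: product_prob_space "\<lambda>_::nat. measure_pmf (mq_choice_pmf c n)" UNIV by unfold_locales
  have step: "mq_step_pmf c n = pair_pmf (pmf_of_set {..<n}) (mq_choice_pmf c n)"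
    by (simp add: mq_step_pmf_def mq_choice_pmf_def)
  have A: "?A = word_measure (\<lambda>_. {..<n})" by (simp add: word_measure_def)
  define ind :: "(nat \<Rightarrow> nat \<times> bool \<times> (nat \<Rightarrow> nat)) \<Rightarrow> ennreal" where "ind \<omega> = indicator V (mq_rank_error c \<omega> s)" for \<omega>
  have ind[measurable]: "ind \<in> borel_measurable (mq_space c n)"
    unfolding ind_def by (rule measurable_compose[OF measurable_mq_rank_error]) simp
  have "emeasure (mq_space c n) {\<omega> \<in> space (mq_space c n). mq_rank_error c \<omega> s \<in> V} = (\<integral>\<^sup>+\<omega>. ind \<omega> \<partial>mq_space c n)"
  proof -
    have "(\<integral>\<^sup>+\<omega>. ind \<omega> \<partial>mq_space c n) = (\<integral>\<^sup>+\<omega>. indicator {\<omega> \<in> space (mq_space c n). mq_rank_error c \<omega> s \<in> V} \<omega> \<partial>mq_space c n)"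
      by (intro nn_integral_cong) (auto simp: ind_def indicator_def)
    also have "\<dots> = emeasure (mq_space c n) {\<omega> \<in> space (mq_space c n). mq_rank_error c \<omega> s \<in> V}"
      by (intro nn_integral_indicator) measurable
    finally show ?thesis by simp
  qed
  also have "\<dots> = (\<integral>\<^sup>+\<omega>. ind \<omega> \<partial>distr (?A \<Otimes>\<^sub>M ?R) (mq_space c n) (\<lambda>x t. (fst x t, snd x t)))"
    unfolding mq_space_def step by (simp only: distr_zip_seq)
  also have "\<dots> = (\<integral>\<^sup>+x. ind (\<lambda>t. (fst x t, snd x t)) \<partial>(?A \<Otimes>\<^sub>M ?R))"
  proof -
    have "(\<lambda>x t. (fst x t, snd x t)) \<in> measurable (?A \<Otimes>\<^sub>M ?R) (mq_space c n)"
      unfolding mq_space_def step by (rule measurable_zip_seq)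
    then show ?thesis by (subst nn_integral_distr) (use ind in simp_all)
  qed
  also have "\<dots> = (\<integral>\<^sup>+a. \<integral>\<^sup>+b. ind (\<lambda>t. (a t, b t)) \<partial>?R \<partial>?A)"
  proof -
    have "(\<lambda>x. ind (\<lambda>t. (fst x t, snd x t))) \<in> borel_measurable (?A \<Otimes>\<^sub>M ?R)"
      by (rule measurable_compose[OF measurable_zip_seq]) (use ind in \<open>simp add: mq_space_def step\<close>)
    from R.nn_integral_fst[OF this] show ?thesis by simp
  qed
  also have "\<dots> = (\<integral>\<^sup>+a. rank_law V s a \<partial>?A)"
  proof (rule nn_integral_cong_AE)
    have AE_b: "AE b in ?R. \<forall>t. b t \<in> set_pmf (mq_choice_pmf c n)"
      unfolding AE_all_countable by (intro allI AE_PiM_component) (auto simp: prob_space_measure_pmf AE_measure_pmf)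
    have eq: "(\<integral>\<^sup>+b. ind (\<lambda>t. (a t, b t)) \<partial>?R) = rank_law V s a" if a: "\<forall>y<n. \<forall>N. \<exists>t\<ge>N. a t = y" for a
    proof -
      have "ind (\<lambda>t. (a t, b t)) = indicator V (word_rank a (\<lambda>t. mq_chosen c (b t)) s)"
        if b: "\<forall>t. b t \<in> set_pmf (mq_choice_pmf c n)" for b
      proof -
        let ?w = "\<lambda>t. (a t, b t)"
        have "mq_selected c ?w t \<subseteq> {..<n} \<and> mq_selected c ?w t \<noteq> {}" for t
          unfolding mq_selected_eq using b by (intro mq_sel_pmf_set[OF c n]) (auto simp: mq_sel_pmf_def)
        then have "mq_rank_error c ?w s = word_rank (\<lambda>t. fst (?w t)) (mq_selected c ?w) s"
          using a by (intro mq_present_word[of n]) auto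
        moreover have "mq_selected c ?w = (\<lambda>t. mq_chosen c (b t))" by (auto simp: mq_selected_eq)
        ultimately show ?thesis by (simp add: ind_def)
      qed
      then have "(\<integral>\<^sup>+b. ind (\<lambda>t. (a t, b t)) \<partial>?R) = (\<integral>\<^sup>+b. indicator V (word_rank a (\<lambda>t. mq_chosen c (b t)) s) \<partial>?R)"
        using AE_b by (intro nn_integral_cong_AE) auto
      also have "\<dots> = (\<integral>\<^sup>+S. indicator V (word_rank a S s) \<partial>distr ?R sel_seq (\<lambda>b t. mq_chosen c (b t)))"
      proof -
        have "(\<lambda>b t. mq_chosen c (b t)) \<in> measurable ?R sel_seq"
          unfolding sel_seq_def unfolding mq_sel_pmf_def by (rule measurable_map_seq)
        moreover have "(\<lambda>S. indicator V (word_rank a S s) :: ennreal) \<in> borel_measurable sel_seq"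
          using measurable_compose[OF measurable_Pair1'[of a word_space sel_seq] word_rank_ind_measurable[of V s]]
          by (simp add: space_PiM)
        ultimately show ?thesis by (subst nn_integral_distr) simp_all
      qed
      also have "distr ?R sel_seq (\<lambda>b t. mq_chosen c (b t)) = sel_seq"
        unfolding sel_seq_def unfolding mq_sel_pmf_def by (rule distr_map_seq)
      finally show ?thesis by (simp add: rank_law_def)
    qed
    show "AE a in ?A. (\<integral>\<^sup>+b. ind (\<lambda>t. (a t, b t)) \<partial>?R) = rank_law V s a"
      using AE_word_infinitely_often[OF n] unfolding A by eventually_elim (rule eq)
  qed
  also have "\<dots> = emeasure (bind_pmf (mc_iter K s \<mu>0) rank_pmf) V"
    unfolding A by (rule nn_integral_rank_law_initial)
  finally show ?thesis .
qed

theorem theorem3: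
  fixes c :: real and n :: nat
  assumes "c > 1" and "n \<ge> 1"
  shows "\<exists>M. real_distribution M \<and>
     weak_conv_m (\<lambda>s. distr (mq_space c n) borel (\<lambda>\<omega>. real (mq_rank_error c \<omega> s))) M \<and>
     integrable M (\<lambda>x. x) \<and>
     (c = 2 \<longrightarrow> (\<integral>x. x \<partial>M) = 5/6 * n - 1 + 1 / (6 * n)) \<and>
     (0 < mq_eps c \<and> mq_eps c < 1 \<and> c = 1 + mq_eps c \<longrightarrow>
        (\<integral>x. x \<partial>M) = (1 / mq_eps c - mq_eps c / 6) * n - 1 / mq_eps c + mq_eps c / (6 * n)) \<and>
     (n * (LBINT x=0..1. mq_f c x) - c / (c - 1) \<le> (\<integral>x. x \<partial>M) \<and>
        (\<integral>x. x \<partial>M) \<le> n * (LBINT x=0..1. mq_f c x)) \<and>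
     (c \<ge> 2 \<longrightarrow> n / real_of_int \<lceil>c\<rceil> - c / (c - 1) \<le> (\<integral>x. x \<partial>M) \<and>
        (\<integral>x. x \<partial>M) \<le> n / (real_of_int \<lfloor>c\<rfloor> - 1))"
proof -
  interpret multiqueue n "mq_sel_pmf c n" "mq_P c n" by (rule multiqueue_mq[OF assms])
  define \<nu> where "\<nu> = bind_pmf \<pi> rank_pmf"
  define M where "M = distr (measure_pmf \<nu>) borel real"
  define E where "E = (\<Sum>j=1..<n. mq_f c (real j / real n))"
  have M: "real_distribution M"
    unfolding M_def by (rule prob_space.real_distribution_distr[OF prob_space_measure_pmf]) simp
  have cdf_s: "measure (distr (mq_space c n) borel (\<lambda>\<omega>. real (mq_rank_error c \<omega> s))) {..x} =
      measure (bind_pmf (mc_iter K s \<mu>0) rank_pmf) {v. real v \<le> x}" for s x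
  proof -
    have "(\<lambda>\<omega>. real (mq_rank_error c \<omega> s)) \<in> borel_measurable (mq_space c n)"
      by (rule measurable_compose[OF measurable_mq_rank_error]) simp
    then have "measure (distr (mq_space c n) borel (\<lambda>\<omega>. real (mq_rank_error c \<omega> s))) {..x} =
      measure (mq_space c n) {\<omega> \<in> space (mq_space c n). mq_rank_error c \<omega> s \<in> {v. real v \<le> x}}"
      by (subst measure_distr) (auto intro!: arg_cong[where f = "measure (mq_space c n)"])
    then show ?thesis
      by (simp only: measure_def emeasure_mq_rank_error[OF assms])
  qed
  have cdf_M: "measure M {..x} = measure \<nu> {v. real v \<le> x}" for x
    unfolding M_def by (subst measure_distr) (auto intro!: arg_cong[where f = "measure \<nu>"])
  \<comment> \<open>The distribution functions converge at every \<open>x\<close>, not only at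
    continuity points of the limit.\<close>
  have conv: "weak_conv_m (\<lambda>s. distr (mq_space c n) borel (\<lambda>\<omega>. real (mq_rank_error c \<omega> s))) M"
    unfolding weak_conv_m_def weak_conv_def cdf_def cdf_s cdf_M \<nu>_def using rank_convergence by blast
  have nn: "(\<integral>\<^sup>+v. ennreal (real v) \<partial>\<nu>) = ennreal E"
    unfolding \<nu>_def E_def nn_integral_rank_stationary by (simp only: mq_expectation_sum[OF assms])
  have E0: "0 \<le> E"
    unfolding E_def mq_expectation_sum[OF assms, symmetric]
    using \<rho>_bounds P_le_1 by (intro sum_nonneg divide_nonneg_nonneg) (auto simp: less_imp_le)
  have int: "integrable \<nu> real"
    by (intro integrableI_nonneg) (auto simp: nn)
  have EM: "(\<integral>x. x \<partial>M) = E"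
  proof -
    have "(\<integral>x. x \<partial>M) = (\<integral>v. real v \<partial>\<nu>)" unfolding M_def by (subst integral_distr) auto
    also have "\<dots> = E" using E0 by (subst integral_eq_nn_integral) (auto simp: nn)
    finally show ?thesis .
  qed
  have intM: "integrable M (\<lambda>x. x)"
    unfolding M_def by (subst integrable_distr_eq) (auto intro: int)
  note b = mq_bounds[OF assms, folded E_def]
  show ?thesis
    by (intro exI[of _ M] conjI M conv intM impI; (unfold EM)?; (elim conjE)?; rule b; assumption?)
qed

end
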